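(* Let $\vec p=(1,p_2)$ and $\vec q=(q_1,q_2)$ satisfy $1<p_2\le q_-\le q_+<\infty$, and let $\vec a,\vec b,\vec c\in\mathbb{R}^2$, $\vec\alpha,\vec\beta\in(-1,\infty)^2$. Then the following are equivalent: (1) $S_{\vec a,\vec b,\vec c}$ is bounded from $L^{\vec p}_{\vec\alpha}(T_B\times T_B)$ to $L^{\vec q}_{\vec\beta}(T_B\times T_B)$; (2) $T_{\vec a,\vec b,\vec c}$ is bounded from $L^{\vec p}_{\vec\alpha}(T_B\times T_B)$ to $L^{\vec q}_{\vec\beta}(T_B\times T_B)$; (3) $\alpha_1<b_1$, $\alpha_2+1<p_2(b_2+1)$, and for each $i\in\{1,2\}$: $-q_ia_i<\beta_i+1$ and $c_i=n+1+a_i+b_i+\lambda_i$, where $\lambda_1=\frac{n+1+\beta_1}{q_1}-(n+1+\alpha_1)$ and $\lambda_2=\frac{n+1+\beta_2}{q_2}-\frac{n+1+\alpha_2}{p_2}$.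
   Context: Let $n$ be a positive integer. For $z=(z_1,\dots,z_n)\in\mathbb{C}^n$ write $z=x+iy$ with $x,y\in\mathbb{R}^n$, $z'=(z_1,\dots,z_{n-1})$, $y'=(y_1,\dots,y_{n-1})$. Let $B=\{y\in\mathbb{R}^n: |y'|^2<y_n\}$ and $T_B=\{x+iy: x\in\mathbb{R}^n, y\in B\}$. For $z\in T_B$ put $\rho(z)=y_n-|y'|^2>0$, and for $z,u\in T_B$ put $\rho(z,u)=\frac14\big(\sum_{j=1}^{n-1}(z_j-\overline{u_j})^2-2i(z_n-\overline{u_n})\big)$; this has positive real part, and complex powers $\rho(z,u)^c$ are taken with the principal branch. $dV$ is Lebesgue measure on $\mathbb{C}^n$ and $dV_\alpha(z)=\rho(z)^\alpha dV(z)$. For $\vec p=(p_1,p_2)\in[1,\infty]^2$ and $\vec\alpha=(\alpha_1,\alpha_2)$, $L^{\vec p}_{\vec\alpha}(T_B\times T_B)$ is the space of measurable $f$ on $T_B\times T_B$ with finite mixed norm $\|f\|_{\vec p,\vec\alpha}=\big\{\int_{T_B}\big(\int_{T_B}|f(z,w)|^{p_1}dV_{\alpha_1}(z)\big)^{p_2/p_1}dV_{\alpha_2}(w)\big\}^{1/p_2}$, with the inner (resp. outer) integral replaced by an essential supremum in $z$ (resp. $w$) when $p_1=\infty$ (resp. $p_2=\infty$); when $\vec p=(\infty,\infty)$ this is $L^\infty(T_B\times T_B)$. Write $p_-=\min\{p_1,p_2\}$, $p_+=\max\{p_1,p_2\}$, and similarly $q_\pm$. For $\vec a=(a_1,a_2),\vec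 b=(b_1,b_2),\vec c=(c_1,c_2)\in\mathbb{R}^2$, $T_{\vec a,\vec b,\vec c}f(z,w)=\rho(z)^{a_1}\rho(w)^{a_2}\int_{T_B}\int_{T_B}\frac{\rho(u)^{b_1}\rho(\eta)^{b_2}}{\rho(z,u)^{c_1}\rho(w,\eta)^{c_2}}f(u,\eta)\,dV(u)\,dV(\eta)$ and $S_{\vec a,\vec b,\vec c}f(z,w)=\rho(z)^{a_1}\rho(w)^{a_2}\int_{T_B}\int_{T_B}\frac{\rho(u)^{b_1}\rho(\eta)^{b_2}}{|\rho(z,u)|^{c_1}|\rho(w,\eta)|^{c_2}}f(u,\eta)\,dV(u)\,dV(\eta)$. An operator is bounded from $X$ to $Y$ if for every $f\in X$ the defining integral converges for a.e. $(z,w)$ and $\|Tf\|_Y\le C\|f\|_X$ with $C$ independent of $f$. *)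

theory Defs
  imports "HOL-Analysis.Analysis"
begin

text \<open>Points of C^n are vectors complex^'n; the index k :: 'n plays the role of the
  distinguished last coordinate z_n, the remaining coordinates form z'.\<close>

definition TB :: "'n::finite \<Rightarrow> (complex^'n) set" where
  "TB k = {z. (\<Sum>j\<in>UNIV-{k}. (Im (z$j))^2) < Im (z$k)}"

definition rho :: "'n::finite \<Rightarrow> complex^'n \<Rightarrow> real" where
  "rho k z = Im (z$k) - (\<Sum>j\<in>UNIV-{k}. (Im (z$j))^2)"

definition rho2 :: "'n::finite \<Rightarrow> complex^'n \<Rightarrow> complex^'n \<Rightarrow> complex" where
  "rho2 k z u = ((\<Sum>j\<in>UNIV-{k}. (z$j - cnj (u$j))^2) - 2 * \<i> * (z$k - cnj (u$k))) / 4"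

text \<open>Real power of an extended nonnegative real (used with positive exponents).\<close>
definition epow :: "ennreal \<Rightarrow> real \<Rightarrow> ennreal" where
  "epow x r = (if x = \<infinity> then \<infinity> else ennreal (enn2real x powr r))"

definition mixnorm :: "'n::finite \<Rightarrow> real \<times> real \<Rightarrow> real \<times> real
    \<Rightarrow> (complex^'n \<Rightarrow> complex^'n \<Rightarrow> complex) \<Rightarrow> ennreal" where
  "mixnorm k p alpha f =
     epow (\<integral>\<^sup>+ w. indicator (TB k) w *
              epow (\<integral>\<^sup>+ z. indicator (TB k) z *
                     ennreal (norm (f z w) powr fst p * rho k z powr fst alpha) \<partial>lborel)
                   (snd p / fst p)
              * ennreal (rho k w powr snd alpha) \<partial>lborel)
          (1 / snd p)"

definition inLp :: "'n::finite \<Rightarrow> real \<times> real \<Rightarrow> real \<times> real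
    \<Rightarrow> (complex^'n \<Rightarrow> complex^'n \<Rightarrow> complex) \<Rightarrow> bool" where
  "inLp k p alpha f \<longleftrightarrow> (\<lambda>(z,w). f z w) \<in> borel_measurable borel \<and> mixnorm k p alpha f < \<infinity>"

definition KT :: "'n::finite \<Rightarrow> real \<times> real \<Rightarrow> complex^'n \<Rightarrow> complex^'n \<Rightarrow> complex^'n \<Rightarrow> complex^'n \<Rightarrow> complex" where
  "KT k c z w u \<eta> = 1 / (rho2 k z u powr complex_of_real (fst c) * rho2 k w \<eta> powr complex_of_real (snd c))"

definition KS :: "'n::finite \<Rightarrow> real \<times> real \<Rightarrow> complex^'n \<Rightarrow> complex^'n \<Rightarrow> complex^'n \<Rightarrow> complex^'n \<Rightarrow> complex" where
  "KS k c z w u \<eta> = complex_of_real (1 / (cmod (rho2 k z u) powr fst c * cmod (rho2 k w \<eta>) powr snd c))"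

definition integrand :: "'n::finite \<Rightarrow> (complex^'n \<Rightarrow> complex^'n \<Rightarrow> complex^'n \<Rightarrow> complex^'n \<Rightarrow> complex)
    \<Rightarrow> real \<times> real \<Rightarrow> (complex^'n \<Rightarrow> complex^'n \<Rightarrow> complex) \<Rightarrow> complex^'n \<Rightarrow> complex^'n
    \<Rightarrow> (complex^'n) \<times> (complex^'n) \<Rightarrow> complex" where
  "integrand k K b f z w x = K z w (fst x) (snd x) *
      complex_of_real (rho k (fst x) powr fst b * rho k (snd x) powr snd b) * f (fst x) (snd x)"

definition intop :: "'n::finite \<Rightarrow> (complex^'n \<Rightarrow> complex^'n \<Rightarrow> complex^'n \<Rightarrow> complex^'n \<Rightarrow> complex)
    \<Rightarrow> real \<times> real \<Rightarrow> real \<times> real \<Rightarrow> (complex^'n \<Rightarrow> complex^'n \<Rightarrow> complex)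
    \<Rightarrow> complex^'n \<Rightarrow> complex^'n \<Rightarrow> complex" where
  "intop k K a b f z w = complex_of_real (rho k z powr fst a * rho k w powr snd a) *
      set_lebesgue_integral lborel (TB k \<times> TB k) (integrand k K b f z w)"

definition opT where "opT k a b c = intop k (KT k c) a b"
definition opS where "opS k a b c = intop k (KS k c) a b"

definition bounded_op :: "'n::finite \<Rightarrow> (complex^'n \<Rightarrow> complex^'n \<Rightarrow> complex^'n \<Rightarrow> complex^'n \<Rightarrow> complex)
    \<Rightarrow> real \<times> real \<Rightarrow> real \<times> real \<Rightarrow> real \<times> real \<Rightarrow> real \<times> real \<Rightarrow> real \<times> real \<Rightarrow> real \<times> real \<Rightarrow> bool" where
  "bounded_op k K a b p alpha q beta \<longleftrightarrow>
     (\<exists>C::real. \<forall>f. inLp k p alpha f \<longrightarrow>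
        (AE x in lborel. x \<in> TB k \<times> TB k \<longrightarrow>
            set_integrable lborel (TB k \<times> TB k) (integrand k K b f (fst x) (snd x)))
        \<and> mixnorm k q beta (intop k K a b f) \<le> ennreal C * mixnorm k p alpha f)"

end

theory Submission
  imports Defs
begin

text \<open>
  Writing \<open>u = (u', \<sigma> + i(\<tau> + |Im u'|\<^sup>2))\<close> turns \<open>\<rho>(u)\<close> into the coordinate \<open>\<tau>\<close>, and a
  \<open>u'\<close>-dependent shift of \<open>\<sigma>\<close> reduces \<open>|\<rho>(z,u)|\<close> to a quantity comparable to
  \<open>\<rho>(z) + \<tau> + |z' - u'|\<^sup>2 + |\<sigma>|\<close>. Hence \<open>\<integral> \<rho>(u)\<^sup>\<alpha> |\<rho>(z,u)|\<^sup>-\<^sup>\<beta> dV(u)\<close> is at most a multiple of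
  \<open>\<rho>(z)\<close> to the power \<open>\<alpha> - \<beta> + n + 1\<close> when \<open>\<alpha> > -1\<close> and \<open>\<beta> > n + 1 + \<alpha>\<close>.

  Sufficiency: Jensen's inequality with exponent \<open>q\<^sub>1\<close> for the measure
  \<open>|\<rho>(w,\<eta>)|\<^sup>-\<^sup>c |f(u,\<eta>)|\<close> on both variables at once removes the first variable and leaves the
  scalar operator acting on \<open>\<eta> \<mapsto> \<parallel>f(\<cdot>,\<eta>)\<parallel>\<^sub>1\<close>, which is handled by a Schur test with powers
  of \<open>\<rho>\<close>, again in the form of two applications of Jensen.

  Necessity: if \<open>z, u\<close> lie in thin parabolic cylinders around the axis and
  \<open>\<rho>(z) + \<rho>(u) \<approx> M\<close>, then \<open>\<rho>(z,u)\<close> has almost zero argument and modulus of order \<open>M\<close>, so the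
  oscillating kernel behaves like the positive one. Indicator functions of cylinders
  then give the conditions: dilating both cylinders gives the homogeneity relations for \<open>c\<^sub>i\<close>, letting
  \<open>z\<close> approach the boundary gives \<open>-q\<^sub>i a\<^sub>i < \<beta>\<^sub>i + 1\<close>, letting \<open>z\<close> go to infinity inside a parabolic cone
  gives \<open>\<alpha>\<^sub>1 < b\<^sub>1\<close>, and \<open>\<rho>\<close> to the power \<open>-b\<^sub>2 - 1\<close> on \<open>\<epsilon> < \<rho> < 1\<close> gives the condition on \<open>b\<^sub>2\<close>.
\<close>

section \<open>Lebesgue measure in tube coordinates\<close>

text \<open>The two operators are never compared with each other. Sufficiency sees a kernel only
  through its modulus, which \<open>KS\<close> and \<open>KT\<close> share on the tube; necessity
  sees it only through a lower bound for its real part on nearby points. Both directions are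
  therefore proved once, for an arbitrary kernel with these two properties. The first exponent is
  the endpoint p = 1. There boundedness into \<open>L^q\<close> needs just a uniform bound for the
  columns of the kernel; the value of \<open>c1\<close> makes the power of the height in that bound
  vanish, and \<open>\<alpha>1 < b1\<close> is exactly its convergence. A divergent Bochner integral
  has the value 0. In the upper bound this is harmless, and convergence almost everywhere follows
  from finiteness of a norm of absolute integrals. In the lower bound it would destroy the estimate,
  and the convergence clause of boundedness is what excludes it. In the necessity part, test
  functions that are products make both sides factor; a fixed reference cylinder in one variable
  then leaves a one-variable inequality in the other.\<close>

lemma box_vec_eq: 
  fixes l u :: "complex^'n"
  shows "box l u = {x. \<forall>j. x$j \<in> box (l$j) (u$j)}"
proof -
  have "x \<in> box l u \<longleftrightarrow> (\<forall>j. x$j \<in> box (l$j) (u$j))" for x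
    unfolding mem_box Basis_vec_def by (auto simp: inner_axis)
  then show ?thesis by auto
qed

lemma prod_Basis_vec:
  fixes l :: "complex^'n"
  shows "(\<Prod>b\<in>Basis. l \<bullet> b) = (\<Prod>j\<in>UNIV. \<Prod>b\<in>Basis. (l$j) \<bullet> b)"
proof -
  have "(\<Prod>b\<in>Basis. l \<bullet> b) = (\<Prod>b\<in>(\<lambda>(j,b). axis j b) ` (UNIV \<times> (Basis::complex set)). l \<bullet> b)"
    by (rule prod.cong) (auto simp: Basis_vec_def)
  also have "\<dots> = (\<Prod>(j,b)\<in>UNIV \<times> (Basis::complex set). l \<bullet> axis j b)"
    by (subst prod.reindex) (auto simp: inj_on_def axis_eq_axis nonzero_Basis case_prod_beta)
  also have "\<dots> = (\<Prod>j\<in>UNIV. \<Prod>b\<in>Basis. l \<bullet> axis j b)"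
    by (rule prod.cartesian_product[symmetric])
  finally show ?thesis by (simp add: inner_axis)
qed

lemma measurable_vec_lambda [measurable]:
  "vec_lambda \<in> measurable (Pi\<^sub>M UNIV (\<lambda>_::'n::finite. lborel :: complex measure)) (borel :: (complex^'n) measure)"
proof (rule borel_measurable_euclidean_space[THEN iffD2], rule ballI)
  fix b :: "complex^'n" assume "b \<in> Basis"
  then obtain j c where b: "b = axis j c" by (auto simp: Basis_vec_def)
  show "(\<lambda>x. vec_lambda x \<bullet> b) \<in> borel_measurable (Pi\<^sub>M UNIV (\<lambda>_::'n. lborel :: complex measure))"
    unfolding b inner_axis by simp
qed

text \<open>Box volumes factor over the coordinates, and by \<open>lborel_eqI\<close> they determine
  the measure. The product form allows the distinguished coordinate to be integrated separately from
  the others.\<close>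

lemma lborel_vec_eq_distr_PiM:
  "distr (Pi\<^sub>M UNIV (\<lambda>_::'n::finite. lborel :: complex measure)) borel vec_lambda = (lborel :: (complex^'n) measure)"
    (is "?D = _")
proof (rule lborel_eqI[symmetric])
  interpret product_sigma_finite "\<lambda>_::'n. lborel :: complex measure" ..
  fix l u :: "complex^'n" assume le: "\<And>b. b \<in> Basis \<Longrightarrow> l \<bullet> b \<le> u \<bullet> b"
  have le': "l$j \<bullet> b \<le> u$j \<bullet> b" if "b \<in> Basis" for j b
    using le[of "axis j b"] that by (auto simp: Basis_vec_def inner_axis)
  have "emeasure ?D (box l u) = emeasure (Pi\<^sub>M UNIV (\<lambda>_::'n. lborel :: complex measure)) (Pi\<^sub>E UNIV (\<lambda>j. box (l$j) (u$j)))"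
    by (subst emeasure_distr, simp, simp) (auto simp: box_vec_eq space_PiM PiE_UNIV_domain intro!: arg_cong2[where f=emeasure])
  also have "\<dots> = (\<Prod>j\<in>UNIV. emeasure lborel (box (l$j) (u$j)))"
    by (subst emeasure_PiM) auto
  also have "\<dots> = (\<Prod>j\<in>UNIV. ennreal (\<Prod>b\<in>Basis. (u$j - l$j) \<bullet> b))"
    by (intro prod.cong refl emeasure_lborel_box le')
  also have "\<dots> = ennreal (\<Prod>j\<in>UNIV. \<Prod>b\<in>Basis. (u$j - l$j) \<bullet> b)"
    by (intro prod_ennreal prod_nonneg) (auto simp: inner_diff_left le')
  also have "\<dots> = ennreal (\<Prod>b\<in>Basis. (u - l) \<bullet> b)"
    by (subst prod_Basis_vec) simp
  finally show "emeasure ?D (box l u) = (\<Prod>b\<in>Basis. (u - l) \<bullet> b)" .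
qed simp

lemma measurable_Complex [measurable]:
  "(\<lambda>(x,y). Complex x y) \<in> borel_measurable (lborel \<Otimes>\<^sub>M lborel)"
  unfolding Complex_eq by measurable

lemma lborel_complex_eq_distr:
  "distr (lborel \<Otimes>\<^sub>M lborel) borel (\<lambda>(x,y). Complex x y) = (lborel :: complex measure)" (is "?D = _")
proof (rule lborel_eqI[symmetric])
  fix l u :: complex assume le: "\<And>b. b \<in> Basis \<Longrightarrow> l \<bullet> b \<le> u \<bullet> b"
  have le': "Re l \<le> Re u" "Im l \<le> Im u" using le[of 1] le[of \<i>] by (auto simp: Basis_complex_def)
  have "emeasure ?D (box l u) = emeasure (lborel \<Otimes>\<^sub>M lborel) (box (Re l) (Re u) \<times> box (Im l) (Im u))"
    by (subst emeasure_distr) (auto simp: mem_box Basis_complex_def space_pair_measure intro!: arg_cong2[where f=emeasure])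
  also have "\<dots> = ennreal ((Re u - Re l) * (Im u - Im l))"
    using le' by (subst lborel.emeasure_pair_measure_Times) (auto simp: ennreal_mult)
  finally show "emeasure ?D (box l u) = (\<Prod>b\<in>Basis. (u - l) \<bullet> b)" by (simp add: Basis_complex_def)
qed simp

lemma nn_integral_complex:
  assumes [measurable]: "f \<in> borel_measurable (borel :: complex measure)"
  shows "(\<integral>\<^sup>+z. f z \<partial>lborel) = (\<integral>\<^sup>+y. \<integral>\<^sup>+x. f (Complex x y) \<partial>lborel \<partial>lborel)"
proof -
  have "(\<integral>\<^sup>+z. f z \<partial>lborel) = (\<integral>\<^sup>+z. f z \<partial>distr (lborel \<Otimes>\<^sub>M lborel) borel (\<lambda>(x,y). Complex x y))"
    by (simp only: lborel_complex_eq_distr)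
  also have "\<dots> = (\<integral>\<^sup>+p. f (case p of (x,y) \<Rightarrow> Complex x y) \<partial>(lborel \<Otimes>\<^sub>M lborel))"
    by (rule nn_integral_distr) auto
  also have "\<dots> = (\<integral>\<^sup>+y. \<integral>\<^sup>+x. f (Complex x y) \<partial>lborel \<partial>lborel)"
    by (subst lborel_pair.nn_integral_snd[symmetric]) auto
  finally show ?thesis .
qed

lemma nn_integral_lborel_translate:
  fixes t :: "'a::euclidean_space"
  assumes [measurable]: "f \<in> borel_measurable borel"
  shows "(\<integral>\<^sup>+x. f x \<partial>lborel) = (\<integral>\<^sup>+x. f (x + t) \<partial>lborel)"
proof -
  have "(\<integral>\<^sup>+x. f x \<partial>lborel) = (\<integral>\<^sup>+x. f x \<partial>distr lborel borel ((+) t))"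
    by (simp only: lborel_distr_plus)
  also have "\<dots> = (\<integral>\<^sup>+x. f (x + t) \<partial>lborel)" by (subst nn_integral_distr) (auto simp: add.commute)
  finally show ?thesis .
qed

lemma nn_integral_vec_split:
  fixes k :: "'n::finite"
  assumes [measurable]: "F \<in> borel_measurable (borel :: (complex^'n) measure)"
  shows "(\<integral>\<^sup>+z. F z \<partial>lborel) =
    (\<integral>\<^sup>+v. \<integral>\<^sup>+c. F (vec_lambda (v(k := c))) \<partial>lborel \<partial>Pi\<^sub>M (UNIV-{k}) (\<lambda>_. lborel))"
proof -
  interpret product_sigma_finite "\<lambda>_::'n. lborel :: complex measure" ..
  have "(\<integral>\<^sup>+z. F z \<partial>lborel) = (\<integral>\<^sup>+z. F z \<partial>distr (Pi\<^sub>M UNIV (\<lambda>_::'n. lborel)) borel vec_lambda)"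
    by (simp only: lborel_vec_eq_distr_PiM)
  also have "\<dots> = (\<integral>\<^sup>+z. F (vec_lambda z) \<partial>(Pi\<^sub>M UNIV (\<lambda>_::'n. lborel)))"
    by (rule nn_integral_distr) auto
  also have "\<dots> = (\<integral>\<^sup>+z. F (vec_lambda z) \<partial>(Pi\<^sub>M (insert k (UNIV-{k})) (\<lambda>_::'n. lborel)))"
    by (simp add: insert_absorb)
  also have "\<dots> = (\<integral>\<^sup>+v. \<integral>\<^sup>+c. F (vec_lambda (v(k := c))) \<partial>lborel \<partial>Pi\<^sub>M (UNIV-{k}) (\<lambda>_. lborel))"
    by (rule product_nn_integral_insert) (auto simp: insert_absorb)
  finally show ?thesis .
qed

text \<open>These are the tube coordinates. For fixed \<open>v\<close> the entry at \<open>k\<close>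
  is a translate of \<open>Complex \<sigma> \<tau>\<close>, so no Jacobian appears. The value
  \<open>v k\<close> is overwritten, which lets \<open>v\<close> range over a product indexed by
  \<open>UNIV-{k}\<close>.\<close>

definition pt :: "'n::finite \<Rightarrow> ('n \<Rightarrow> complex) \<Rightarrow> real \<Rightarrow> real \<Rightarrow> complex^'n" where
  "pt k v \<sigma> \<tau> = vec_lambda (v(k := Complex \<sigma> (\<tau> + (\<Sum>j\<in>UNIV-{k}. (Im (v j))\<^sup>2))))"

lemma pt_nth: "pt k v \<sigma> \<tau> $ k = Complex \<sigma> (\<tau> + (\<Sum>j\<in>UNIV-{k}. (Im (v j))\<^sup>2))"
  "j \<noteq> k \<Longrightarrow> pt k v \<sigma> \<tau> $ j = v j"
  by (auto simp: pt_def)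

lemma rho_pt [simp]: "rho k (pt k v \<sigma> \<tau>) = \<tau>"
proof -
  have "(\<Sum>j\<in>UNIV-{k}. (Im (pt k v \<sigma> \<tau> $ j))\<^sup>2) = (\<Sum>j\<in>UNIV-{k}. (Im (v j))\<^sup>2)"
    by (rule sum.cong) (auto simp: pt_nth)
  then show ?thesis by (simp add: rho_def pt_nth)
qed

lemma TB_iff: "z \<in> TB k \<longleftrightarrow> rho k z > 0" by (auto simp: TB_def rho_def)

lemma measurable_pt:
  assumes [measurable]: "v \<in> measurable M (Pi\<^sub>M (UNIV-{k}) (\<lambda>_::'n::finite. lborel :: complex measure))"
    "s \<in> borel_measurable M" "t \<in> borel_measurable M"
  shows "(\<lambda>x. pt k (v x) (s x) (t x)) \<in> borel_measurable M"
proof (rule borel_measurable_euclidean_space[THEN iffD2], rule ballI)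
  have v[measurable]: "(\<lambda>x. v x j) \<in> borel_measurable M" if "j \<noteq> k" for j
    using measurable_compose[OF assms(1) measurable_component_singleton[of j]] that by simp
  have [measurable]: "(\<lambda>x. Complex (s x) (t x + (\<Sum>j\<in>UNIV-{k}. (Im (v x j))\<^sup>2))) \<in> borel_measurable M"
    unfolding Complex_eq
    by (intro borel_measurable_add borel_measurable_times borel_measurable_sum borel_measurable_power measurable_compose[OF _ borel_measurable_of_real] measurable_compose[OF v borel_measurable_Im] assms borel_measurable_const) auto
  fix b :: "complex^'n" assume "b \<in> Basis"
  then obtain j c where b: "b = axis j c" by (auto simp: Basis_vec_def)
  show "(\<lambda>x. pt k (v x) (s x) (t x) \<bullet> b) \<in> borel_measurable M"
    unfolding b inner_axis
  proof (cases "j = k")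
    case True
    then show "(\<lambda>x. pt k (v x) (s x) (t x) $ j \<bullet> c) \<in> borel_measurable M" by (simp add: pt_nth)
  next
    case False
    then show "(\<lambda>x. pt k (v x) (s x) (t x) $ j \<bullet> c) \<in> borel_measurable M" by (simp add: pt_nth v)
  qed
qed

text \<open>For each \<open>v\<close> the change of variables is a translation of one complex
  coordinate; Fubini then moves \<open>\<tau>\<close> outside, since the weights depend on the
  height. The shift \<open>A v\<close> is left free so that it can later cancel the imaginary part
  of the kernel.\<close>

lemma nn_integral_TB_coordinates:
  fixes k :: "'n::finite" and A :: "('n \<Rightarrow> complex) \<Rightarrow> real"
  assumes F[measurable]: "F \<in> borel_measurable (borel :: (complex^'n) measure)"
    and A[measurable]: "A \<in> borel_measurable (Pi\<^sub>M (UNIV-{k}) (\<lambda>_. lborel))"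
  shows "(\<integral>\<^sup>+z. F z \<partial>lborel) =
    (\<integral>\<^sup>+\<tau>. \<integral>\<^sup>+v. \<integral>\<^sup>+\<sigma>. F (pt k v (\<sigma> + A v) \<tau>) \<partial>lborel \<partial>Pi\<^sub>M (UNIV-{k}) (\<lambda>_. lborel) \<partial>lborel)"
proof -
  let ?P = "Pi\<^sub>M (UNIV-{k}) (\<lambda>_. lborel :: complex measure)"
  interpret product_sigma_finite "\<lambda>_::'n. lborel :: complex measure" ..
  interpret P: finite_product_sigma_finite "\<lambda>_::'n. lborel :: complex measure" "UNIV-{k}" by standard auto
  interpret PP: pair_sigma_finite ?P "lborel :: real measure" ..
  note measurable_pt[measurable]
  have [measurable]: "(\<lambda>c. F (vec_lambda (v(k := c)))) \<in> borel_measurable borel" for v :: "'n \<Rightarrow> complex"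
  proof (rule measurable_compose[OF _ F], rule borel_measurable_euclidean_space[THEN iffD2], rule ballI)
    fix b :: "complex^'n" assume "b \<in> Basis"
    then obtain j c where b: "b = axis j c" by (auto simp: Basis_vec_def)
    show "(\<lambda>x. vec_lambda (v(k := x)) \<bullet> b) \<in> borel_measurable borel"
      unfolding b inner_axis by (cases "j = k") auto
  qed
  have eq: "(\<integral>\<^sup>+c. F (vec_lambda (v(k := c))) \<partial>lborel) = (\<integral>\<^sup>+\<tau>. \<integral>\<^sup>+\<sigma>. F (pt k v (\<sigma> + A v) \<tau>) \<partial>lborel \<partial>lborel)" for v
    by (subst nn_integral_lborel_translate[where t="Complex (A v) (\<Sum>j\<in>UNIV-{k}. (Im (v j))\<^sup>2)"], simp)
      (subst nn_integral_complex, auto simp: pt_def plus_complex.code)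
  show ?thesis
    unfolding nn_integral_vec_split[OF F, of k] eq
    by (rule PP.Fubini'[symmetric]) measurable
qed

section \<open>The kernel integral and cylinders\<close>

lemma nn_integral_powr_to_inf:
  fixes e a :: real
  assumes "e < -1" "a > 0"
  shows "(\<integral>\<^sup>+x. ennreal (x powr e) * indicator {a..} x \<partial>lborel) = ennreal (a powr (e+1) / (- e - 1))"
proof -
  have "(\<integral>\<^sup>+x. ennreal (x powr e) * indicator {a..} x \<partial>lborel) = ennreal (-(a powr (e+1)) / (e+1))"
    using assms by (intro nn_integral_has_integral_lebesgue' has_integral_powr_to_inf) auto
  also have "-(a powr (e+1)) / (e+1) = a powr (e+1) / (- e - 1)"
    using assms by (simp add: field_simps)
  finally show ?thesis .
qed

lemma nn_integral_shifted_abs_powr: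
  fixes \<theta> R :: real
  assumes "\<theta> > 1" "R > 0"
  shows "(\<integral>\<^sup>+x. ennreal ((R + \<bar>x\<bar>) powr - \<theta>) \<partial>lborel) \<le> ennreal (2 / (\<theta> - 1) * R powr (1 - \<theta>))"
proof -
  let ?I = "R powr (1 - \<theta>) / (\<theta> - 1)"
  have half: "(\<integral>\<^sup>+x. ennreal ((R + x) powr - \<theta>) * indicator {0..} x \<partial>lborel) = ennreal ?I"
  proof -
    have "ennreal ?I = (\<integral>\<^sup>+x. ennreal (x powr - \<theta>) * indicator {R..} x \<partial>lborel)"
      using assms by (subst nn_integral_powr_to_inf) (auto simp: algebra_simps)
    also have "\<dots> = (\<integral>\<^sup>+x. ennreal ((x + R) powr - \<theta>) * indicator {R..} (x + R) \<partial>lborel)"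
      by (rule nn_integral_lborel_translate) simp
    also have "\<dots> = (\<integral>\<^sup>+x. ennreal ((R + x) powr - \<theta>) * indicator {0..} x \<partial>lborel)"
      by (intro nn_integral_cong) (auto simp: indicator_def add.commute)
    finally show ?thesis by simp
  qed
  have "(\<integral>\<^sup>+x. ennreal ((R + \<bar>x\<bar>) powr - \<theta>) \<partial>lborel) \<le>
     (\<integral>\<^sup>+x. ennreal ((R + x) powr - \<theta>) * indicator {0..} x + ennreal ((R + (-x)) powr - \<theta>) * indicator {0..} (-x) \<partial>lborel)"
    by (intro nn_integral_mono) (auto simp: indicator_def abs_if)
  also have "\<dots> = (\<integral>\<^sup>+x. ennreal ((R + x) powr - \<theta>) * indicator {0..} x \<partial>lborel) + (\<integral>\<^sup>+x. ennreal ((R + (-x)) powr - \<theta>) * indicator {0..} (-x) \<partial>lborel)"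
    by (rule nn_integral_add) auto
  also have "(\<integral>\<^sup>+x. ennreal ((R + (-x)) powr - \<theta>) * indicator {0..} (-x) \<partial>lborel) = (\<integral>\<^sup>+x. ennreal ((R + x) powr - \<theta>) * indicator {0..} x \<partial>lborel)"
    by (subst (2) nn_integral_real_affine[where c="-1" and t=0]) auto
  also note half
  also have "ennreal ?I + ennreal ?I = ennreal (2 / (\<theta> - 1) * R powr (1 - \<theta>))"
    using assms by (subst ennreal_plus[symmetric]) auto
  finally show ?thesis .
qed

text \<open>Since \<open>(sqrt R + |x|) * (sqrt R + |y|)\<close> is at most
  \<open>2 * (R + x^2 + y^2)\<close>, the planar integral splits into two real ones, each
  contributing half of the final exponent of \<open>R\<close>.\<close>

lemma nn_integral_complex_shifted_powr:
  fixes \<theta> R :: real and a :: complex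
  assumes "\<theta> > 1" "R > 0"
  shows "(\<integral>\<^sup>+v. ennreal ((R + (cmod (v - a))\<^sup>2) powr - \<theta>) \<partial>lborel)
    \<le> ennreal (2 powr \<theta> * (2 / (\<theta> - 1))\<^sup>2 * R powr (1 - \<theta>))"
proof -
  let ?g = "\<lambda>x. (sqrt R + \<bar>x\<bar>) powr - \<theta>"
  have pw: "(R + (cmod (Complex x y))\<^sup>2) powr - \<theta> \<le> 2 powr \<theta> * ?g x * ?g y" for x y
  proof -
    have q: "(sqrt R + \<bar>x\<bar>)\<^sup>2 \<le> 2 * (R + x\<^sup>2)" for x
    proof -
      have "0 \<le> (sqrt R - \<bar>x\<bar>)\<^sup>2" by simp
      then show ?thesis using assms by (simp add: power2_eq_square algebra_simps)
    qed
    have "((sqrt R + \<bar>x\<bar>) * (sqrt R + \<bar>y\<bar>))\<^sup>2 \<le> (2 * (R + x\<^sup>2)) * (2 * (R + y\<^sup>2))"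
      unfolding power_mult_distrib using assms by (intro mult_mono q) auto
    also have "\<dots> \<le> (2 * (R + x\<^sup>2 + y\<^sup>2))\<^sup>2"
    proof -
      have "(2 * (R + x\<^sup>2 + y\<^sup>2))\<^sup>2 - (2 * (R + x\<^sup>2)) * (2 * (R + y\<^sup>2)) = 4 * (R * x\<^sup>2 + R * y\<^sup>2 + (x\<^sup>2)\<^sup>2 + x\<^sup>2 * y\<^sup>2 + (y\<^sup>2)\<^sup>2)"
        by (simp add: power2_eq_square algebra_simps)
      also have "\<dots> \<ge> 0" using assms by simp
      finally show ?thesis by simp
    qed
    finally have "(sqrt R + \<bar>x\<bar>) * (sqrt R + \<bar>y\<bar>) \<le> 2 * (R + x\<^sup>2 + y\<^sup>2)"
      by (rule power2_le_imp_le) (use assms in simp)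
    moreover have pos: "0 < sqrt R + \<bar>x\<bar>" for x using assms by (simp add: add_pos_nonneg)
    ultimately have "(2 * (R + x\<^sup>2 + y\<^sup>2)) powr - \<theta> \<le> ((sqrt R + \<bar>x\<bar>) * (sqrt R + \<bar>y\<bar>)) powr - \<theta>"
      by (intro powr_mono2') (use assms pos in auto)
    also have "\<dots> = ?g x * ?g y" using pos[of x] pos[of y] by (simp add: powr_mult)
    also have "(2 * (R + x\<^sup>2 + y\<^sup>2)) powr - \<theta> = 2 powr - \<theta> * (R + x\<^sup>2 + y\<^sup>2) powr - \<theta>"
      by (rule powr_mult)
    finally have *: "2 powr - \<theta> * (R + x\<^sup>2 + y\<^sup>2) powr - \<theta> \<le> ?g x * ?g y" .
    have "2 powr \<theta> * 2 powr - \<theta> = (1::real)" by (simp add: powr_minus)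
    then have "(R + x\<^sup>2 + y\<^sup>2) powr - \<theta> = 2 powr \<theta> * (2 powr - \<theta> * (R + x\<^sup>2 + y\<^sup>2) powr - \<theta>)"
      by (simp only: mult.assoc[symmetric] mult_1_left)
    also have "\<dots> \<le> 2 powr \<theta> * (?g x * ?g y)" using * by (intro mult_left_mono) auto
    finally show ?thesis by (simp add: cmod_power2 mult.assoc add.assoc)
  qed
  have one: "(\<integral>\<^sup>+x. ennreal (?g x) \<partial>lborel) \<le> ennreal (2 / (\<theta> - 1) * sqrt R powr (1 - \<theta>))"
    using assms by (intro nn_integral_shifted_abs_powr) auto
  have "(\<integral>\<^sup>+v. ennreal ((R + (cmod (v - a))\<^sup>2) powr - \<theta>) \<partial>lborel) = (\<integral>\<^sup>+v. ennreal ((R + (cmod v)\<^sup>2) powr - \<theta>) \<partial>lborel)"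
    by (subst nn_integral_lborel_translate[where t=a]) auto
  also have "\<dots> = (\<integral>\<^sup>+y. \<integral>\<^sup>+x. ennreal ((R + (cmod (Complex x y))\<^sup>2) powr - \<theta>) \<partial>lborel \<partial>lborel)"
    by (subst nn_integral_complex) auto
  also have "\<dots> \<le> (\<integral>\<^sup>+y. \<integral>\<^sup>+x. ennreal (2 powr \<theta>) * ennreal (?g y) * ennreal (?g x) \<partial>lborel \<partial>lborel)"
  proof (intro nn_integral_mono)
    fix x y
    show "ennreal ((R + (cmod (Complex x y))\<^sup>2) powr - \<theta>) \<le> ennreal (2 powr \<theta>) * ennreal (?g y) * ennreal (?g x)"
      using pw[of x y] by (simp add: ennreal_mult[symmetric] mult_ac)
  qed
  also have "\<dots> = ennreal (2 powr \<theta>) * ((\<integral>\<^sup>+x. ennreal (?g x) \<partial>lborel) * (\<integral>\<^sup>+x. ennreal (?g x) \<partial>lborel))"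
    by (simp add: nn_integral_cmult nn_integral_multc mult.assoc)
  also have "\<dots> \<le> ennreal (2 powr \<theta>) * (ennreal (2 / (\<theta> - 1) * sqrt R powr (1 - \<theta>)) * ennreal (2 / (\<theta> - 1) * sqrt R powr (1 - \<theta>)))"
    by (intro mult_mono one) auto
  also have "\<dots> = ennreal (2 powr \<theta> * ((2 / (\<theta> - 1) * sqrt R powr (1 - \<theta>)) * (2 / (\<theta> - 1) * sqrt R powr (1 - \<theta>))))"
    using assms by (simp add: ennreal_mult[symmetric])
  also have "2 powr \<theta> * ((2 / (\<theta> - 1) * sqrt R powr (1 - \<theta>)) * (2 / (\<theta> - 1) * sqrt R powr (1 - \<theta>)))
     = 2 powr \<theta> * (2 / (\<theta> - 1))\<^sup>2 * R powr (1 - \<theta>)"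
  proof -
    have "sqrt R powr (1 - \<theta>) * sqrt R powr (1 - \<theta>) = R powr (1 - \<theta>)"
      using assms by (subst powr_mult[symmetric]) auto
    then show ?thesis by (simp add: power2_eq_square)
  qed
  finally show ?thesis .
qed

text \<open>Split at height \<open>r\<close>: below it \<open>r + \<tau>\<close> is replaced by
  \<open>r\<close>, above it by \<open>\<tau>\<close>. The two hypotheses on the exponents are
  convergence at 0 and at infinity, and both pieces scale with the same power of
  \<open>r\<close>.\<close>

lemma nn_integral_powr_shifted_powr:
  fixes \<alpha> s r :: real
  assumes "\<alpha> > -1" "s > \<alpha> + 1" "r > 0"
  shows "(\<integral>\<^sup>+\<tau>. indicator {0<..} \<tau> * ennreal (\<tau> powr \<alpha> * (r + \<tau>) powr - s) \<partial>lborel)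
    \<le> ennreal ((1 / (\<alpha> + 1) + 1 / (s - \<alpha> - 1)) * r powr (\<alpha> - s + 1))"
proof -
  have "(\<integral>\<^sup>+\<tau>. indicator {0<..} \<tau> * ennreal (\<tau> powr \<alpha> * (r + \<tau>) powr - s) \<partial>lborel)
    \<le> (\<integral>\<^sup>+\<tau>. ennreal (r powr - s) * (ennreal (\<tau> powr \<alpha>) * indicator {0..r} \<tau>) + ennreal (\<tau> powr (\<alpha> - s)) * indicator {r..} \<tau> \<partial>lborel)"
  proof (rule nn_integral_mono)
    fix \<tau> :: real
    show "indicator {0<..} \<tau> * ennreal (\<tau> powr \<alpha> * (r + \<tau>) powr - s) \<le> ennreal (r powr - s) * (ennreal (\<tau> powr \<alpha>) * indicator {0..r} \<tau>) + ennreal (\<tau> powr (\<alpha> - s)) * indicator {r..} \<tau>"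
    proof (cases "\<tau> > 0")
      case True
      have 1: "(r + \<tau>) powr - s \<le> r powr - s" "(r + \<tau>) powr - s \<le> \<tau> powr - s"
        using assms True by (auto intro!: powr_mono2')
      show ?thesis
      proof (cases "\<tau> < r")
        case T: True
        then show ?thesis using True 1 by (auto simp: ennreal_mult[symmetric] mult.commute intro!: ennreal_leI mult_left_mono)
      next
        case False
        have "\<tau> powr \<alpha> * (r + \<tau>) powr - s \<le> \<tau> powr \<alpha> * \<tau> powr - s" using 1 by (intro mult_left_mono) auto
        also have "\<dots> = \<tau> powr (\<alpha> - s)" by (simp add: powr_add[symmetric])
        finally have "ennreal (\<tau> powr \<alpha> * (r + \<tau>) powr - s) \<le> ennreal (\<tau> powr (\<alpha> - s))" by (rule ennreal_leI)
        then show ?thesis using False True by (auto intro: add_increasing)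
      qed
    qed auto
  qed
  also have "\<dots> = ennreal (r powr - s) * (\<integral>\<^sup>+\<tau>. ennreal (\<tau> powr \<alpha>) * indicator {0..r} \<tau> \<partial>lborel) + (\<integral>\<^sup>+\<tau>. ennreal (\<tau> powr (\<alpha> - s)) * indicator {r..} \<tau> \<partial>lborel)"
    by (subst nn_integral_add) (auto simp: nn_integral_cmult)
  also have "(\<integral>\<^sup>+\<tau>. ennreal (\<tau> powr \<alpha>) * indicator {0..r} \<tau> \<partial>lborel) = ennreal (r powr (\<alpha> + 1) / (\<alpha> + 1))"
    using assms by (intro nn_integral_has_integral_lebesgue' has_integral_powr_from_0) auto
  also have "(\<integral>\<^sup>+\<tau>. ennreal (\<tau> powr (\<alpha> - s)) * indicator {r..} \<tau> \<partial>lborel) = ennreal (r powr (\<alpha> - s + 1) / (- (\<alpha> - s) - 1))"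
    using assms by (intro nn_integral_powr_to_inf) auto
  also have "ennreal (r powr - s) * ennreal (r powr (\<alpha> + 1) / (\<alpha> + 1)) + ennreal (r powr (\<alpha> - s + 1) / (- (\<alpha> - s) - 1))
    = ennreal (r powr - s * (r powr (\<alpha> + 1) / (\<alpha> + 1)) + r powr (\<alpha> - s + 1) / (- (\<alpha> - s) - 1))"
    using assms by (simp add: ennreal_mult[symmetric])
  also have "r powr - s * (r powr (\<alpha> + 1) / (\<alpha> + 1)) + r powr (\<alpha> - s + 1) / (- (\<alpha> - s) - 1)
    = (1 / (\<alpha> + 1) + 1 / (s - \<alpha> - 1)) * r powr (\<alpha> - s + 1)"
  proof -
    have "r powr - s * r powr (\<alpha> + 1) = r powr (\<alpha> - s + 1)" by (simp add: powr_add[symmetric] algebra_simps)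
    then show ?thesis by (simp add: algebra_simps)
  qed
  finally show ?thesis .
qed

text \<open>With z = x + iy and u = s + it, the identity \<open>(x - s)^2 - (y + t)^2 = (x - s)^2 +
  (y - t)^2 - 2*y^2 - 2*t^2\<close> in each coordinate other than \<open>k\<close> turns
  \<open>Im (z$k) + Im (u$k)\<close> into the sum of the two heights and leaves a squared
  distance.\<close>

lemma Re_rho2:
  "Re (rho2 k z u) = (rho k z + rho k u) / 2 + (\<Sum>j\<in>UNIV-{k}. (cmod (z$j - u$j))\<^sup>2) / 4"
proof -
  have "Re (\<Sum>j\<in>UNIV-{k}. (z$j - cnj (u$j))\<^sup>2) =
    (\<Sum>j\<in>UNIV-{k}. (cmod (z$j - u$j))\<^sup>2) - 2 * (\<Sum>j\<in>UNIV-{k}. (Im (z$j))\<^sup>2) - 2 * (\<Sum>j\<in>UNIV-{k}. (Im (u$j))\<^sup>2)"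
    unfolding cmod_power2
    by (simp add: sum_distrib_left sum_subtractf[symmetric] power2_eq_square algebra_simps)
  then show ?thesis by (simp add: rho2_def rho_def field_simps)
qed

text \<open>The coordinate \<open>Re (u$k)\<close> enters linearly and everything else depends on
  the remaining coordinates, so a translation in \<open>Re (u$k)\<close> can normalise the imaginary
  part.\<close>

lemma Im_rho2:
  "Im (rho2 k z u) = (Re (u$k) - Re (z$k)) / 2 + (\<Sum>j\<in>UNIV-{k}. (Re (z$j) - Re (u$j)) * (Im (z$j) + Im (u$j))) / 2"
proof -
  have "Im (\<Sum>j\<in>UNIV-{k}. (z$j - cnj (u$j))\<^sup>2) = 2 * (\<Sum>j\<in>UNIV-{k}. (Re (z$j) - Re (u$j)) * (Im (z$j) + Im (u$j)))"
    by (simp add: sum_distrib_left power2_eq_square algebra_simps)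
  then show ?thesis by (simp add: rho2_def field_simps)
qed

lemma cnj_rho2: "cnj (rho2 k z u) = rho2 k u z"
proof (rule complex_eqI)
  show "Re (cnj (rho2 k z u)) = Re (rho2 k u z)" by (simp add: Re_rho2 norm_minus_commute)
  have "(\<Sum>j\<in>UNIV-{k}. (Re (u$j) - Re (z$j)) * (Im (u$j) + Im (z$j))) = - (\<Sum>j\<in>UNIV-{k}. (Re (z$j) - Re (u$j)) * (Im (z$j) + Im (u$j)))"
    unfolding sum_negf[symmetric] by (rule sum.cong) (auto simp: algebra_simps)
  then show "Im (cnj (rho2 k z u)) = Im (rho2 k u z)"
    by (simp add: Im_rho2 field_simps)
qed

text \<open>Hermitian symmetry carries the kernel estimate, stated for integration in the second
  argument, over to the first; the column bounds below use it in that form.\<close>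

lemma cmod_rho2_commute: "cmod (rho2 k z u) = cmod (rho2 k u z)"
  by (metis cnj_rho2 complex_mod_cnj)

lemma Re_rho2_ge: "(rho k z + rho k u) / 2 \<le> Re (rho2 k z u)"
  by (simp add: Re_rho2 sum_nonneg)

lemma measurable_rho [measurable]: "rho k \<in> borel_measurable borel"
  unfolding rho_def by (intro borel_measurable_continuous_onI continuous_intros)

lemma measurable_rho2 [measurable]: "(\<lambda>x. rho2 k (fst x) (snd x)) \<in> borel_measurable borel"
  unfolding rho2_def by (intro borel_measurable_continuous_onI continuous_intros) auto

lemma measurable_rho2' [measurable (raw)]:
  assumes "f \<in> borel_measurable M" "g \<in> borel_measurable M"
  shows "(\<lambda>x. rho2 k (f x) (g x)) \<in> borel_measurable M"
  using measurable_compose[OF borel_measurable_Pair[OF assms] measurable_rho2] by simp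

lemma measurable_TB [measurable]: "TB k \<in> sets borel"
proof -
  have "TB k = rho k -` {0<..} \<inter> space borel" by (auto simp: TB_iff)
  then show ?thesis using measurable_sets[OF measurable_rho, of "{0<..}" k] by simp
qed


text \<open>Up to the factor 4, the modulus of the kernel dominates each of the n quantities
  \<open>r + \<tau> + |\<sigma>|\<close> and \<open>r + \<tau> + |v j - z$j|^2\<close>. Sharing
  \<open>\<beta>\<close> equally among them, \<open>\<theta> = \<beta> / n\<close> to each, bounds
  the integrand by a product with separated variables. Here \<open>\<theta> > 1\<close>, so each of
  the n integrals gives \<open>(r + \<tau>) powr (1 - \<theta>)\<close>, together
  \<open>(r + \<tau>) powr - (\<beta> - n)\<close>, and the integral over the height
  remains.\<close>

lemma nn_integral_kernel_le:
  fixes k :: "'n::finite" and \<alpha> \<beta> :: real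
  defines "n \<equiv> real CARD('n)"
  assumes \<alpha>: "\<alpha> > -1" and \<beta>: "\<beta> > n + 1 + \<alpha>"
  shows "\<exists>C>0. \<forall>z\<in>TB k. (\<integral>\<^sup>+u. indicator (TB k) u * ennreal (rho k u powr \<alpha> * cmod (rho2 k z u) powr - \<beta>) \<partial>lborel)
     \<le> ennreal (C * rho k z powr (\<alpha> - \<beta> + n + 1))"
proof -
  let ?P = "Pi\<^sub>M (UNIV-{k}) (\<lambda>_. lborel :: complex measure)"
  interpret product_sigma_finite "\<lambda>_::'n. lborel :: complex measure" ..
  define m where "m = CARD('n) - 1"
  have n1: "CARD('n) = Suc m" unfolding m_def using zero_less_card_finite[where 'a='n] by simp
  have n: "n = real m + 1" unfolding n_def n1 by simp
  have cm: "card (UNIV - {k}) = m" by (simp add: m_def)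
  define \<theta> where "\<theta> = \<beta> / n"
  have np: "n > 0" unfolding n by simp
  have \<theta>: "\<theta> > 1" "\<theta> > 0" and \<beta>0: "\<beta> > 0" unfolding \<theta>_def using \<alpha> \<beta> np by (auto simp: field_simps)
  have \<theta>\<beta>: "\<theta> + real m * \<theta> = \<beta>"
  proof -
    have "\<theta> + real m * \<theta> = \<theta> * n" by (simp add: n algebra_simps)
    then show ?thesis using np by (simp add: \<theta>_def)
  qed
  define C1 where "C1 = 2 / (\<theta> - 1)"
  define C2 where "C2 = 2 powr \<theta> * (2 / (\<theta> - 1))\<^sup>2"
  define C3 where "C3 = 1 / (\<alpha> + 1) + 1 / ((\<beta> - n) - \<alpha> - 1)"
  have C: "C1 > 0" "C2 > 0" "C3 > 0" using \<theta> \<alpha> \<beta> by (auto simp: C1_def C2_def C3_def add_pos_pos)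
  show ?thesis
  proof (intro exI[of _ "4 powr \<beta> * C1 * C2 ^ m * C3"] conjI ballI)
    show "0 < 4 powr \<beta> * C1 * C2 ^ m * C3" using C by simp
    fix z assume z: "z \<in> TB k"
    define r where "r = rho k z"
    have r: "r > 0" using z by (simp add: r_def TB_iff)
    \<comment> \<open>Chosen so that the imaginary part of
      \<open>rho2 k z (pt k v (\<sigma> + A v) \<tau>)\<close> is exactly
      \<open>\<sigma> / 2\<close>.\<close>
    define A where "A v = Re (z$k) - (\<Sum>j\<in>UNIV-{k}. (Re (z$j) - Re (v j)) * (Im (z$j) + Im (v j)))" for v :: "'n \<Rightarrow> complex"
    have A[measurable]: "A \<in> borel_measurable ?P" unfolding A_def
      by (intro borel_measurable_diff borel_measurable_const borel_measurable_sum borel_measurable_times borel_measurable_add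
        measurable_compose[OF _ borel_measurable_Re] measurable_compose[OF _ borel_measurable_Im]) auto
    have pw: "cmod (rho2 k z (pt k v (\<sigma> + A v) \<tau>)) powr - \<beta>
        \<le> 4 powr \<beta> * (r + \<tau> + \<bar>\<sigma>\<bar>) powr - \<theta> * (\<Prod>j\<in>UNIV-{k}. (r + \<tau> + (cmod (v j - z$j))\<^sup>2) powr - \<theta>)"
      if \<tau>: "\<tau> > 0" for v \<sigma> \<tau>
    proof -
      define \<omega> where "\<omega> = rho2 k z (pt k v (\<sigma> + A v) \<tau>)"
      have "(\<Sum>j\<in>UNIV-{k}. (cmod (z$j - pt k v (\<sigma> + A v) \<tau> $ j))\<^sup>2) = (\<Sum>j\<in>UNIV-{k}. (cmod (v j - z$j))\<^sup>2)"
        by (rule sum.cong) (auto simp: pt_nth norm_minus_commute)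
      then have Re: "Re \<omega> = (r + \<tau>) / 2 + (\<Sum>j\<in>UNIV-{k}. (cmod (v j - z$j))\<^sup>2) / 4"
        by (simp add: \<omega>_def Re_rho2 r_def)
      have "(\<Sum>j\<in>UNIV-{k}. (Re (z$j) - Re (pt k v (\<sigma> + A v) \<tau>$j)) * (Im (z$j) + Im (pt k v (\<sigma> + A v) \<tau>$j)))
        = (\<Sum>j\<in>UNIV-{k}. (Re (z$j) - Re (v j)) * (Im (z$j) + Im (v j)))"
        by (rule sum.cong) (auto simp: pt_nth)
      then have Im: "Im \<omega> = \<sigma> / 2" by (simp add: \<omega>_def Im_rho2 A_def pt_nth field_simps)
      define X where "X = 4 * cmod \<omega>"
      define S where "S = (\<Sum>j\<in>UNIV-{k}. (cmod (v j - z$j))\<^sup>2)"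
      have S0: "S \<ge> 0" unfolding S_def by (rule sum_nonneg) auto
      note Re = Re[folded S_def]
      have X1: "r + \<tau> + \<bar>\<sigma>\<bar> \<le> X"
      proof -
        have "Re \<omega> \<le> cmod \<omega>" "\<bar>Im \<omega>\<bar> \<le> cmod \<omega>" by (rule complex_Re_le_cmod, rule abs_Im_le_cmod)
        then have "(r + \<tau>) / 2 + S / 4 \<le> cmod \<omega>" "\<bar>\<sigma>\<bar> / 2 \<le> cmod \<omega>" unfolding Re Im by simp_all
        then show ?thesis unfolding X_def add_divide_distrib using S0 by linarith
      qed
      have X2: "r + \<tau> + (cmod (v j - z$j))\<^sup>2 \<le> X" if "j \<in> UNIV-{k}" for j
      proof -
        have "(cmod (v j - z$j))\<^sup>2 \<le> S"
          unfolding S_def by (rule member_le_sum[OF that]) auto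
        moreover have "(r + \<tau>) / 2 + S / 4 \<le> cmod \<omega>" using complex_Re_le_cmod[of \<omega>] unfolding Re .
        ultimately show ?thesis using r \<tau> unfolding X_def add_divide_distrib by linarith
      qed
      have Xp: "X > 0" using X1 r \<tau> by linarith
      have "X powr - \<beta> = X powr - \<theta> * (\<Prod>j\<in>UNIV-{k}. X powr - \<theta>)"
      proof -
        have "(X powr - \<theta>) ^ m = X powr (- \<theta> * real m)" using Xp by (simp add: powr_power mult.commute)
        then have "X powr - \<theta> * (\<Prod>j\<in>UNIV-{k}. X powr - \<theta>) = X powr (- \<theta> + - \<theta> * real m)"
          unfolding prod_constant cm powr_add by simp
        also have "- \<theta> + - \<theta> * real m = - \<beta>" using \<theta>\<beta> by (simp add: mult.commute)
        finally show ?thesis by simp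
      qed
      also have "\<dots> \<le> (r + \<tau> + \<bar>\<sigma>\<bar>) powr - \<theta> * (\<Prod>j\<in>UNIV-{k}. (r + \<tau> + (cmod (v j - z$j))\<^sup>2) powr - \<theta>)"
        using r \<tau> \<theta> X1 X2 by (intro mult_mono prod_mono conjI powr_mono2' prod_nonneg ballI) (auto simp: add_pos_nonneg)
      finally have "X powr - \<beta> \<le> (r + \<tau> + \<bar>\<sigma>\<bar>) powr - \<theta> * (\<Prod>j\<in>UNIV-{k}. (r + \<tau> + (cmod (v j - z$j))\<^sup>2) powr - \<theta>)" .
      then have "4 powr \<beta> * X powr - \<beta> \<le> 4 powr \<beta> * ((r + \<tau> + \<bar>\<sigma>\<bar>) powr - \<theta> * (\<Prod>j\<in>UNIV-{k}. (r + \<tau> + (cmod (v j - z$j))\<^sup>2) powr - \<theta>))"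
        by (rule mult_left_mono) simp
      moreover have "4 powr \<beta> * X powr - \<beta> = cmod \<omega> powr - \<beta>"
        unfolding X_def powr_mult by (simp add: powr_minus)
      ultimately show ?thesis unfolding \<omega>_def[symmetric] by (simp add: mult.assoc)
    qed
    have "(\<integral>\<^sup>+u. indicator (TB k) u * ennreal (rho k u powr \<alpha> * cmod (rho2 k z u) powr - \<beta>) \<partial>lborel)
      = (\<integral>\<^sup>+\<tau>. \<integral>\<^sup>+v. \<integral>\<^sup>+\<sigma>. indicator (TB k) (pt k v (\<sigma> + A v) \<tau>) * ennreal (\<tau> powr \<alpha> * cmod (rho2 k z (pt k v (\<sigma> + A v) \<tau>)) powr - \<beta>) \<partial>lborel \<partial>?P \<partial>lborel)"
      by (subst nn_integral_TB_coordinates[where k=k and A=A]) auto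
    also have "\<dots> \<le> (\<integral>\<^sup>+\<tau>. indicator {0<..} \<tau> * ennreal (4 powr \<beta> * C1 * C2 ^ m * (\<tau> powr \<alpha> * (r + \<tau>) powr - (\<beta> - n))) \<partial>lborel)"
    proof (rule nn_integral_mono)
      fix \<tau> :: real
      show "(\<integral>\<^sup>+v. \<integral>\<^sup>+\<sigma>. indicator (TB k) (pt k v (\<sigma> + A v) \<tau>) * ennreal (\<tau> powr \<alpha> * cmod (rho2 k z (pt k v (\<sigma> + A v) \<tau>)) powr - \<beta>) \<partial>lborel \<partial>?P)
        \<le> indicator {0<..} \<tau> * ennreal (4 powr \<beta> * C1 * C2 ^ m * (\<tau> powr \<alpha> * (r + \<tau>) powr - (\<beta> - n)))"
      proof (cases "\<tau> > 0")
        case True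
        let ?R = "r + \<tau>"
        let ?p = "\<lambda>v. \<Prod>j\<in>UNIV-{k}. ennreal ((?R + (cmod (v j - z$j))\<^sup>2) powr - \<theta>)"
        have R: "?R > 0" using True r by simp
        have [measurable]: "(\<lambda>v. ?p v) \<in> borel_measurable ?P"
        proof (rule borel_measurable_prod_ennreal)
          fix j assume j: "j \<in> UNIV-{k}"
          show "(\<lambda>v. ennreal ((?R + (cmod (v j - z$j))\<^sup>2) powr - \<theta>)) \<in> borel_measurable ?P"
            by (rule measurable_compose[OF measurable_component_singleton[OF j]]) simp
        qed
        have "(\<integral>\<^sup>+v. \<integral>\<^sup>+\<sigma>. indicator (TB k) (pt k v (\<sigma> + A v) \<tau>) * ennreal (\<tau> powr \<alpha> * cmod (rho2 k z (pt k v (\<sigma> + A v) \<tau>)) powr - \<beta>) \<partial>lborel \<partial>?P)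
          \<le> (\<integral>\<^sup>+v. \<integral>\<^sup>+\<sigma>. (ennreal (\<tau> powr \<alpha> * 4 powr \<beta>) * ?p v) * ennreal ((?R + \<bar>\<sigma>\<bar>) powr - \<theta>) \<partial>lborel \<partial>?P)"
        proof (intro nn_integral_mono)
          fix v \<sigma>
          have "\<tau> powr \<alpha> * cmod (rho2 k z (pt k v (\<sigma> + A v) \<tau>)) powr - \<beta> \<le>
            (\<tau> powr \<alpha> * 4 powr \<beta> * (\<Prod>j\<in>UNIV-{k}. (?R + (cmod (v j - z$j))\<^sup>2) powr - \<theta>)) * (?R + \<bar>\<sigma>\<bar>) powr - \<theta>"
            using mult_left_mono[OF pw[OF True, of v \<sigma>], of "\<tau> powr \<alpha>"] by (simp add: ac_simps)
          then show "indicator (TB k) (pt k v (\<sigma> + A v) \<tau>) * ennreal (\<tau> powr \<alpha> * cmod (rho2 k z (pt k v (\<sigma> + A v) \<tau>)) powr - \<beta>)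
            \<le> (ennreal (\<tau> powr \<alpha> * 4 powr \<beta>) * ?p v) * ennreal ((?R + \<bar>\<sigma>\<bar>) powr - \<theta>)"
            using True by (auto simp: TB_iff prod_ennreal ennreal_mult[symmetric] prod_nonneg intro!: ennreal_leI)
        qed
        also have "\<dots> = (ennreal (\<tau> powr \<alpha> * 4 powr \<beta>) * (\<integral>\<^sup>+v. ?p v \<partial>?P)) * (\<integral>\<^sup>+\<sigma>. ennreal ((?R + \<bar>\<sigma>\<bar>) powr - \<theta>) \<partial>lborel)"
          by (simp add: nn_integral_cmult nn_integral_multc)
        also have "(\<integral>\<^sup>+v. ?p v \<partial>?P) = (\<Prod>j\<in>UNIV-{k}. \<integral>\<^sup>+c. ennreal ((?R + (cmod (c - z$j))\<^sup>2) powr - \<theta>) \<partial>lborel)"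
          by (rule product_nn_integral_prod) auto
        also have "(ennreal (\<tau> powr \<alpha> * 4 powr \<beta>) * \<dots>) * (\<integral>\<^sup>+\<sigma>. ennreal ((?R + \<bar>\<sigma>\<bar>) powr - \<theta>) \<partial>lborel)
          \<le> (ennreal (\<tau> powr \<alpha> * 4 powr \<beta>) * (\<Prod>j\<in>UNIV-{k}. ennreal (C2 * ?R powr (1 - \<theta>)))) * ennreal (C1 * ?R powr (1 - \<theta>))"
          unfolding C1_def C2_def
          by (intro mult_mono prod_mono_ennreal nn_integral_complex_shifted_powr nn_integral_shifted_abs_powr \<theta> R) auto
        also have "\<dots> = ennreal ((\<tau> powr \<alpha> * 4 powr \<beta>) * (C2 * ?R powr (1 - \<theta>)) ^ m * (C1 * ?R powr (1 - \<theta>)))"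
          unfolding prod_constant cm using C by (simp add: ennreal_mult[symmetric] ennreal_power)
        also have "(\<tau> powr \<alpha> * 4 powr \<beta>) * (C2 * ?R powr (1 - \<theta>)) ^ m * (C1 * ?R powr (1 - \<theta>))
          = 4 powr \<beta> * C1 * C2 ^ m * (\<tau> powr \<alpha> * ?R powr - (\<beta> - n))"
        proof -
          have "(?R powr (1 - \<theta>)) ^ m * ?R powr (1 - \<theta>) = ?R powr (real m * (1 - \<theta>) + (1 - \<theta>))"
            using R by (simp add: powr_power powr_add mult.commute)
          also have "real m * (1 - \<theta>) + (1 - \<theta>) = - (\<beta> - n)" using \<theta>\<beta> n by (simp add: algebra_simps)
          finally show ?thesis by (simp add: power_mult_distrib ac_simps)
        qed
        finally show ?thesis using True by simp
      qed (simp add: TB_iff indicator_def)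
    qed
    also have "\<dots> = (\<integral>\<^sup>+\<tau>. ennreal (4 powr \<beta> * C1 * C2 ^ m) * (indicator {0<..} \<tau> * ennreal (\<tau> powr \<alpha> * (r + \<tau>) powr - (\<beta> - n))) \<partial>lborel)"
      using C by (intro nn_integral_cong) (auto simp: ennreal_mult ac_simps)
    also have "\<dots> = ennreal (4 powr \<beta> * C1 * C2 ^ m) * (\<integral>\<^sup>+\<tau>. indicator {0<..} \<tau> * ennreal (\<tau> powr \<alpha> * (r + \<tau>) powr - (\<beta> - n)) \<partial>lborel)"
      by (rule nn_integral_cmult) simp
    also have "\<dots> \<le> ennreal (4 powr \<beta> * C1 * C2 ^ m) * ennreal (C3 * r powr (\<alpha> - (\<beta> - n) + 1))"
      unfolding C3_def using \<alpha> \<beta> r by (intro mult_left_mono nn_integral_powr_shifted_powr) auto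
    also have "\<dots> = ennreal (4 powr \<beta> * C1 * C2 ^ m * C3 * r powr (\<alpha> - \<beta> + n + 1))"
      using C by (simp add: ennreal_mult[symmetric] algebra_simps)
    finally show "(\<integral>\<^sup>+u. indicator (TB k) u * ennreal (rho k u powr \<alpha> * cmod (rho2 k z u) powr - \<beta>) \<partial>lborel)
     \<le> ennreal (4 powr \<beta> * C1 * C2 ^ m * C3 * rho k z powr (\<alpha> - \<beta> + n + 1))" by (simp add: r_def)
  qed
qed

text \<open>A box in tube coordinates with parabolic scaling: \<open>Re (z$k)\<close> has size
  \<open>r\<close>, the other coordinates have size \<open>sqrt r\<close>. The radius may depend on
  the height, so constant \<open>r\<close> gives a cylinder and linear \<open>r\<close> gives a
  parabolic cone.\<close>

definition cylinder :: "'n::finite \<Rightarrow> (real \<Rightarrow> real) \<Rightarrow> real set \<Rightarrow> (complex^'n) set" where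
  "cylinder k r S = {z. rho k z \<in> S \<and> \<bar>Re (z$k)\<bar> < r (rho k z) \<and>
     (\<forall>j\<in>UNIV-{k}. (Re (z$j))\<^sup>2 < r (rho k z) \<and> (Im (z$j))\<^sup>2 < r (rho k z))}"

lemma measurable_cylinder:
  assumes [measurable]: "r \<in> borel_measurable borel" "S \<in> sets borel"
  shows "cylinder k r S \<in> sets borel"
proof -
  have [measurable]: "(\<lambda>z::complex^'n. Re (z$j)) \<in> borel_measurable borel" "(\<lambda>z::complex^'n. Im (z$j)) \<in> borel_measurable borel" for j
    by (intro borel_measurable_continuous_onI continuous_intros)+
  have "Measurable.pred borel (\<lambda>z. rho k z \<in> S \<and> \<bar>Re (z$k)\<bar> < r (rho k z) \<and>
     (\<forall>j\<in>UNIV-{k}. (Re (z$j))\<^sup>2 < r (rho k z) \<and> (Im (z$j))\<^sup>2 < r (rho k z)))"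
    by measurable
  then show ?thesis unfolding cylinder_def pred_def by simp
qed

text \<open>The slice at height \<open>\<tau>\<close> is the product of an interval of length
  \<open>2 * r \<tau>\<close> and n - 1 squares of side \<open>2 * sqrt (r \<tau>)\<close>.\<close>

lemma nn_integral_cylinder:
  fixes k :: "'n::finite"
  assumes [measurable]: "r \<in> borel_measurable borel" "S \<in> sets borel" "\<phi> \<in> borel_measurable borel"
    and r: "\<And>\<tau>. \<tau> \<in> S \<Longrightarrow> r \<tau> > 0"
  shows "(\<integral>\<^sup>+z. indicator (cylinder k r S) z * \<phi> (rho k z) \<partial>lborel)
    = (\<integral>\<^sup>+\<tau>. indicator S \<tau> * (ennreal (2 * 4 ^ (CARD('n) - 1) * r \<tau> ^ CARD('n)) * \<phi> \<tau>) \<partial>lborel)"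
proof -
  let ?P = "Pi\<^sub>M (UNIV-{k}) (\<lambda>_. lborel :: complex measure)"
  interpret product_sigma_finite "\<lambda>_::'n. lborel :: complex measure" ..
  note measurable_cylinder[measurable]
  let ?q = "\<lambda>\<tau> c::complex. indicator {c. (Re c)\<^sup>2 < r \<tau> \<and> (Im c)\<^sup>2 < r \<tau>} c :: ennreal"
  have [measurable]: "(\<lambda>c. ?q \<tau> c) \<in> borel_measurable borel" for \<tau> by measurable
  have "(\<integral>\<^sup>+z. indicator (cylinder k r S) z * \<phi> (rho k z) \<partial>lborel)
    = (\<integral>\<^sup>+\<tau>. \<integral>\<^sup>+v. \<integral>\<^sup>+\<sigma>. indicator (cylinder k r S) (pt k v (\<sigma> + 0) \<tau>) * \<phi> (rho k (pt k v (\<sigma> + 0) \<tau>)) \<partial>lborel \<partial>?P \<partial>lborel)"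
    by (rule nn_integral_TB_coordinates) auto
  also have "\<dots> = (\<integral>\<^sup>+\<tau>. indicator S \<tau> * (ennreal (2 * 4 ^ (CARD('n) - 1) * r \<tau> ^ CARD('n)) * \<phi> \<tau>) \<partial>lborel)"
  proof (rule nn_integral_cong)
    fix \<tau> :: real
    show "(\<integral>\<^sup>+v. \<integral>\<^sup>+\<sigma>. indicator (cylinder k r S) (pt k v (\<sigma> + 0) \<tau>) * \<phi> (rho k (pt k v (\<sigma> + 0) \<tau>)) \<partial>lborel \<partial>?P)
      = indicator S \<tau> * (ennreal (2 * 4 ^ (CARD('n) - 1) * r \<tau> ^ CARD('n)) * \<phi> \<tau>)"
    proof (cases "\<tau> \<in> S")
      case True
      have [measurable]: "(\<lambda>v. \<Prod>j\<in>UNIV-{k}. ?q \<tau> (v j)) \<in> borel_measurable ?P"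
      proof (rule borel_measurable_prod_ennreal)
        fix j assume j: "j \<in> UNIV-{k}"
        show "(\<lambda>v. ?q \<tau> (v j)) \<in> borel_measurable ?P"
          by (rule measurable_compose[OF measurable_component_singleton[OF j]]) simp
      qed
      have p: "(\<Prod>j\<in>UNIV-{k}. ?q \<tau> (v j)) = indicator {v. \<forall>j\<in>UNIV-{k}. (Re (v j))\<^sup>2 < r \<tau> \<and> (Im (v j))\<^sup>2 < r \<tau>} v" for v
      proof (cases "\<forall>j\<in>UNIV-{k}. (Re (v j))\<^sup>2 < r \<tau> \<and> (Im (v j))\<^sup>2 < r \<tau>")
        case False
        then obtain j where "j \<in> UNIV-{k}" "?q \<tau> (v j) = 0" by (auto simp: indicator_def)
        then have "(\<Prod>j\<in>UNIV-{k}. ?q \<tau> (v j)) = 0" by (intro prod_zero) auto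
        with False show ?thesis by simp
      qed simp
      have "(\<integral>\<^sup>+v. \<integral>\<^sup>+\<sigma>. indicator (cylinder k r S) (pt k v (\<sigma> + 0) \<tau>) * \<phi> (rho k (pt k v (\<sigma> + 0) \<tau>)) \<partial>lborel \<partial>?P)
         = (\<integral>\<^sup>+v. \<integral>\<^sup>+\<sigma>. \<phi> \<tau> * (\<Prod>j\<in>UNIV-{k}. ?q \<tau> (v j)) * indicator {-r \<tau><..<r \<tau>} \<sigma> \<partial>lborel \<partial>?P)"
        unfolding p using True
        by (intro nn_integral_cong) (auto simp: indicator_def cylinder_def pt_nth)
      also have "\<dots> = \<phi> \<tau> * (\<integral>\<^sup>+v. (\<Prod>j\<in>UNIV-{k}. ?q \<tau> (v j)) \<partial>?P) * ennreal (2 * r \<tau>)"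
        using r[OF True] by (simp add: nn_integral_cmult nn_integral_multc)
      also have "(\<integral>\<^sup>+v. (\<Prod>j\<in>UNIV-{k}. ?q \<tau> (v j)) \<partial>?P) = (\<Prod>j\<in>UNIV-{k}. \<integral>\<^sup>+c. ?q \<tau> c \<partial>lborel)"
        by (rule product_nn_integral_prod) auto
      also have "(\<integral>\<^sup>+c. ?q \<tau> c \<partial>lborel) = ennreal (4 * r \<tau>)"
      proof -
        let ?I = "{-sqrt (r \<tau>)<..<sqrt (r \<tau>)}"
        have sq: "x\<^sup>2 < r \<tau> \<longleftrightarrow> x \<in> ?I" for x
          using r[OF True] real_sqrt_less_iff[of "x\<^sup>2" "r \<tau>"] by (auto simp del: real_sqrt_less_iff simp: abs_less_iff)
        have "(\<integral>\<^sup>+c. ?q \<tau> c \<partial>lborel) = (\<integral>\<^sup>+y. \<integral>\<^sup>+x. indicator ?I y * indicator ?I x \<partial>lborel \<partial>lborel)"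
          by (subst nn_integral_complex) (auto simp: sq indicator_def intro!: nn_integral_cong)
        also have "\<dots> = ennreal (2 * sqrt (r \<tau>)) * ennreal (2 * sqrt (r \<tau>))"
          using r[OF True] by (simp add: nn_integral_cmult nn_integral_multc)
        also have "\<dots> = ennreal (4 * r \<tau>)" using r[OF True] by (simp add: ennreal_mult[symmetric])
        finally show ?thesis .
      qed
      also have "\<phi> \<tau> * (\<Prod>j\<in>UNIV-{k}. ennreal (4 * r \<tau>)) * ennreal (2 * r \<tau>) = ennreal (2 * r \<tau> * (4 * r \<tau>) ^ (CARD('n) - 1)) * \<phi> \<tau>"
        using r[OF True] by (simp add: ennreal_mult ennreal_power[symmetric] ac_simps)
      also have "2 * r \<tau> * (4 * r \<tau>) ^ (CARD('n) - 1) = 2 * 4 ^ (CARD('n) - 1) * r \<tau> ^ CARD('n)"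
        using zero_less_card_finite[where 'a='n] by (cases "CARD('n)") (auto simp: power_mult_distrib)
      finally show ?thesis using True by simp
    qed (simp add: indicator_def cylinder_def)
  qed
  finally show ?thesis .
qed

section \<open>Jensen and Schur estimates\<close>

lemma epow_ennreal: "x \<ge> 0 \<Longrightarrow> epow (ennreal x) r = ennreal (x powr r)"
  by (simp add: epow_def)

lemma epow_top [simp]: "epow top r = top"
  by (simp add: epow_def)

lemma epow_zero [simp]: "epow 0 r = 0"
  by (simp add: epow_def)

lemma epow_one [simp]: "epow x 1 = x"
  by (cases x) (auto simp: epow_def)

text \<open>The convention \<open>0 powr r = 0\<close> holds for every \<open>r\<close>, including
  \<open>r = 0\<close>, and \<open>top\<close> is always sent to \<open>top\<close>. Hence this and
  the multiplication rules below carry no condition on the sign of the exponent.\<close>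

lemma epow_eq_zero_iff [simp]: "epow x r = 0 \<longleftrightarrow> x = 0"
  by (cases x) (auto simp: epow_def)

lemma epow_eq_top_iff [simp]: "epow x r = top \<longleftrightarrow> x = top"
  by (cases x) (auto simp: epow_def)

lemma epow_mono: "x \<le> y \<Longrightarrow> 0 \<le> r \<Longrightarrow> epow x r \<le> epow y r"
  by (cases x; cases y) (auto simp: epow_ennreal powr_mono2 top_unique)

lemma epow_mult: "epow (x * y) r = epow x r * epow y r"
proof (cases x; cases y)
  fix a b :: real assume "0 \<le> a" "x = ennreal a" "0 \<le> b" "y = ennreal b"
  then show ?thesis by (simp add: ennreal_mult[symmetric] epow_ennreal powr_mult)
qed (auto simp: epow_ennreal ennreal_top_mult ennreal_mult_top)

lemma epow_epow: "epow (epow x r) s = epow x (r * s)"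
  by (cases x) (auto simp: epow_ennreal powr_powr)

lemma epow_add: "epow x r * epow x s = epow x (r + s)"
  by (cases x) (auto simp: epow_ennreal ennreal_mult[symmetric] powr_add)

lemma measurable_epow [measurable]: "(\<lambda>x. epow x r) \<in> borel_measurable borel"
  unfolding epow_def by measurable

text \<open>Convexity: the graph of \<open>t powr r\<close> lies above its tangent at
  \<open>c\<close>. The inequality is Young's with weights \<open>1/r\<close> and
  \<open>1 - 1/r\<close>.\<close>

lemma powr_tangent:
  fixes t c r :: real
  assumes "t \<ge> 0" "c > 0" "r \<ge> 1"
  shows "r * c powr (r - 1) * t \<le> t powr r + (r - 1) * c powr r"
proof (cases "t = 0")
  case False
  have "(t powr r) powr (1/r) * (c powr r) powr (1 - 1/r) \<le> (1/r) * t powr r + (1 - 1/r) * c powr r"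
    using assms False by (intro Youngs_inequality_0) auto
  moreover have "(t powr r) powr (1/r) = t" using assms by (simp add: powr_powr)
  moreover have "(c powr r) powr (1 - 1/r) = c powr (r - 1)" using assms by (simp add: powr_powr algebra_simps)
  ultimately have "t * c powr (r - 1) \<le> (1/r) * t powr r + (1 - 1/r) * c powr r" by simp
  from mult_left_mono[OF this, of r] show ?thesis using assms by (simp add: algebra_simps)
qed (use assms in auto)

text \<open>The measure with density \<open>\<phi>\<close> is not normalised; the factor with
  exponent \<open>r - 1\<close> compensates for its mass. The proof integrates the tangent
  inequality at the mean of \<open>g\<close>.\<close>

lemma nn_integral_Jensen:
  fixes g \<phi> :: "'a \<Rightarrow> real"
  assumes [measurable]: "g \<in> borel_measurable M" "\<phi> \<in> borel_measurable M"
    and nn: "\<And>x. g x \<ge> 0" "\<And>x. \<phi> x \<ge> 0" and r: "r \<ge> 1"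
  shows "epow (\<integral>\<^sup>+x. ennreal (g x * \<phi> x) \<partial>M) r
    \<le> (\<integral>\<^sup>+x. ennreal (g x powr r * \<phi> x) \<partial>M) * epow (\<integral>\<^sup>+x. ennreal (\<phi> x) \<partial>M) (r - 1)"
proof -
  let ?I = "\<integral>\<^sup>+x. ennreal (g x * \<phi> x) \<partial>M" and ?X = "\<integral>\<^sup>+x. ennreal (g x powr r * \<phi> x) \<partial>M" and ?F = "\<integral>\<^sup>+x. ennreal (\<phi> x) \<partial>M"
  \<comment> \<open>If one factor on the right is 0, the product is 0 even when the other factor is
    infinite, so the left side has to vanish as well.\<close>
  have z: "?I = 0" if "?X = 0 \<or> ?F = 0"
  proof -
    have "AE x in M. g x * \<phi> x = 0"
      using that
    proof
      assume "?X = 0"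
      then have "AE x in M. ennreal (g x powr r * \<phi> x) = 0" by (subst (asm) nn_integral_0_iff_AE) auto
      then show ?thesis by eventually_elim (use nn in \<open>auto simp: ennreal_eq_0_iff mult_le_0_iff order_antisym_conv\<close>)
    next
      assume "?F = 0"
      then have "AE x in M. ennreal (\<phi> x) = 0" by (subst (asm) nn_integral_0_iff_AE) auto
      then show ?thesis by eventually_elim (use nn in \<open>auto simp: ennreal_eq_0_iff intro: antisym\<close>)
    qed
    then show ?thesis by (subst nn_integral_0_iff_AE) auto
  qed
  show ?thesis
  proof (cases "?X = 0 \<or> ?F = 0")
    case True then show ?thesis using z by simp
  next
    case nz: False
    show ?thesis
    proof (cases "?X = top \<or> ?F = top")
      case True then show ?thesis using nz by (auto simp: ennreal_top_mult ennreal_mult_top)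
    next
      case False
      then obtain X F where X: "?X = ennreal X" "X > 0" and F: "?F = ennreal F" "F > 0"
        using nz by (cases ?X; cases ?F) (auto simp: less_le)
      have young: "ennreal (r * c powr (r - 1)) * ?I \<le> ennreal (X + (r - 1) * c powr r * F)" if c: "c > 0" for c
      proof -
        have "ennreal (r * c powr (r - 1)) * ?I = (\<integral>\<^sup>+x. ennreal (r * c powr (r - 1)) * ennreal (g x * \<phi> x) \<partial>M)"
          by (rule nn_integral_cmult[symmetric]) simp
        also have "\<dots> \<le> (\<integral>\<^sup>+x. ennreal (g x powr r * \<phi> x) + ennreal ((r - 1) * c powr r) * ennreal (\<phi> x) \<partial>M)"
        proof (rule nn_integral_mono)
          fix x
          have "r * c powr (r - 1) * g x * \<phi> x \<le> (g x powr r + (r - 1) * c powr r) * \<phi> x"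
            using powr_tangent[of "g x" c r] nn c r by (intro mult_right_mono) auto
          then show "ennreal (r * c powr (r - 1)) * ennreal (g x * \<phi> x) \<le> ennreal (g x powr r * \<phi> x) + ennreal ((r - 1) * c powr r) * ennreal (\<phi> x)"
            using nn r by (subst (1 2) ennreal_mult[symmetric], simp, simp, simp, simp)
              (subst ennreal_plus[symmetric], simp, simp, rule ennreal_leI, simp add: algebra_simps)
        qed
        also have "\<dots> = ?X + ennreal ((r - 1) * c powr r) * ?F"
          by (subst nn_integral_add) (auto simp: nn_integral_cmult)
        also have "\<dots> = ennreal (X + (r - 1) * c powr r * F)"
          using X F r by (simp add: ennreal_mult[symmetric])
        finally show ?thesis .
      qed
      \<comment> \<open>A single tangent point already bounds the integral by a finite number; this
        makes the mean \<open>i / F\<close> available as the next tangent point.\<close>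
      have "?I \<noteq> top" using young[of 1] r by (auto simp: ennreal_mult_top top_unique)
      then obtain i where i: "?I = ennreal i" "i \<ge> 0" by (cases ?I) auto
      show ?thesis
      proof (cases "i = 0")
        case True then show ?thesis using i by simp
      next
        case False
        then have i0: "i > 0" using i by simp
        \<comment> \<open>The mean of \<open>g\<close> for the normalised measure, the tangent point
          at which the integrated inequality becomes Jensen's.\<close>
        define c where "c = i / F"
        have c: "c > 0" using i0 F by (simp add: c_def)
        have "r * c powr (r - 1) * i \<le> X + (r - 1) * c powr r * F"
        proof -
          have "ennreal (r * c powr (r - 1) * i) \<le> ennreal (X + (r - 1) * c powr r * F)"
            using young[OF c] i r by (simp add: ennreal_mult'' del: ennreal_plus)
          then show ?thesis using X F r by (subst (asm) ennreal_le_iff) auto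
        qed
        moreover have "c powr r * F = c powr (r - 1) * i"
        proof -
          have "c powr r = c powr (r - 1) * c" using c powr_add[of c "r - 1" 1] by simp
          then show ?thesis using F by (simp add: c_def)
        qed
        ultimately have "r * (c powr (r - 1) * i) \<le> X + (r - 1) * (c powr (r - 1) * i)" by (simp add: mult.assoc)
        then have *: "c powr (r - 1) * i \<le> X" by (simp add: algebra_simps)
        have "i powr r = i powr (r - 1) * i" using i0 powr_add[of i "r - 1" 1] by simp
        also have "\<dots> = c powr (r - 1) * i * F powr (r - 1)"
          using i0 F by (simp add: c_def powr_divide)
        also have "\<dots> \<le> X * F powr (r - 1)" using * by (intro mult_right_mono) auto
        finally show ?thesis unfolding i(1) X(1) F(1)
          using i X F by (simp add: epow_ennreal ennreal_mult[symmetric])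
      qed
    qed
  qed
qed

text \<open>If \<open>g\<close> maps point masses into a bounded subset of \<open>L\<^sup>r\<close>, then Jensen's inequality
  for the measure \<open>\<phi> dx\<close> and Tonelli bound the whole operator on \<open>L\<^sup>1\<close>; no integral Minkowski inequality is needed.\<close>

lemma (in pair_sigma_finite) nn_integral_Schur_L1:
  fixes g :: "'a \<Rightarrow> 'b \<Rightarrow> real"
  assumes g[measurable]: "(\<lambda>(z,x). g z x) \<in> borel_measurable (M1 \<Otimes>\<^sub>M M2)"
    and [measurable]: "\<phi> \<in> borel_measurable M2" "\<omega> \<in> borel_measurable M1"
    and nn: "\<And>z x. g z x \<ge> 0" "\<And>x. \<phi> x \<ge> 0" "\<And>z. \<omega> z \<ge> 0" and r: "r \<ge> 1"
    and bd: "\<And>x. \<phi> x \<noteq> 0 \<Longrightarrow> (\<integral>\<^sup>+z. ennreal (g z x powr r * \<omega> z) \<partial>M1) \<le> ennreal C"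
  shows "(\<integral>\<^sup>+z. epow (\<integral>\<^sup>+x. ennreal (g z x * \<phi> x) \<partial>M2) r * ennreal (\<omega> z) \<partial>M1)
    \<le> ennreal C * epow (\<integral>\<^sup>+x. ennreal (\<phi> x) \<partial>M2) r"
proof -
  let ?F = "\<integral>\<^sup>+x. ennreal (\<phi> x) \<partial>M2"
  have "(\<integral>\<^sup>+z. epow (\<integral>\<^sup>+x. ennreal (g z x * \<phi> x) \<partial>M2) r * ennreal (\<omega> z) \<partial>M1)
    \<le> (\<integral>\<^sup>+z. (\<integral>\<^sup>+x. ennreal (g z x powr r * \<phi> x) \<partial>M2) * epow ?F (r - 1) * ennreal (\<omega> z) \<partial>M1)"
    using nn r by (intro nn_integral_mono mult_right_mono nn_integral_Jensen) auto
  also have "\<dots> = (\<integral>\<^sup>+z. epow ?F (r - 1) * (\<integral>\<^sup>+x. ennreal (g z x powr r * \<phi> x) * ennreal (\<omega> z) \<partial>M2) \<partial>M1)"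
    by (intro nn_integral_cong, subst nn_integral_multc) (auto simp: ac_simps)
  also have "\<dots> = epow ?F (r - 1) * (\<integral>\<^sup>+z. \<integral>\<^sup>+x. ennreal (g z x powr r * \<phi> x) * ennreal (\<omega> z) \<partial>M2 \<partial>M1)"
    by (rule nn_integral_cmult) simp
  also have "(\<integral>\<^sup>+z. \<integral>\<^sup>+x. ennreal (g z x powr r * \<phi> x) * ennreal (\<omega> z) \<partial>M2 \<partial>M1)
    = (\<integral>\<^sup>+x. \<integral>\<^sup>+z. ennreal (g z x powr r * \<phi> x) * ennreal (\<omega> z) \<partial>M1 \<partial>M2)"
    by (rule Fubini'[symmetric]) simp
  also have "\<dots> = (\<integral>\<^sup>+x. ennreal (\<phi> x) * (\<integral>\<^sup>+z. ennreal (g z x powr r * \<omega> z) \<partial>M1) \<partial>M2)"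
    using nn by (intro nn_integral_cong, subst nn_integral_cmult[symmetric])
      (auto intro!: nn_integral_cong simp: ennreal_mult ac_simps)
  also have "\<dots> \<le> (\<integral>\<^sup>+x. ennreal (\<phi> x) * ennreal C \<partial>M2)"
  proof (rule nn_integral_mono)
    fix x
    show "ennreal (\<phi> x) * (\<integral>\<^sup>+z. ennreal (g z x powr r * \<omega> z) \<partial>M1) \<le> ennreal (\<phi> x) * ennreal C"
      using bd[of x] by (cases "\<phi> x = 0") (auto intro: mult_left_mono)
  qed
  also have "\<dots> = ?F * ennreal C" by (rule nn_integral_multc) simp
  also have "epow ?F (r - 1) * (?F * ennreal C) = ennreal C * (epow ?F (r - 1) * epow ?F 1)"
    by (simp add: ac_simps)
  also have "\<dots> = ennreal C * epow ?F r" unfolding epow_add by simp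
  finally show ?thesis by (simp add: mult_left_mono)
qed


text \<open>Jensen with exponent \<open>p\<close> against the Schur weight replaces \<open>h\<close>
  by the density \<open>\<phi>\<close> of its p-th power, at the cost of a negative power of
  \<open>rho k w\<close>. What remains is an operator from \<open>L^1\<close> to \<open>L^r\<close>
  with \<open>r = q / p\<close>, and for this it suffices to bound the columns of its kernel
  \<open>g\<close> uniformly.\<close>

lemma Forelli_Rudin_bounded:
  fixes k :: "'n::finite" and p q a b c \<alpha> \<beta> :: real
  defines "n \<equiv> real CARD('n)"
  assumes p: "1 < p" and q: "p \<le> q" and ab: "\<alpha> + 1 < p * (b + 1)" and a: "- q * a < \<beta> + 1"
    and c: "c = n + 1 + a + b + ((n + 1 + \<beta>) / q - (n + 1 + \<alpha>) / p)"
  shows "\<exists>C\<ge>0. \<forall>h\<in>borel_measurable borel. (\<forall>\<eta>. 0 \<le> h \<eta>) \<longrightarrow>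
    (\<integral>\<^sup>+w. indicator (TB k) w * epow (\<integral>\<^sup>+\<eta>. indicator (TB k) \<eta> *
        ennreal (rho k w powr a * rho k \<eta> powr b * cmod (rho2 k w \<eta>) powr - c * h \<eta>) \<partial>lborel) q
        * ennreal (rho k w powr \<beta>) \<partial>lborel)
    \<le> ennreal C * epow (\<integral>\<^sup>+\<eta>. indicator (TB k) \<eta> * ennreal (h \<eta> powr p * rho k \<eta> powr \<alpha>) \<partial>lborel) (q / p)"
proof -
  txt \<open>The Schur weight is \<open>\<rho>(\<eta>)\<^sup>x |\<rho>(w,\<eta>)|\<^sup>-\<^sup>y\<close>: the upper bound on \<open>x\<close> and the smallness of
    \<open>e = y - x - n - 1\<close> are exactly what the second kernel integral needs to converge.\<close>
  define r where "r = q / p"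
  have r: "r \<ge> 1" and pr: "p * r = q" and qr: "q - r > 0" using p q by (auto simp: r_def field_simps)
  \<comment> \<open>Equivalent to \<open>\<alpha> + 1 < p * (b + 1)\<close>: this hypothesis says
    exactly that an admissible exponent \<open>x\<close> exists.\<close>
  have "-1 < (b * p - \<alpha>) / (p - 1)" using p ab by (simp add: field_simps)
  then obtain x where x: "-1 < x" "x < (b * p - \<alpha>) / (p - 1)" using dense by blast
  \<comment> \<open>Half of the largest value for which \<open>X > -1\<close> below can hold; it is
    positive because of the condition on \<open>a\<close>.\<close>
  define e where "e = (\<beta> + 1 + a * q) / (2 * (q - r))"
  have e: "e > 0" and er: "(q - r) * e < \<beta> + 1 + a * q"
  proof -
    have D: "\<beta> + 1 + a * q > 0" using a by (simp add: mult.commute)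
    then show "e > 0" using qr by (simp add: e_def)
    have "(q - r) * e = (\<beta> + 1 + a * q) / 2" using qr unfolding e_def by (simp add: divide_simps)
    then show "(q - r) * e < \<beta> + 1 + a * q" using D by simp
  qed
  define y where "y = x + n + 1 + e"
  define X where "X = \<beta> + a * q - (q - r) * e"
  define Y where "Y = c * q - y * (q - r)"
  have X: "X > -1" using er by (simp add: X_def)
  have cq: "c * q = q * (n + 1 + a + b) + (n + 1 + \<beta>) - (n + 1 + \<alpha>) * r"
    using p q unfolding c r_def by (simp add: field_simps)
  have "x * (p - 1) < b * p - \<alpha>" using x p by (simp add: pos_less_divide_eq)
  then have "x * (p - 1) * r < (b * p - \<alpha>) * r" using r by (intro mult_strict_right_mono) auto
  then have xq: "x * (q - r) < b * q - \<alpha> * r" unfolding pr[symmetric] by (simp add: algebra_simps)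
  have Y: "Y > n + 1 + X" using xq unfolding Y_def X_def y_def cq by (simp add: algebra_simps)
  obtain C0 where C0: "C0 > 0" and J0: "\<And>z. z \<in> TB k \<Longrightarrow> (\<integral>\<^sup>+u. indicator (TB k) u * ennreal (rho k u powr x * cmod (rho2 k z u) powr - y) \<partial>lborel)
     \<le> ennreal (C0 * rho k z powr (x - y + n + 1))"
    using nn_integral_kernel_le[of x y k] x e unfolding n_def y_def by auto
  obtain C1 where C1: "C1 > 0" and J1: "\<And>z. z \<in> TB k \<Longrightarrow> (\<integral>\<^sup>+u. indicator (TB k) u * ennreal (rho k u powr X * cmod (rho2 k z u) powr - Y) \<partial>lborel)
     \<le> ennreal (C1 * rho k z powr (X - Y + n + 1))"
    using nn_integral_kernel_le[of X Y k] X Y unfolding n_def by auto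
  show ?thesis
  proof (intro exI[of _ "(C0 powr (p - 1)) powr r * C1"] conjI ballI impI)
    show "0 \<le> (C0 powr (p - 1)) powr r * C1" using C1 by simp
    fix h :: "complex^'n \<Rightarrow> real" assume h[measurable]: "h \<in> borel_measurable borel" and h0': "\<forall>\<eta>. 0 \<le> h \<eta>"
    then have h0: "0 \<le> h \<eta>" for \<eta> by auto
    \<comment> \<open>Up to the constant from \<open>C0\<close>, the kernel left by the first Jensen
      step: \<open>g' powr p * m\<close> times the mass factor
      \<open>rho k w powr (- e * (p - 1))\<close>, after \<open>h powr p\<close> and
      \<open>rho k \<eta> powr \<alpha>\<close> have been moved into \<open>\<phi>\<close>.\<close>
    define g where "g w \<eta> = indicator (TB k) w * indicator (TB k) \<eta> *
      (rho k w powr (a * p - (p - 1) * e) * rho k \<eta> powr ((b - x) * p + x - \<alpha>) * cmod (rho2 k w \<eta>) powr ((y - c) * p - y))" for w \<eta>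
    define \<phi> where "\<phi> \<eta> = indicator (TB k) \<eta> * (h \<eta> powr p * rho k \<eta> powr \<alpha>)" for \<eta>
    define I where "I w = (\<integral>\<^sup>+\<eta>. indicator (TB k) \<eta> *
        ennreal (rho k w powr a * rho k \<eta> powr b * cmod (rho2 k w \<eta>) powr - c * h \<eta>) \<partial>lborel)" for w
    have [measurable]: "\<phi> \<in> borel_measurable borel" unfolding \<phi>_def by measurable
    have [measurable]: "(\<lambda>(z, x). g z x) \<in> borel_measurable (lborel \<Otimes>\<^sub>M lborel)"
      unfolding g_def by measurable
    have step1: "epow (I w) p \<le> ennreal (C0 powr (p - 1)) * (\<integral>\<^sup>+\<eta>. ennreal (g w \<eta> * \<phi> \<eta>) \<partial>lborel)" if w: "w \<in> TB k" for w
    proof -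
      define g' where "g' \<eta> = indicator (TB k) \<eta> * (rho k w powr a * rho k \<eta> powr (b - x) * cmod (rho2 k w \<eta>) powr (y - c) * h \<eta>)" for \<eta>
      define m where "m \<eta> = indicator (TB k) \<eta> * (rho k \<eta> powr x * cmod (rho2 k w \<eta>) powr - y)" for \<eta>
      have [measurable]: "g' \<in> borel_measurable borel" "m \<in> borel_measurable borel"
        unfolding g'_def m_def by measurable
      have nn: "g' \<eta> \<ge> 0" "m \<eta> \<ge> 0" for \<eta> using h0 by (simp_all add: g'_def m_def)
      have "I w = (\<integral>\<^sup>+\<eta>. ennreal (g' \<eta> * m \<eta>) \<partial>lborel)"
        unfolding I_def
      proof (rule nn_integral_cong)
        fix \<eta>
        show "indicator (TB k) \<eta> * ennreal (rho k w powr a * rho k \<eta> powr b * cmod (rho2 k w \<eta>) powr - c * h \<eta>) = ennreal (g' \<eta> * m \<eta>)"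
        proof (cases "\<eta> \<in> TB k")
          case True
          have "rho k \<eta> powr b = rho k \<eta> powr (b - x) * rho k \<eta> powr x"
            "cmod (rho2 k w \<eta>) powr - c = cmod (rho2 k w \<eta>) powr (y - c) * cmod (rho2 k w \<eta>) powr - y"
            by (simp_all add: powr_add[symmetric])
          then show ?thesis using True by (simp add: g'_def m_def ac_simps)
        qed (simp add: g'_def m_def)
      qed
      then have "epow (I w) p \<le> (\<integral>\<^sup>+\<eta>. ennreal (g' \<eta> powr p * m \<eta>) \<partial>lborel) * epow (\<integral>\<^sup>+\<eta>. ennreal (m \<eta>) \<partial>lborel) (p - 1)"
        using nn_integral_Jensen[of g' lborel m p] p nn by auto
      also have "\<dots> \<le> (\<integral>\<^sup>+\<eta>. ennreal (g' \<eta> powr p * m \<eta>) \<partial>lborel) * ennreal (C0 powr (p - 1) * rho k w powr (- e * (p - 1)))"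
      proof (rule mult_left_mono)
        have "(\<integral>\<^sup>+\<eta>. ennreal (m \<eta>) \<partial>lborel) = (\<integral>\<^sup>+u. indicator (TB k) u * ennreal (rho k u powr x * cmod (rho2 k w u) powr - y) \<partial>lborel)"
          by (intro nn_integral_cong) (auto simp: m_def indicator_def)
        also have "\<dots> \<le> ennreal (C0 * rho k w powr - e)" using J0[OF w] by (simp add: y_def)
        finally have "epow (\<integral>\<^sup>+\<eta>. ennreal (m \<eta>) \<partial>lborel) (p - 1) \<le> epow (ennreal (C0 * rho k w powr - e)) (p - 1)"
          using p by (intro epow_mono) auto
        also have "\<dots> = ennreal (C0 powr (p - 1) * rho k w powr (- e * (p - 1)))"
          using C0 by (simp add: epow_ennreal powr_mult powr_powr)
        finally show "epow (\<integral>\<^sup>+\<eta>. ennreal (m \<eta>) \<partial>lborel) (p - 1) \<le> ennreal (C0 powr (p - 1) * rho k w powr (- e * (p - 1)))" .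
      qed simp
      also have "\<dots> = (\<integral>\<^sup>+\<eta>. ennreal (g' \<eta> powr p * m \<eta>) * ennreal (C0 powr (p - 1) * rho k w powr (- e * (p - 1))) \<partial>lborel)"
        by (rule nn_integral_multc[symmetric]) simp
      also have "\<dots> = (\<integral>\<^sup>+\<eta>. ennreal (C0 powr (p - 1)) * ennreal (g w \<eta> * \<phi> \<eta>) \<partial>lborel)"
      proof (rule nn_integral_cong)
        fix \<eta>
        have eq: "g' \<eta> powr p * m \<eta> * (C0 powr (p - 1) * rho k w powr (- e * (p - 1))) = C0 powr (p - 1) * (g w \<eta> * \<phi> \<eta>)"
        proof (cases "\<eta> \<in> TB k")
          case True
          have E: "rho k \<eta> powr ((b - x) * p) * rho k \<eta> powr x = rho k \<eta> powr ((b - x) * p + x - \<alpha>) * rho k \<eta> powr \<alpha>"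
            "rho k w powr (a * p) * rho k w powr (- e * (p - 1)) = rho k w powr (a * p - (p - 1) * e)"
            "cmod (rho2 k w \<eta>) powr ((y - c) * p) * cmod (rho2 k w \<eta>) powr - y = cmod (rho2 k w \<eta>) powr ((y - c) * p - y)"
            by (simp_all add: powr_add[symmetric] algebra_simps)
          have eq: "g' \<eta> powr p * m \<eta> * (C0 powr (p - 1) * rho k w powr (- e * (p - 1))) =
            C0 powr (p - 1) * (h \<eta> powr p * (rho k \<eta> powr ((b - x) * p) * rho k \<eta> powr x) * (rho k w powr (a * p) * rho k w powr (- e * (p - 1)))
              * (cmod (rho2 k w \<eta>) powr ((y - c) * p) * cmod (rho2 k w \<eta>) powr - y))"
            using True unfolding g'_def m_def by (simp add: powr_mult powr_powr)
          also have "\<dots> = C0 powr (p - 1) * (g w \<eta> * \<phi> \<eta>)" unfolding E using True w by (simp add: g_def \<phi>_def)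
          finally show ?thesis .
        qed (simp add: m_def \<phi>_def)
        show "ennreal (g' \<eta> powr p * m \<eta>) * ennreal (C0 powr (p - 1) * rho k w powr (- e * (p - 1))) = ennreal (C0 powr (p - 1)) * ennreal (g w \<eta> * \<phi> \<eta>)"
          using nn by (subst (1 2) ennreal_mult'[symmetric]) (auto simp only: eq intro!: mult_nonneg_nonneg powr_ge_zero)
      qed
      also have "\<dots> = ennreal (C0 powr (p - 1)) * (\<integral>\<^sup>+\<eta>. ennreal (g w \<eta> * \<phi> \<eta>) \<partial>lborel)"
        by (rule nn_integral_cmult) simp
      finally show ?thesis .
    qed
    have bd: "(\<integral>\<^sup>+w. ennreal (g w \<eta> powr r * (indicator (TB k) w * rho k w powr \<beta>)) \<partial>lborel) \<le> ennreal C1" if "\<phi> \<eta> \<noteq> 0" for \<eta>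
    proof -
      have \<eta>: "\<eta> \<in> TB k" using that by (auto simp: \<phi>_def indicator_def split: if_splits)
      have "(\<integral>\<^sup>+w. ennreal (g w \<eta> powr r * (indicator (TB k) w * rho k w powr \<beta>)) \<partial>lborel)
        = (\<integral>\<^sup>+w. ennreal (rho k \<eta> powr (((b - x) * p + x - \<alpha>) * r)) * (indicator (TB k) w * ennreal (rho k w powr X * cmod (rho2 k \<eta> w) powr - Y)) \<partial>lborel)"
      proof (rule nn_integral_cong)
        fix w
        show "ennreal (g w \<eta> powr r * (indicator (TB k) w * rho k w powr \<beta>)) = ennreal (rho k \<eta> powr (((b - x) * p + x - \<alpha>) * r)) * (indicator (TB k) w * ennreal (rho k w powr X * cmod (rho2 k \<eta> w) powr - Y))"
        proof (cases "w \<in> TB k")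
          case True
          have E: "(a * p - (p - 1) * e) * r + \<beta> = X" "((y - c) * p - y) * r = - Y"
            unfolding X_def Y_def pr[symmetric] by (simp_all add: algebra_simps)
          have "g w \<eta> powr r * rho k w powr \<beta> = rho k \<eta> powr (((b - x) * p + x - \<alpha>) * r) * (rho k w powr ((a * p - (p - 1) * e) * r + \<beta>) * cmod (rho2 k w \<eta>) powr (((y - c) * p - y) * r))"
            using True \<eta> by (simp add: g_def powr_mult powr_powr powr_add)
          then show ?thesis using True unfolding E by (simp add: ennreal_mult[symmetric] cmod_rho2_commute[of k w])
        qed simp
      qed
      also have "\<dots> = ennreal (rho k \<eta> powr (((b - x) * p + x - \<alpha>) * r)) * (\<integral>\<^sup>+w. indicator (TB k) w * ennreal (rho k w powr X * cmod (rho2 k \<eta> w) powr - Y) \<partial>lborel)"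
        by (rule nn_integral_cmult) simp
      also have "\<dots> \<le> ennreal (rho k \<eta> powr (((b - x) * p + x - \<alpha>) * r)) * ennreal (C1 * rho k \<eta> powr (X - Y + n + 1))"
        by (intro mult_left_mono J1 \<eta>) auto
      also have "\<dots> = ennreal (C1 * rho k \<eta> powr (((b - x) * p + x - \<alpha>) * r + (X - Y + n + 1)))"
        using C1 by (simp add: ennreal_mult[symmetric] powr_add ac_simps)
      \<comment> \<open>The auxiliary \<open>x\<close> and \<open>e\<close> cancel, and the
        prescribed value of \<open>c\<close> cancels the rest, so the column bound does not depend
        on \<open>\<eta>\<close>.\<close>
      also have "((b - x) * p + x - \<alpha>) * r + (X - Y + n + 1) = 0"
        unfolding X_def Y_def cq y_def unfolding pr[symmetric] by (simp add: algebra_simps)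
      also have "C1 * rho k \<eta> powr 0 = C1" using \<eta> by (simp add: TB_iff)
      finally show ?thesis .
    qed
    have "(\<integral>\<^sup>+w. indicator (TB k) w * epow (I w) q * ennreal (rho k w powr \<beta>) \<partial>lborel)
      \<le> (\<integral>\<^sup>+w. ennreal ((C0 powr (p - 1)) powr r) * (epow (\<integral>\<^sup>+\<eta>. ennreal (g w \<eta> * \<phi> \<eta>) \<partial>lborel) r * ennreal (indicator (TB k) w * rho k w powr \<beta>)) \<partial>lborel)"
    proof (rule nn_integral_mono)
      fix w
      show "indicator (TB k) w * epow (I w) q * ennreal (rho k w powr \<beta>) \<le> ennreal ((C0 powr (p - 1)) powr r) * (epow (\<integral>\<^sup>+\<eta>. ennreal (g w \<eta> * \<phi> \<eta>) \<partial>lborel) r * ennreal (indicator (TB k) w * rho k w powr \<beta>))"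
      proof (cases "w \<in> TB k")
        case True
        have "epow (I w) q = epow (epow (I w) p) r" by (simp add: epow_epow pr)
        also have "\<dots> \<le> epow (ennreal (C0 powr (p - 1)) * (\<integral>\<^sup>+\<eta>. ennreal (g w \<eta> * \<phi> \<eta>) \<partial>lborel)) r"
          using r by (intro epow_mono step1 True) auto
        also have "\<dots> = ennreal ((C0 powr (p - 1)) powr r) * epow (\<integral>\<^sup>+\<eta>. ennreal (g w \<eta> * \<phi> \<eta>) \<partial>lborel) r"
          by (simp add: epow_mult epow_ennreal)
        finally show ?thesis using True by (simp add: mult.assoc[symmetric] mult_right_mono)
      qed simp
    qed
    also have "\<dots> = ennreal ((C0 powr (p - 1)) powr r) * (\<integral>\<^sup>+w. epow (\<integral>\<^sup>+\<eta>. ennreal (g w \<eta> * \<phi> \<eta>) \<partial>lborel) r * ennreal (indicator (TB k) w * rho k w powr \<beta>) \<partial>lborel)"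
      by (rule nn_integral_cmult) simp
    also have "\<dots> \<le> ennreal ((C0 powr (p - 1)) powr r) * (ennreal C1 * epow (\<integral>\<^sup>+\<eta>. ennreal (\<phi> \<eta>) \<partial>lborel) r)"
      by (intro mult_left_mono lborel_pair.nn_integral_Schur_L1 bd r) (auto simp: g_def \<phi>_def)
    also have "(\<integral>\<^sup>+\<eta>. ennreal (\<phi> \<eta>) \<partial>lborel) = (\<integral>\<^sup>+\<eta>. indicator (TB k) \<eta> * ennreal (h \<eta> powr p * rho k \<eta> powr \<alpha>) \<partial>lborel)"
      by (intro nn_integral_cong) (auto simp: \<phi>_def indicator_def)
    finally show "(\<integral>\<^sup>+w. indicator (TB k) w * epow (\<integral>\<^sup>+\<eta>. indicator (TB k) \<eta> *
        ennreal (rho k w powr a * rho k \<eta> powr b * cmod (rho2 k w \<eta>) powr - c * h \<eta>) \<partial>lborel) q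
        * ennreal (rho k w powr \<beta>) \<partial>lborel)
    \<le> ennreal ((C0 powr (p - 1)) powr r * C1) * epow (\<integral>\<^sup>+\<eta>. indicator (TB k) \<eta> * ennreal (h \<eta> powr p * rho k \<eta> powr \<alpha>) \<partial>lborel) (q / p)"
      using C1 by (simp add: I_def r_def ennreal_mult mult.assoc)
  qed
qed

section \<open>Sufficiency\<close>

text \<open>The interface of the sufficiency part: measurability and modulus on the tube. The kernel
  is cut off there because the principal power in \<open>KT\<close> is controlled only where
  \<open>rho2\<close> has positive real part.\<close>

definition power_kernel :: "'n::finite \<Rightarrow> real \<Rightarrow> real \<Rightarrow>
    (complex^'n \<Rightarrow> complex^'n \<Rightarrow> complex^'n \<Rightarrow> complex^'n \<Rightarrow> complex) \<Rightarrow> bool" where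
  "power_kernel k c1 c2 K \<longleftrightarrow> (\<forall>z\<in>TB k. \<forall>w\<in>TB k.
     (\<lambda>x. indicator (TB k \<times> TB k) x *\<^sub>R K z w (fst x) (snd x)) \<in> borel_measurable borel \<and>
     (\<forall>u\<in>TB k. \<forall>\<eta>\<in>TB k. cmod (K z w u \<eta>) = cmod (rho2 k z u) powr - c1 * cmod (rho2 k w \<eta>) powr - c2))"

lemma borel_measurable_fst_snd [measurable]:
  "fst \<in> borel_measurable (borel :: ('a::second_countable_topology \<times> 'b::second_countable_topology) measure)"
  "snd \<in> borel_measurable (borel :: ('a \<times> 'b) measure)"
  unfolding borel_prod[symmetric] by simp_all

text \<open>The mixed norm integrates the first variable inside, so its finiteness yields null sets
  in the opposite order to the one expected by the product measure.\<close>

lemma AE_lborel_pair_swap: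
  assumes "{x. P (fst x) (snd x)} \<in> sets (borel :: ('a::euclidean_space \<times> 'b::euclidean_space) measure)"
    and "AE w in lborel. AE z in lborel. P z w"
  shows "AE x in lborel. P (fst x) (snd x)"
proof -
  have S: "{x \<in> space (lborel \<Otimes>\<^sub>M lborel). P (fst x) (snd x)} \<in> sets (lborel \<Otimes>\<^sub>M lborel)"
    using assms(1) unfolding lborel_prod by simp
  have "AE z in lborel. AE w in lborel. P z w"
    using assms(2) lborel_pair.AE_commute[OF S] by simp
  then have "AE x in lborel \<Otimes>\<^sub>M lborel. P (fst x) (snd x)"
    using lborel_pair.AE_pair_measure[OF S] by simp
  then show ?thesis unfolding lborel_prod .
qed

lemma measurable_TB_Times [measurable]: "TB k \<times> TB k \<in> sets borel"
  using pair_measureI[OF measurable_TB[of k] measurable_TB[of k]] unfolding borel_prod .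

text \<open>For fixed \<open>w\<close>, the operator on absolute values integrates
  \<open>g z x * \<phi> w x\<close> over the pair x of inner variables, where only \<open>g\<close>
  depends on \<open>z\<close>. The \<open>L^1\<close> Schur estimate with exponent \<open>q1\<close>
  bounds its norm in \<open>z\<close> by the total mass of \<open>\<phi> w\<close>, which is the
  scalar operator in the second variable applied to the inner norm \<open>h\<close>.\<close>

lemma kernel_conditions_imp_bounded_op:
  fixes k :: "'n::finite" and p2 q1 q2 a1 a2 b1 b2 c1 c2 \<alpha>1 \<alpha>2 \<beta>1 \<beta>2 :: real
  defines "n \<equiv> real CARD('n)"
  assumes p2: "1 < p2" and q1: "1 \<le> q1" and q2: "p2 \<le> q2"
    and K: "power_kernel k c1 c2 K"
    and b1: "\<alpha>1 < b1" and b2: "\<alpha>2 + 1 < p2 * (b2 + 1)"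
    and a1: "- q1 * a1 < \<beta>1 + 1" and a2: "- q2 * a2 < \<beta>2 + 1"
    and c1: "c1 = n + 1 + a1 + b1 + ((n + 1 + \<beta>1) / q1 - (n + 1 + \<alpha>1))"
    and c2: "c2 = n + 1 + a2 + b2 + ((n + 1 + \<beta>2) / q2 - (n + 1 + \<alpha>2) / p2)"
  shows "bounded_op k K (a1,a2) (b1,b2) (1,p2) (\<alpha>1,\<alpha>2) (q1,q2) (\<beta>1,\<beta>2)"
proof -
  have cq: "c1 * q1 = n + 1 + \<beta>1 + a1 * q1 + q1 * (b1 - \<alpha>1)"
    using q1 unfolding c1 by (simp add: field_simps)
  \<comment> \<open>By \<open>cq\<close> this quantity is exactly the excess of
    \<open>c1 * q1\<close> over the critical exponent of the kernel integral.\<close>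
  have "q1 * (b1 - \<alpha>1) > 0" using q1 b1 by simp
  then obtain C1 where C1: "C1 > 0" and J1: "\<And>z. z \<in> TB k \<Longrightarrow>
     (\<integral>\<^sup>+u. indicator (TB k) u * ennreal (rho k u powr (a1 * q1 + \<beta>1) * cmod (rho2 k z u) powr - (c1 * q1)) \<partial>lborel)
     \<le> ennreal (C1 * rho k z powr (a1 * q1 + \<beta>1 - c1 * q1 + n + 1))"
    using nn_integral_kernel_le[of "a1 * q1 + \<beta>1" "c1 * q1" k] a1 cq unfolding n_def by (auto simp: mult.commute)
  obtain C2 where C2: "C2 \<ge> 0" and J2: "\<And>h. h \<in> borel_measurable borel \<Longrightarrow> (\<forall>\<eta>. 0 \<le> h \<eta>) \<Longrightarrow>
    (\<integral>\<^sup>+w. indicator (TB k) w * epow (\<integral>\<^sup>+\<eta>. indicator (TB k) \<eta> *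
        ennreal (rho k w powr a2 * rho k \<eta> powr b2 * cmod (rho2 k w \<eta>) powr - c2 * h \<eta>) \<partial>lborel) q2
        * ennreal (rho k w powr \<beta>2) \<partial>lborel)
    \<le> ennreal C2 * epow (\<integral>\<^sup>+\<eta>. indicator (TB k) \<eta> * ennreal (h \<eta> powr p2 * rho k \<eta> powr \<alpha>2) \<partial>lborel) (q2 / p2)"
    using Forelli_Rudin_bounded[OF p2 q2 b2 a2 c2[unfolded n_def], of k] by blast
  define C where "C = (C1 powr (q2 / q1) * C2) powr (1 / q2)"
  show ?thesis
    unfolding bounded_op_def
  proof (intro exI[of _ C] allI impI)
    fix f assume f: "inLp k (1,p2) (\<alpha>1,\<alpha>2) f"
    have fm: "(\<lambda>(z,w). f z w) \<in> borel_measurable (borel \<Otimes>\<^sub>M borel)"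
      using f by (simp add: inLp_def borel_prod)
    have fm'[measurable (raw)]: "(\<lambda>x. f (g x) (h x)) \<in> borel_measurable M"
      if "g \<in> borel_measurable M" "h \<in> borel_measurable M" for M :: "'z measure" and g h
      using measurable_compose[OF measurable_Pair[OF that] fm] by simp
    have fm2[measurable]: "(\<lambda>x. f (fst x) (snd x)) \<in> borel_measurable borel"
      by (simp add: fm')
    define \<Phi> where "\<Phi> \<eta> = (\<integral>\<^sup>+u. indicator (TB k) u * ennreal (cmod (f u \<eta>) * rho k u powr \<alpha>1) \<partial>lborel)" for \<eta>
    have [measurable]: "\<Phi> \<in> borel_measurable borel" unfolding \<Phi>_def by (simp add: fm')
    \<comment> \<open>Where the inner norm is infinite, \<open>enn2real\<close> gives 0; finiteness
      of the mixed norm confines this to a null set of the tube, see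
      \<open>\<Phi>fin\<close>.\<close>
    define h where "h \<eta> = enn2real (\<Phi> \<eta>)" for \<eta>
    have [measurable]: "h \<in> borel_measurable borel" unfolding h_def by measurable
    have mix: "mixnorm k (1,p2) (\<alpha>1,\<alpha>2) f = epow (\<integral>\<^sup>+w. indicator (TB k) w * epow (\<Phi> w) p2 * ennreal (rho k w powr \<alpha>2) \<partial>lborel) (1 / p2)"
      by (simp add: mixnorm_def \<Phi>_def)
    have fin: "(\<integral>\<^sup>+w. indicator (TB k) w * epow (\<Phi> w) p2 * ennreal (rho k w powr \<alpha>2) \<partial>lborel) \<noteq> \<infinity>"
      using f unfolding inLp_def mix by (auto simp: less_top[symmetric])
    have \<Phi>fin: "AE \<eta> in lborel. \<eta> \<in> TB k \<longrightarrow> \<Phi> \<eta> = ennreal (h \<eta>)"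
    proof -
      have "AE w in lborel. indicator (TB k) w * epow (\<Phi> w) p2 * ennreal (rho k w powr \<alpha>2) \<noteq> \<infinity>"
        by (rule nn_integral_PInf_AE[OF _ fin]) simp
      then show ?thesis
      proof eventually_elim
        case (elim \<eta>)
        show ?case
        proof
          assume "\<eta> \<in> TB k"
          then have "\<Phi> \<eta> \<noteq> top" using elim by (auto simp: TB_iff ennreal_top_mult)
          then show "\<Phi> \<eta> = ennreal (h \<eta>)" by (simp add: h_def less_top)
        qed
      qed
    qed
    have norm_f: "(\<integral>\<^sup>+\<eta>. indicator (TB k) \<eta> * ennreal (h \<eta> powr p2 * rho k \<eta> powr \<alpha>2) \<partial>lborel)
      = (\<integral>\<^sup>+w. indicator (TB k) w * epow (\<Phi> w) p2 * ennreal (rho k w powr \<alpha>2) \<partial>lborel)"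
    proof (rule nn_integral_cong_AE, use \<Phi>fin in eventually_elim)
      case (elim \<eta>)
      have "\<eta> \<in> TB k \<Longrightarrow> epow (\<Phi> \<eta>) p2 = ennreal (h \<eta> powr p2)"
        using elim epow_ennreal[of "h \<eta>" p2] by (simp add: h_def)
      then show ?case by (auto simp: indicator_def ennreal_mult)
    qed
    \<comment> \<open>The factor \<open>rho k u powr b1\<close> is split:
      \<open>b1 - \<alpha>1\<close> goes to \<open>g\<close>, while \<open>\<alpha>1\<close> goes to
      \<open>\<phi>\<close>, where it completes the weighted \<open>L^1\<close> norm of
      \<open>f\<close>.\<close>
    define g where "g z x = indicator (TB k) z * indicator (TB k) (fst x) *
      (rho k z powr a1 * rho k (fst x) powr (b1 - \<alpha>1) * cmod (rho2 k z (fst x)) powr - c1)" for z and x :: "(complex^'n) \<times> (complex^'n)"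
    define \<phi> where "\<phi> w x = indicator (TB k) (fst x) * indicator (TB k) (snd x) *
      (rho k w powr a2 * rho k (snd x) powr b2 * cmod (rho2 k w (snd x)) powr - c2 * (cmod (f (fst x) (snd x)) * rho k (fst x) powr \<alpha>1))" for w and x :: "(complex^'n) \<times> (complex^'n)"
    have nn: "g z x \<ge> 0" "\<phi> w x \<ge> 0" for z w x by (simp_all add: g_def \<phi>_def)
    have TBx[measurable]: "(\<lambda>x::(complex^'n) \<times> (complex^'n). indicator (TB k) (fst x) :: real) \<in> borel_measurable borel" "(\<lambda>x::(complex^'n) \<times> (complex^'n). indicator (TB k) (snd x) :: real) \<in> borel_measurable borel"
      by measurable
    have gm[measurable]: "(\<lambda>y. g (fst y) (snd y)) \<in> borel_measurable borel"
      unfolding g_def by measurable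
    have \<phi>m[measurable]: "(\<lambda>y. \<phi> (fst y) (snd y)) \<in> borel_measurable borel"
      unfolding \<phi>_def by measurable
    have gm'[measurable (raw)]: "(\<lambda>x. g (s x) (t x)) \<in> borel_measurable M"
      if "s \<in> borel_measurable M" "t \<in> borel_measurable M" for M :: "'z measure" and s t
      using measurable_compose[OF measurable_Pair[OF that, unfolded borel_prod] gm] by simp
    have \<phi>m'[measurable (raw)]: "(\<lambda>x. \<phi> (s x) (t x)) \<in> borel_measurable M"
      if "s \<in> borel_measurable M" "t \<in> borel_measurable M" for M :: "'z measure" and s t
      using measurable_compose[OF measurable_Pair[OF that, unfolded borel_prod] \<phi>m] by simp
    define G where "G z w = (\<integral>\<^sup>+x. ennreal (g z x * \<phi> w x) \<partial>lborel)" for z w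
    have Gm: "(\<lambda>x. G (fst x) (snd x)) \<in> borel_measurable borel"
      unfolding G_def by (rule lborel.borel_measurable_nn_integral) (simp add: case_prod_beta gm' \<phi>m')
    have stepA: "(\<integral>\<^sup>+z. epow (G z w) q1 * ennreal (indicator (TB k) z * rho k z powr \<beta>1) \<partial>lborel) \<le> ennreal C1 * epow (\<integral>\<^sup>+x. ennreal (\<phi> w x) \<partial>lborel) q1" for w
      unfolding G_def
    proof (rule lborel_pair.nn_integral_Schur_L1[OF _ _ _ nn(1) nn(2) _ q1])
      fix x assume "\<phi> w x \<noteq> 0"
      then have u: "fst x \<in> TB k" by (auto simp: \<phi>_def indicator_def split: if_splits)
      have "(\<integral>\<^sup>+z. ennreal (g z x powr q1 * (indicator (TB k) z * rho k z powr \<beta>1)) \<partial>lborel)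
        = (\<integral>\<^sup>+z. ennreal (rho k (fst x) powr ((b1 - \<alpha>1) * q1)) * (indicator (TB k) z * ennreal (rho k z powr (a1 * q1 + \<beta>1) * cmod (rho2 k (fst x) z) powr - (c1 * q1))) \<partial>lborel)"
      proof (rule nn_integral_cong)
        fix z
        show "ennreal (g z x powr q1 * (indicator (TB k) z * rho k z powr \<beta>1)) = ennreal (rho k (fst x) powr ((b1 - \<alpha>1) * q1)) * (indicator (TB k) z * ennreal (rho k z powr (a1 * q1 + \<beta>1) * cmod (rho2 k (fst x) z) powr - (c1 * q1)))"
          using u by (cases "z \<in> TB k")
            (auto simp: g_def powr_mult powr_powr powr_add cmod_rho2_commute[of k z] ennreal_mult[symmetric] ac_simps)
      qed
      also have "\<dots> = ennreal (rho k (fst x) powr ((b1 - \<alpha>1) * q1)) * (\<integral>\<^sup>+z. indicator (TB k) z * ennreal (rho k z powr (a1 * q1 + \<beta>1) * cmod (rho2 k (fst x) z) powr - (c1 * q1)) \<partial>lborel)"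
        by (rule nn_integral_cmult) simp
      also have "\<dots> \<le> ennreal (rho k (fst x) powr ((b1 - \<alpha>1) * q1)) * ennreal (C1 * rho k (fst x) powr (a1 * q1 + \<beta>1 - c1 * q1 + n + 1))"
        by (intro mult_left_mono J1 u) simp
      also have "\<dots> = ennreal (C1 * rho k (fst x) powr ((b1 - \<alpha>1) * q1 + (a1 * q1 + \<beta>1 - c1 * q1 + n + 1)))"
        using C1 by (simp add: ennreal_mult[symmetric] powr_add ac_simps)
      also have "(b1 - \<alpha>1) * q1 + (a1 * q1 + \<beta>1 - c1 * q1 + n + 1) = 0"
        unfolding cq by (simp add: algebra_simps)
      also have "C1 * rho k (fst x) powr 0 = C1" using u by (simp add: TB_iff)
      finally show "(\<integral>\<^sup>+z. ennreal (g z x powr q1 * (indicator (TB k) z * rho k z powr \<beta>1)) \<partial>lborel) \<le> ennreal C1" .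
    next
      show "\<phi> w \<in> borel_measurable lborel" using \<phi>m'[of "\<lambda>_. w" lborel "\<lambda>x. x"] by simp
    qed (auto simp: case_prod_beta)
    have stepB: "(\<integral>\<^sup>+x. ennreal (\<phi> w x) \<partial>lborel) = (\<integral>\<^sup>+\<eta>. indicator (TB k) \<eta> *
        ennreal (rho k w powr a2 * rho k \<eta> powr b2 * cmod (rho2 k w \<eta>) powr - c2 * h \<eta>) \<partial>lborel)" for w
    proof -
      have "(\<integral>\<^sup>+x. ennreal (\<phi> w x) \<partial>lborel) = (\<integral>\<^sup>+\<eta>. \<integral>\<^sup>+u. ennreal (\<phi> w (u, \<eta>)) \<partial>lborel \<partial>lborel)"
        unfolding lborel_prod[symmetric] by (rule lborel_pair.nn_integral_snd[symmetric]) (simp add: lborel_prod \<phi>m')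
      also have "\<dots> = (\<integral>\<^sup>+\<eta>. indicator (TB k) \<eta> * ennreal (rho k w powr a2 * rho k \<eta> powr b2 * cmod (rho2 k w \<eta>) powr - c2) * \<Phi> \<eta> \<partial>lborel)"
      proof (rule nn_integral_cong)
        fix \<eta>
        have "(\<integral>\<^sup>+u. ennreal (\<phi> w (u, \<eta>)) \<partial>lborel) = (\<integral>\<^sup>+u. (indicator (TB k) \<eta> * ennreal (rho k w powr a2 * rho k \<eta> powr b2 * cmod (rho2 k w \<eta>) powr - c2)) *
            (indicator (TB k) u * ennreal (cmod (f u \<eta>) * rho k u powr \<alpha>1)) \<partial>lborel)"
          by (intro nn_integral_cong) (auto simp: \<phi>_def indicator_def ennreal_mult[symmetric])
        also have "\<dots> = (indicator (TB k) \<eta> * ennreal (rho k w powr a2 * rho k \<eta> powr b2 * cmod (rho2 k w \<eta>) powr - c2)) * \<Phi> \<eta>"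
          unfolding \<Phi>_def by (rule nn_integral_cmult) (simp add: fm')
        finally show "(\<integral>\<^sup>+u. ennreal (\<phi> w (u, \<eta>)) \<partial>lborel) = indicator (TB k) \<eta> * ennreal (rho k w powr a2 * rho k \<eta> powr b2 * cmod (rho2 k w \<eta>) powr - c2) * \<Phi> \<eta>" .
      qed
      also have "\<dots> = (\<integral>\<^sup>+\<eta>. indicator (TB k) \<eta> * ennreal (rho k w powr a2 * rho k \<eta> powr b2 * cmod (rho2 k w \<eta>) powr - c2 * h \<eta>) \<partial>lborel)"
        by (rule nn_integral_cong_AE, use \<Phi>fin in eventually_elim) (auto simp: indicator_def ennreal_mult h_def)
      finally show ?thesis .
    qed
    \<comment> \<open>The mixed norm of the absolute operator \<open>G\<close>, raised to the power
      \<open>q2\<close>. Its finiteness will give convergence almost everywhere, and its size the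
      norm bound.\<close>
    define N where "N = (\<integral>\<^sup>+w. indicator (TB k) w * epow (\<integral>\<^sup>+z. epow (G z w) q1 * ennreal (indicator (TB k) z * rho k z powr \<beta>1) \<partial>lborel) (q2 / q1) * ennreal (rho k w powr \<beta>2) \<partial>lborel)"
    have q2': "q2 > 0" "q2 / q1 \<ge> 0" "p2 > 0" "q1 > 0" using p2 q1 q2 by auto
    have "N \<le> (\<integral>\<^sup>+w. ennreal (C1 powr (q2 / q1)) * (indicator (TB k) w * epow (\<integral>\<^sup>+\<eta>. indicator (TB k) \<eta> *
        ennreal (rho k w powr a2 * rho k \<eta> powr b2 * cmod (rho2 k w \<eta>) powr - c2 * h \<eta>) \<partial>lborel) q2 * ennreal (rho k w powr \<beta>2)) \<partial>lborel)"
      unfolding N_def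
    proof (rule nn_integral_mono)
      fix w
      let ?B = "\<integral>\<^sup>+\<eta>. indicator (TB k) \<eta> * ennreal (rho k w powr a2 * rho k \<eta> powr b2 * cmod (rho2 k w \<eta>) powr - c2 * h \<eta>) \<partial>lborel"
      have "epow (\<integral>\<^sup>+z. epow (G z w) q1 * ennreal (indicator (TB k) z * rho k z powr \<beta>1) \<partial>lborel) (q2 / q1) \<le> epow (ennreal C1 * epow ?B q1) (q2 / q1)"
        using stepA[of w] q2' unfolding stepB by (intro epow_mono) auto
      also have "\<dots> = ennreal (C1 powr (q2 / q1)) * epow ?B q2"
        using C1 q2' by (simp add: epow_mult epow_epow epow_ennreal)
      finally have "indicator (TB k) w * epow (\<integral>\<^sup>+z. epow (G z w) q1 * ennreal (indicator (TB k) z * rho k z powr \<beta>1) \<partial>lborel) (q2 / q1) * ennreal (rho k w powr \<beta>2)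
        \<le> indicator (TB k) w * (ennreal (C1 powr (q2 / q1)) * epow ?B q2) * ennreal (rho k w powr \<beta>2)"
        by (intro mult_mono) auto
      then show "indicator (TB k) w * epow (\<integral>\<^sup>+z. epow (G z w) q1 * ennreal (indicator (TB k) z * rho k z powr \<beta>1) \<partial>lborel) (q2 / q1) * ennreal (rho k w powr \<beta>2)
        \<le> ennreal (C1 powr (q2 / q1)) * (indicator (TB k) w * epow ?B q2 * ennreal (rho k w powr \<beta>2))" by (simp add: ac_simps)
    qed
    also have "\<dots> = ennreal (C1 powr (q2 / q1)) * (\<integral>\<^sup>+w. indicator (TB k) w * epow (\<integral>\<^sup>+\<eta>. indicator (TB k) \<eta> *
        ennreal (rho k w powr a2 * rho k \<eta> powr b2 * cmod (rho2 k w \<eta>) powr - c2 * h \<eta>) \<partial>lborel) q2 * ennreal (rho k w powr \<beta>2) \<partial>lborel)"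
      by (rule nn_integral_cmult) simp
    also have "\<dots> \<le> ennreal (C1 powr (q2 / q1)) * (ennreal C2 * epow (\<integral>\<^sup>+w. indicator (TB k) w * epow (\<Phi> w) p2 * ennreal (rho k w powr \<alpha>2) \<partial>lborel) (q2 / p2))"
      unfolding norm_f[symmetric] by (intro mult_left_mono J2) (auto simp: h_def)
    also have "\<dots> = ennreal (C1 powr (q2 / q1) * C2) * epow (\<integral>\<^sup>+w. indicator (TB k) w * epow (\<Phi> w) p2 * ennreal (rho k w powr \<alpha>2) \<partial>lborel) (q2 / p2)"
      using C2 by (simp add: ennreal_mult mult.assoc)
    finally have N: "N \<le> ennreal (C1 powr (q2 / q1) * C2) * epow (\<integral>\<^sup>+w. indicator (TB k) w * epow (\<Phi> w) p2 * ennreal (rho k w powr \<alpha>2) \<partial>lborel) (q2 / p2)" .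
    then have Nfin: "N \<noteq> \<infinity>" using fin by (auto simp: top_unique ennreal_mult_eq_top_iff)
    have epN: "epow N (1 / q2) \<le> ennreal C * mixnorm k (1,p2) (\<alpha>1,\<alpha>2) f"
    proof -
      have "epow N (1 / q2) \<le> epow (ennreal (C1 powr (q2 / q1) * C2) * epow (\<integral>\<^sup>+w. indicator (TB k) w * epow (\<Phi> w) p2 * ennreal (rho k w powr \<alpha>2) \<partial>lborel) (q2 / p2)) (1 / q2)"
        using q2' by (intro epow_mono N) auto
      also have "\<dots> = ennreal C * mixnorm k (1,p2) (\<alpha>1,\<alpha>2) f"
        using C2 q2' unfolding mix C_def by (simp add: epow_mult epow_epow epow_ennreal)
      finally show ?thesis .
    qed
    have GX: "G z w = ennreal (rho k z powr a1 * rho k w powr a2) * (\<integral>\<^sup>+x. ennreal (norm (indicator (TB k \<times> TB k) x *\<^sub>R integrand k K (b1,b2) f z w x)) \<partial>lborel)"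
      and Im: "(\<lambda>x. indicator (TB k \<times> TB k) x *\<^sub>R integrand k K (b1,b2) f z w x) \<in> borel_measurable borel"
      if z: "z \<in> TB k" and w: "w \<in> TB k" for z w
    proof -
      note K' = K[unfolded power_kernel_def, rule_format, OF z w]
      have [measurable]: "(\<lambda>x. indicator (TB k \<times> TB k) x *\<^sub>R K z w (fst x) (snd x)) \<in> borel_measurable borel" using K' by simp
      have "(\<lambda>x. (indicator (TB k \<times> TB k) x *\<^sub>R K z w (fst x) (snd x)) *
          (complex_of_real (rho k (fst x) powr b1 * rho k (snd x) powr b2) * f (fst x) (snd x))) \<in> borel_measurable borel"
        by measurable
      also have "(\<lambda>x. (indicator (TB k \<times> TB k) x *\<^sub>R K z w (fst x) (snd x)) *
          (complex_of_real (rho k (fst x) powr b1 * rho k (snd x) powr b2) * f (fst x) (snd x))) = (\<lambda>x. indicator (TB k \<times> TB k) x *\<^sub>R integrand k K (b1,b2) f z w x)"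
        by (auto simp: integrand_def fun_eq_iff indicator_def)
      finally show Im: "(\<lambda>x. indicator (TB k \<times> TB k) x *\<^sub>R integrand k K (b1,b2) f z w x) \<in> borel_measurable borel" .
      have "G z w = (\<integral>\<^sup>+x. ennreal (rho k z powr a1 * rho k w powr a2) * ennreal (norm (indicator (TB k \<times> TB k) x *\<^sub>R integrand k K (b1,b2) f z w x)) \<partial>lborel)"
        unfolding G_def
      proof (rule nn_integral_cong)
        fix x
        show "ennreal (g z x * \<phi> w x) = ennreal (rho k z powr a1 * rho k w powr a2) * ennreal (norm (indicator (TB k \<times> TB k) x *\<^sub>R integrand k K (b1,b2) f z w x))"
        proof (cases "fst x \<in> TB k \<and> snd x \<in> TB k")
          case True
          then have x: "x \<in> TB k \<times> TB k" by (cases x) auto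
          have E: "rho k (fst x) powr (b1 - \<alpha>1) * rho k (fst x) powr \<alpha>1 = rho k (fst x) powr b1" by (simp add: powr_add[symmetric])
          have "g z x * \<phi> w x = (rho k z powr a1 * rho k w powr a2) * (cmod (rho2 k z (fst x)) powr - c1 * cmod (rho2 k w (snd x)) powr - c2 * ((rho k (fst x) powr (b1 - \<alpha>1) * rho k (fst x) powr \<alpha>1) * rho k (snd x) powr b2) * cmod (f (fst x) (snd x)))"
            using True z by (simp add: g_def \<phi>_def ac_simps)
          also have "\<dots> = (rho k z powr a1 * rho k w powr a2) * norm (indicator (TB k \<times> TB k) x *\<^sub>R integrand k K (b1,b2) f z w x)"
            unfolding E using x True K' by (simp add: integrand_def norm_mult)
          finally show ?thesis by (simp add: ennreal_mult)
        next
          case False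
          then have "x \<notin> TB k \<times> TB k" by (cases x) auto
          with False show ?thesis by (auto simp: \<phi>_def g_def)
        qed
      qed
      also have "\<dots> = ennreal (rho k z powr a1 * rho k w powr a2) * (\<integral>\<^sup>+x. ennreal (norm (indicator (TB k \<times> TB k) x *\<^sub>R integrand k K (b1,b2) f z w x)) \<partial>lborel)"
      proof (rule nn_integral_cmult)
        note Im[measurable]
        show "(\<lambda>x. ennreal (norm (indicator (TB k \<times> TB k) x *\<^sub>R integrand k K (b1,b2) f z w x))) \<in> borel_measurable lborel"
          by measurable
      qed
      finally show "G z w = ennreal (rho k z powr a1 * rho k w powr a2) * (\<integral>\<^sup>+x. ennreal (norm (indicator (TB k \<times> TB k) x *\<^sub>R integrand k K (b1,b2) f z w x)) \<partial>lborel)" .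
    qed
    have integrable: "set_integrable lborel (TB k \<times> TB k) (integrand k K (b1,b2) f z w)" if z: "z \<in> TB k" and w: "w \<in> TB k" and "G z w < \<infinity>" for z w
    proof -
      have "rho k z powr a1 * rho k w powr a2 > 0" using z w by (simp add: TB_iff)
      then have "(\<integral>\<^sup>+x. ennreal (norm (indicator (TB k \<times> TB k) x *\<^sub>R integrand k K (b1,b2) f z w x)) \<partial>lborel) < \<infinity>"
        using that(3) unfolding GX[OF z w] by (auto simp: ennreal_mult_less_top less_top[symmetric] ennreal_mult_eq_top_iff)
      then show ?thesis unfolding set_integrable_def using Im[OF z w] by (intro integrableI_bounded) auto
    qed
    have normle: "ennreal (cmod (intop k K (a1,a2) (b1,b2) f z w)) \<le> G z w" if z: "z \<in> TB k" and w: "w \<in> TB k" for z w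
    proof (cases "set_integrable lborel (TB k \<times> TB k) (integrand k K (b1,b2) f z w)")
      case True
      have "ennreal (cmod (set_lebesgue_integral lborel (TB k \<times> TB k) (integrand k K (b1,b2) f z w))) \<le>
        (\<integral>\<^sup>+x. ennreal (norm (indicator (TB k \<times> TB k) x *\<^sub>R integrand k K (b1,b2) f z w x)) \<partial>lborel)"
        using True unfolding set_lebesgue_integral_def set_integrable_def by (rule integral_norm_bound_ennreal)
      then show ?thesis unfolding GX[OF z w] by (simp add: intop_def norm_mult ennreal_mult mult_left_mono)
    next
      \<comment> \<open>A function that is not integrable has Bochner integral 0, so domination by
        \<open>G\<close> holds at every point of the tube.\<close>
      case False
      then have "set_lebesgue_integral lborel (TB k \<times> TB k) (integrand k K (b1,b2) f z w) = 0"
        unfolding set_lebesgue_integral_def set_integrable_def by (rule not_integrable_integral_eq)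
      then show ?thesis by (simp add: intop_def)
    qed
    \<comment> \<open>Finiteness of \<open>N\<close> makes the inner integral finite for almost
      every \<open>w\<close>, and then \<open>G z w\<close> finite for almost every
      \<open>z\<close>.\<close>
    have AEG: "AE x in lborel. fst x \<in> TB k \<and> snd x \<in> TB k \<longrightarrow> G (fst x) (snd x) < \<infinity>"
    proof (rule AE_lborel_pair_swap)
      note Gm[measurable]
      show "{x. fst x \<in> TB k \<and> snd x \<in> TB k \<longrightarrow> G (fst x) (snd x) < \<infinity>} \<in> sets borel"
      proof -
        have "Measurable.pred borel (\<lambda>x. fst x \<in> TB k \<and> snd x \<in> TB k \<longrightarrow> G (fst x) (snd x) < \<infinity>)" by measurable
        then show ?thesis by (simp add: pred_def)
      qed
      have Gz: "(\<lambda>z. G z w) \<in> borel_measurable borel" for w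
        using measurable_compose[OF borel_measurable_Pair[of "\<lambda>z. z" borel "\<lambda>_. w"] Gm] by simp
      have Gw: "(\<lambda>x. G (snd x) (fst x)) \<in> borel_measurable (lborel \<Otimes>\<^sub>M lborel)"
        using measurable_compose[OF borel_measurable_Pair[of snd borel fst] Gm] by (simp add: lborel_prod)
      note [measurable] = Gz Gw
      have [measurable]: "(\<lambda>w. \<integral>\<^sup>+z. epow (G z w) q1 * ennreal (indicator (TB k) z * rho k z powr \<beta>1) \<partial>lborel) \<in> borel_measurable borel"
        using lborel.borel_measurable_nn_integral[of "\<lambda>w z. epow (G z w) q1 * ennreal (indicator (TB k) z * rho k z powr \<beta>1)" lborel] by (simp add: case_prod_beta)
      have "AE w in lborel. indicator (TB k) w * epow (\<integral>\<^sup>+z. epow (G z w) q1 * ennreal (indicator (TB k) z * rho k z powr \<beta>1) \<partial>lborel) (q2 / q1) * ennreal (rho k w powr \<beta>2) \<noteq> \<infinity>"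
        by (rule nn_integral_PInf_AE[OF _ Nfin[unfolded N_def]]) simp
      then show "AE w in lborel. AE z in lborel. z \<in> TB k \<and> w \<in> TB k \<longrightarrow> G z w < \<infinity>"
      proof eventually_elim
        case (elim w)
        show ?case
        proof (cases "w \<in> TB k")
          case True
          then have "(\<integral>\<^sup>+z. epow (G z w) q1 * ennreal (indicator (TB k) z * rho k z powr \<beta>1) \<partial>lborel) \<noteq> \<infinity>"
            using elim by (auto simp: TB_iff ennreal_top_mult)
          then have "AE z in lborel. epow (G z w) q1 * ennreal (indicator (TB k) z * rho k z powr \<beta>1) \<noteq> \<infinity>"
            by (intro nn_integral_PInf_AE) simp
          then show ?thesis by eventually_elim (auto simp: TB_iff ennreal_top_mult less_top[symmetric])
        qed simp
      qed
    qed
    show "(AE x in lborel. x \<in> TB k \<times> TB k \<longrightarrow> set_integrable lborel (TB k \<times> TB k) (integrand k K (b1,b2) f (fst x) (snd x)))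
        \<and> mixnorm k (q1,q2) (\<beta>1,\<beta>2) (intop k K (a1,a2) (b1,b2) f) \<le> ennreal C * mixnorm k (1,p2) (\<alpha>1,\<alpha>2) f"
    proof
      show "AE x in lborel. x \<in> TB k \<times> TB k \<longrightarrow> set_integrable lborel (TB k \<times> TB k) (integrand k K (b1,b2) f (fst x) (snd x))"
        using AEG by eventually_elim (auto intro: integrable)
      have "mixnorm k (q1,q2) (\<beta>1,\<beta>2) (intop k K (a1,a2) (b1,b2) f) \<le> epow N (1 / q2)"
        unfolding mixnorm_def N_def fst_conv snd_conv
      proof (intro epow_mono nn_integral_mono)
        fix w
        show "indicator (TB k) w * epow (\<integral>\<^sup>+z. indicator (TB k) z * ennreal (cmod (intop k K (a1,a2) (b1,b2) f z w) powr q1 * rho k z powr \<beta>1) \<partial>lborel) (q2 / q1) * ennreal (rho k w powr \<beta>2)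
          \<le> indicator (TB k) w * epow (\<integral>\<^sup>+z. epow (G z w) q1 * ennreal (indicator (TB k) z * rho k z powr \<beta>1) \<partial>lborel) (q2 / q1) * ennreal (rho k w powr \<beta>2)"
        proof (cases "w \<in> TB k")
          case w: True
          show ?thesis
          proof (intro mult_right_mono mult_left_mono epow_mono nn_integral_mono)
            fix z
            show "indicator (TB k) z * ennreal (cmod (intop k K (a1,a2) (b1,b2) f z w) powr q1 * rho k z powr \<beta>1) \<le> epow (G z w) q1 * ennreal (indicator (TB k) z * rho k z powr \<beta>1)"
            proof (cases "z \<in> TB k")
              case z: True
              have "ennreal (cmod (intop k K (a1,a2) (b1,b2) f z w) powr q1) = epow (ennreal (cmod (intop k K (a1,a2) (b1,b2) f z w))) q1"
                by (simp add: epow_ennreal)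
              also have "\<dots> \<le> epow (G z w) q1" using q1 by (intro epow_mono normle z w) auto
              finally show ?thesis using z by (simp add: ennreal_mult mult_right_mono)
            qed simp
          qed (use q2' in auto)
        qed simp
      qed (use q2' in auto)
      also note epN
      finally show "mixnorm k (q1,q2) (\<beta>1,\<beta>2) (intop k K (a1,a2) (b1,b2) f) \<le> ennreal C * mixnorm k (1,p2) (\<alpha>1,\<alpha>2) f" .
    qed
  qed
qed

section \<open>Coherence of the kernel and the test inequality\<close>

definition near :: "'n::finite \<Rightarrow> real \<Rightarrow> real \<Rightarrow> complex^'n \<Rightarrow> bool" where
  "near k \<delta> M z \<longleftrightarrow> \<bar>Re (z$k)\<bar> < \<delta> * M \<and> (\<forall>j\<in>UNIV-{k}. (Re (z$j))\<^sup>2 < \<delta> * M \<and> (Im (z$j))\<^sup>2 < \<delta> * M)"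

text \<open>Only the sum of the heights is tied to \<open>M\<close>, so one point may approach the
  boundary while the other keeps the kernel at scale \<open>M\<close>. The factor 4 admits two
  points with heights between \<open>M\<close> and \<open>2 * M\<close>.\<close>

definition close :: "'n::finite \<Rightarrow> real \<Rightarrow> real \<Rightarrow> complex^'n \<Rightarrow> complex^'n \<Rightarrow> bool" where
  "close k \<delta> M z u \<longleftrightarrow> 0 < M \<and> M \<le> rho k z + rho k u \<and> rho k z + rho k u \<le> 4 * M \<and> near k \<delta> M z \<and> near k \<delta> M u"

text \<open>The heights alone keep the real part above \<open>M / 2\<close>, whereas the imaginary
  part comes entirely from displacements controlled by \<open>\<delta>\<close>. Their quotient
  bounds the argument, through \<open>arctan\<close>, by a multiple of
  \<open>\<delta>\<close>.\<close>

lemma close_rho2: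
  fixes k :: "'n::finite"
  assumes cl: "close k \<delta> M z u" and \<delta>: "0 < \<delta>" "2 * real CARD('n) * \<delta> \<le> 1"
  shows "M / 2 \<le> Re (rho2 k z u)" "cmod (rho2 k z u) \<le> 4 * M" "\<bar>Im (Ln (rho2 k z u))\<bar> \<le> 4 * real CARD('n) * \<delta>"
proof -
  let ?n = "real CARD('n)" and ?D = "\<delta> * M" and ?\<omega> = "rho2 k z u"
  have M: "M > 0" and D: "?D > 0" using cl \<delta> by (auto simp: close_def)
  have n1: "?n \<ge> 1" using zero_less_card_finite[where 'a='n] by linarith
  have card: "real (card (UNIV - {k} :: 'n set)) = ?n - 1" using zero_less_card_finite[where 'a='n] by (simp add: of_nat_diff)
  have nD: "2 * (?n * ?D) \<le> M" using mult_right_mono[OF \<delta>(2), of M] M by (simp add: ac_simps)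
  have sq: "(x - y)\<^sup>2 \<le> 4 * ?D" "(x + y)\<^sup>2 \<le> 4 * ?D" if "x\<^sup>2 < ?D" "y\<^sup>2 < ?D" for x y
  proof -
    have "0 \<le> (x + y)\<^sup>2" "0 \<le> (x - y)\<^sup>2" by auto
    then show "(x - y)\<^sup>2 \<le> 4 * ?D" "(x + y)\<^sup>2 \<le> 4 * ?D" using that by (auto simp: power2_eq_square algebra_simps)
  qed
  have j: "(Re (z$j))\<^sup>2 < ?D" "(Im (z$j))\<^sup>2 < ?D" "(Re (u$j))\<^sup>2 < ?D" "(Im (u$j))\<^sup>2 < ?D" if "j \<in> UNIV-{k}" for j
    using cl that by (auto simp: close_def near_def)
  have k: "\<bar>Re (z$k)\<bar> < ?D" "\<bar>Re (u$k)\<bar> < ?D" using cl by (auto simp: close_def near_def)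
  have "(\<Sum>j\<in>UNIV-{k}. (cmod (z$j - u$j))\<^sup>2) \<le> (\<Sum>j\<in>UNIV-{k}. 8 * ?D)"
  proof (rule sum_mono)
    fix i assume i: "i \<in> UNIV-{k}"
    show "(cmod (z$i - u$i))\<^sup>2 \<le> 8 * ?D"
      using sq(1)[OF j(1)[OF i] j(3)[OF i]] sq(1)[OF j(2)[OF i] j(4)[OF i]] by (simp add: cmod_power2)
  qed
  also have "\<dots> \<le> 8 * (?n * ?D)" unfolding sum_constant card using D by (simp add: algebra_simps)
  finally have S: "(\<Sum>j\<in>UNIV-{k}. (cmod (z$j - u$j))\<^sup>2) \<le> 4 * M" using nD by linarith
  have S0: "0 \<le> (\<Sum>j\<in>UNIV-{k}. (cmod (z$j - u$j))\<^sup>2)" by (rule sum_nonneg) auto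
  show ReM: "M / 2 \<le> Re ?\<omega>" using Re_rho2_ge[of k z u] cl unfolding close_def add_divide_distrib by linarith
  have Re3: "Re ?\<omega> \<le> 3 * M" using S cl unfolding Re_rho2 close_def add_divide_distrib by linarith
  have "\<bar>\<Sum>j\<in>UNIV-{k}. (Re (z$j) - Re (u$j)) * (Im (z$j) + Im (u$j))\<bar> \<le> (\<Sum>j\<in>UNIV-{k}. 4 * ?D)"
  proof (rule order_trans[OF sum_abs], rule sum_mono)
    fix i assume i: "i \<in> UNIV-{k}"
    have *: "\<bar>s * t\<bar> \<le> (s\<^sup>2 + t\<^sup>2) / 2" for s t :: real
    proof -
      have "0 \<le> (s - t)\<^sup>2" "0 \<le> (s + t)\<^sup>2" by auto
      then show ?thesis by (auto simp: power2_eq_square algebra_simps abs_le_iff)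
    qed
    show "\<bar>(Re (z$i) - Re (u$i)) * (Im (z$i) + Im (u$i))\<bar> \<le> 4 * ?D"
      using *[of "Re (z$i) - Re (u$i)" "Im (z$i) + Im (u$i)"] sq(1)[OF j(1)[OF i] j(3)[OF i]] sq(2)[OF j(2)[OF i] j(4)[OF i]] unfolding add_divide_distrib by linarith
  qed
  also have "\<dots> = 4 * ((?n - 1) * ?D)" unfolding sum_constant card by simp
  finally have "\<bar>Im ?\<omega>\<bar> \<le> ?D + 2 * ((?n - 1) * ?D)" using k unfolding Im_rho2 add_divide_distrib diff_divide_distrib by linarith
  then have Im: "\<bar>Im ?\<omega>\<bar> \<le> 2 * (?n * ?D)" using D by (simp add: algebra_simps)
  show "cmod ?\<omega> \<le> 4 * M" using cmod_le[of ?\<omega>] Re3 ReM Im nD M by linarith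
  have pos: "Re ?\<omega> > 0" using ReM M by linarith
  have "Im (Ln ?\<omega>) = arctan (Im ?\<omega> / Re ?\<omega>)"
    using arg_conv_arctan[OF pos] pos by (subst Arg_eq_Im_Ln[symmetric]) auto
  also have "\<bar>\<dots>\<bar> \<le> \<bar>Im ?\<omega> / Re ?\<omega>\<bar>" by (rule abs_arctan_le)
  also have "\<dots> = \<bar>Im ?\<omega>\<bar> / Re ?\<omega>" using pos by (simp add: abs_divide)
  also have "\<dots> \<le> (2 * (?n * ?D)) / (M / 2)" using Im ReM M by (intro frac_le) auto
  also have "\<dots> = 4 * ?n * \<delta>" using M by simp
  finally show "\<bar>Im (Ln ?\<omega>)\<bar> \<le> 4 * ?n * \<delta>" .
qed

text \<open>The sign of \<open>c\<close> decides which of the two bounds on \<open>x\<close> is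
  used; the constant \<open>4 powr - |c|\<close> is small enough for either.\<close>

lemma powr_comparable_ge:
  fixes x M c :: real
  assumes "M > 0" "M / 2 \<le> x" "x \<le> 4 * M"
  shows "4 powr - \<bar>c\<bar> * M powr - c \<le> x powr - c"
proof (cases "c \<ge> 0")
  case True
  have "(4 * M) powr - c \<le> x powr - c" using assms True by (intro powr_mono2') auto
  then show ?thesis using True by (simp add: powr_mult)
next
  case False
  have "4 powr c \<le> (1 / 2) powr - c"
  proof -
    have "(1 / 2 :: real) powr - c = 2 powr c" by (simp add: powr_minus powr_divide)
    moreover have "4 powr c \<le> (2::real) powr c" using False by (intro powr_mono2') auto
    ultimately show ?thesis by simp
  qed
  then have "4 powr c * M powr - c \<le> (1 / 2) powr - c * M powr - c" by (intro mult_right_mono) auto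
  also have "\<dots> = (M / 2) powr - c" using assms by (simp add: powr_mult[symmetric])
  also have "\<dots> \<le> x powr - c" using assms False by (intro powr_mono2) auto
  finally show ?thesis using False by simp
qed

text \<open>The interface of the necessity part. A lower bound on the real part survives integration
  against nonnegative functions, which a bound on the modulus would not.\<close>

definition coherent_kernel :: "'n::finite \<Rightarrow> real \<Rightarrow> real \<Rightarrow>
    (complex^'n \<Rightarrow> complex^'n \<Rightarrow> complex^'n \<Rightarrow> complex^'n \<Rightarrow> complex) \<Rightarrow> bool" where
  "coherent_kernel k c1 c2 K \<longleftrightarrow> (\<exists>\<delta>>0. \<exists>\<kappa>>0. \<forall>z w u \<eta> M1 M2. close k \<delta> M1 z u \<longrightarrow> close k \<delta> M2 w \<eta> \<longrightarrow>
      \<kappa> * (M1 powr - c1 * M2 powr - c2) \<le> Re (K z w u \<eta>))"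

lemma KT_eq_exp:
  assumes "rho2 k z u \<noteq> 0" "rho2 k w \<eta> \<noteq> 0"
  shows "KT k (c1,c2) z w u \<eta> = exp (- (of_real c1 * Ln (rho2 k z u) + of_real c2 * Ln (rho2 k w \<eta>)))"
  using assms by (simp add: KT_def powr_def exp_diff exp_minus divide_inverse)

lemma Re_KT:
  assumes "rho2 k z u \<noteq> 0" "rho2 k w \<eta> \<noteq> 0"
  shows "Re (KT k (c1,c2) z w u \<eta>) = cmod (rho2 k z u) powr - c1 * cmod (rho2 k w \<eta>) powr - c2 *
    cos (c1 * Im (Ln (rho2 k z u)) + c2 * Im (Ln (rho2 k w \<eta>)))"
proof -
  have "exp (- (c1 * ln (cmod (rho2 k z u)) + c2 * ln (cmod (rho2 k w \<eta>)))) = cmod (rho2 k z u) powr - c1 * cmod (rho2 k w \<eta>) powr - c2"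
    using assms by (simp add: powr_def exp_add[symmetric])
  moreover have "cos (- (c1 * Im (Ln (rho2 k z u))) - c2 * Im (Ln (rho2 k w \<eta>))) = cos (c1 * Im (Ln (rho2 k z u)) + c2 * Im (Ln (rho2 k w \<eta>)))"
    using cos_minus[of "c1 * Im (Ln (rho2 k z u)) + c2 * Im (Ln (rho2 k w \<eta>))"] by simp
  ultimately show ?thesis unfolding KT_eq_exp[OF assms] using assms by (simp add: Re_exp)
qed

lemma coherent_kernels:
  fixes k :: "'n::finite"
  shows coherent_KS: "coherent_kernel k c1 c2 (KS k (c1,c2))"
    and coherent_KT: "coherent_kernel k c1 c2 (KT k (c1,c2))"
proof -
  let ?n = "real CARD('n)"
  have n1: "?n \<ge> 1" using zero_less_card_finite[where 'a='n] by linarith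
  \<comment> \<open>The aperture is adapted to the exponents: the combined phase stays below 1,
    hence below \<open>pi / 3\<close>, where the cosine is at least 1/2. The summand 1 also secures
    \<open>2 * n * \<delta> <= 1\<close>, with n the dimension, as \<open>close_rho2\<close>
    demands.\<close>
  define \<delta> where "\<delta> = 1 / (8 * ?n * (1 + \<bar>c1\<bar> + \<bar>c2\<bar>))"
  have \<delta>0: "\<delta> > 0" using n1 by (simp add: \<delta>_def add_pos_nonneg)
  have \<delta>1: "8 * ?n * \<delta> * (1 + \<bar>c1\<bar> + \<bar>c2\<bar>) = 1"
  proof -
    have "8 * ?n * (1 + \<bar>c1\<bar> + \<bar>c2\<bar>) \<noteq> 0" using n1 by (simp add: add_nonneg_eq_0_iff)
    then show ?thesis unfolding \<delta>_def by (simp add: field_simps)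
  qed
  have nd: "?n * \<delta> \<ge> 0" using n1 \<delta>0 by simp
  have \<delta>': "2 * ?n * \<delta> \<le> 1" "8 * (?n * \<delta>) * \<bar>c1\<bar> + 8 * (?n * \<delta>) * \<bar>c2\<bar> \<le> 1"
    using \<delta>1 nd mult_nonneg_nonneg[OF nd, of "\<bar>c1\<bar>"] mult_nonneg_nonneg[OF nd, of "\<bar>c2\<bar>"]
    by (simp_all add: algebra_simps)
  define \<kappa> where "\<kappa> = 1/2 * (4 powr - \<bar>c1\<bar> * 4 powr - \<bar>c2\<bar>)"
  have \<kappa>: "\<kappa> > 0" by (simp add: \<kappa>_def)
  have lb: "2 * \<kappa> * (M1 powr - c1 * M2 powr - c2) \<le> cmod (rho2 k z u) powr - c1 * cmod (rho2 k w \<eta>) powr - c2"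
    and cs: "cos (c1 * Im (Ln (rho2 k z u)) + c2 * Im (Ln (rho2 k w \<eta>))) \<ge> 1/2"
    and nz: "rho2 k z u \<noteq> 0" "rho2 k w \<eta> \<noteq> 0"
    if cl: "close k \<delta> M1 z u" "close k \<delta> M2 w \<eta>" for z w u \<eta> M1 M2
  proof -
    note R1 = close_rho2[OF cl(1) \<delta>0 \<delta>'(1)] and R2 = close_rho2[OF cl(2) \<delta>0 \<delta>'(1)]
    have M: "M1 > 0" "M2 > 0" using cl by (auto simp: close_def)
    show "rho2 k z u \<noteq> 0" "rho2 k w \<eta> \<noteq> 0" using R1(1) R2(1) M by auto
    have 1: "4 powr - \<bar>c1\<bar> * M1 powr - c1 \<le> cmod (rho2 k z u) powr - c1"
      using R1 M complex_Re_le_cmod[of "rho2 k z u"] by (intro powr_comparable_ge) auto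
    have 2: "4 powr - \<bar>c2\<bar> * M2 powr - c2 \<le> cmod (rho2 k w \<eta>) powr - c2"
      using R2 M complex_Re_le_cmod[of "rho2 k w \<eta>"] by (intro powr_comparable_ge) auto
    show "2 * \<kappa> * (M1 powr - c1 * M2 powr - c2) \<le> cmod (rho2 k z u) powr - c1 * cmod (rho2 k w \<eta>) powr - c2"
      using mult_mono[OF 1 2] by (simp add: \<kappa>_def ac_simps)
    have "\<bar>c1 * Im (Ln (rho2 k z u)) + c2 * Im (Ln (rho2 k w \<eta>))\<bar> \<le> \<bar>c1\<bar> * (4 * ?n * \<delta>) + \<bar>c2\<bar> * (4 * ?n * \<delta>)"
      by (intro order_trans[OF abs_triangle_ineq] add_mono) (auto simp: abs_mult intro!: mult_left_mono R1 R2)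
    also have "\<dots> \<le> 1" using \<delta>'(2) by (simp add: algebra_simps)
    also have "1 \<le> pi / 3" using pi_gt3 by simp
    finally have *: "\<bar>c1 * Im (Ln (rho2 k z u)) + c2 * Im (Ln (rho2 k w \<eta>))\<bar> \<le> pi / 3" .
    have "cos (pi / 3) \<le> cos \<bar>c1 * Im (Ln (rho2 k z u)) + c2 * Im (Ln (rho2 k w \<eta>))\<bar>"
      using * pi_gt_zero by (intro cos_monotone_0_pi_le) auto
    then show "cos (c1 * Im (Ln (rho2 k z u)) + c2 * Im (Ln (rho2 k w \<eta>))) \<ge> 1/2" by (simp add: cos_60)
  qed
  show "coherent_kernel k c1 c2 (KT k (c1,c2))"
    unfolding coherent_kernel_def
  proof (rule exI[of _ \<delta>], intro conjI \<delta>0, rule exI[of _ \<kappa>], intro conjI \<kappa> allI impI)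
    fix z w u \<eta> M1 M2 assume cl: "close k \<delta> M1 z u" "close k \<delta> M2 w \<eta>"
    have "2 * \<kappa> * (M1 powr - c1 * M2 powr - c2) * (1/2) \<le> Re (KT k (c1,c2) z w u \<eta>)"
      unfolding Re_KT[OF nz[OF cl]] by (rule mult_mono[OF lb[OF cl] cs[OF cl]]) auto
    then show "\<kappa> * (M1 powr - c1 * M2 powr - c2) \<le> Re (KT k (c1,c2) z w u \<eta>)" by simp
  qed
  show "coherent_kernel k c1 c2 (KS k (c1,c2))"
    unfolding coherent_kernel_def
  proof (rule exI[of _ \<delta>], intro conjI \<delta>0, rule exI[of _ \<kappa>], intro conjI \<kappa> allI impI)
    fix z w u \<eta> M1 M2 assume cl: "close k \<delta> M1 z u" "close k \<delta> M2 w \<eta>"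
    have "\<kappa> * (M1 powr - c1 * M2 powr - c2) \<le> 2 * \<kappa> * (M1 powr - c1 * M2 powr - c2)" using \<kappa> by simp
    also note lb[OF cl]
    finally show "\<kappa> * (M1 powr - c1 * M2 powr - c2) \<le> Re (KS k (c1,c2) z w u \<eta>)"
      unfolding KS_def Re_complex_of_real by (simp add: powr_minus divide_inverse)
  qed
qed

lemma power_kernel_KS: "power_kernel k c1 c2 (KS k (c1,c2))"
proof -
  have "(\<lambda>x. KS k (c1,c2) z w (fst x) (snd x)) \<in> borel_measurable borel" for z w
    unfolding KS_def by measurable
  then show ?thesis unfolding power_kernel_def
    by (auto simp: KS_def powr_minus divide_inverse norm_mult norm_inverse)
qed

text \<open>For real exponents the principal power has modulus equal to the power of the modulus. On
  the tube \<open>rho2\<close> has positive real part and so avoids the branch cut, which gives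
  continuity and hence measurability.\<close>

lemma power_kernel_KT: "power_kernel k c1 c2 (KT k (c1,c2))"
  unfolding power_kernel_def
proof (intro ballI conjI)
  fix z w assume z: "z \<in> TB k" and w: "w \<in> TB k"
  have np: "0 < Re (rho2 k x y)" if "x \<in> TB k" "y \<in> TB k" for x y
    using Re_rho2_ge[of k x y] that by (auto simp: TB_iff)
  have pos: "0 < Re (rho2 k z (fst x))" "0 < Re (rho2 k w (snd x))" if "x \<in> TB k \<times> TB k" for x
    using that np z w by auto
  have c: "continuous_on (TB k \<times> TB k) (\<lambda>x. rho2 k z (fst x))" "continuous_on (TB k \<times> TB k) (\<lambda>x. rho2 k w (snd x))"
    unfolding rho2_def by (intro continuous_intros; simp)+
  have "continuous_on (TB k \<times> TB k) (\<lambda>x. exp (- (of_real c1 * Ln (rho2 k z (fst x)) + of_real c2 * Ln (rho2 k w (snd x)))))"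
    by (intro continuous_intros continuous_on_Ln c) (use pos in \<open>fastforce simp: complex_nonpos_Reals_iff\<close>)+
  moreover have "KT k (c1,c2) z w (fst x) (snd x) = exp (- (of_real c1 * Ln (rho2 k z (fst x)) + of_real c2 * Ln (rho2 k w (snd x))))"
    if "x \<in> TB k \<times> TB k" for x
    using pos[OF that] by (intro KT_eq_exp) auto
  ultimately have "continuous_on (TB k \<times> TB k) (\<lambda>x. KT k (c1,c2) z w (fst x) (snd x))"
    by (subst continuous_on_cong[OF refl])
  then show "(\<lambda>x. indicator (TB k \<times> TB k) x *\<^sub>R KT k (c1,c2) z w (fst x) (snd x)) \<in> borel_measurable borel"
    by (intro borel_measurable_continuous_on_indicator measurable_TB_Times)
  fix u \<eta> assume "u \<in> TB k" "\<eta> \<in> TB k"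
  show "cmod (KT k (c1,c2) z w u \<eta>) = cmod (rho2 k z u) powr - c1 * cmod (rho2 k w \<eta>) powr - c2"
    by (simp add: KT_def norm_divide norm_mult norm_inverse norm_powr_real_powr' powr_minus divide_inverse)
qed


text \<open>The scale \<open>M\<close> may vary with the output point \<open>z\<close> but not with
  \<open>u\<close>, so that the lower bound \<open>M z powr - c\<close> can be taken out of the
  integral over \<open>U\<close>.\<close>

definition test_pair :: "'n::finite \<Rightarrow> real \<Rightarrow> (complex^'n) set \<Rightarrow> (complex^'n) set \<Rightarrow> (complex^'n \<Rightarrow> real) \<Rightarrow> (complex^'n \<Rightarrow> real) \<Rightarrow> bool" where
  "test_pair k \<delta> Z U M g \<longleftrightarrow> Z \<in> sets borel \<and> U \<in> sets borel \<and> Z \<subseteq> TB k \<and> U \<subseteq> TB k \<and>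
     M \<in> borel_measurable borel \<and> g \<in> borel_measurable borel \<and> (\<forall>u. 0 \<le> g u) \<and> (\<forall>z\<in>Z. \<forall>u\<in>U. close k \<delta> (M z) z u)"

text \<open>With the test function \<open>1\<^sub>U(u) g(u)\<close> in one variable, \<open>test_mass\<close> is the kernel-free part of the
  operator applied to it, \<open>test_out\<close> the \<open>q\<close>-th power of the norm of \<open>M(z)\<^sup>-\<^sup>c \<rho>(z)\<^sup>a\<close> on \<open>Z\<close>,
  and \<open>test_in\<close> the \<open>p\<close>-th power of the norm of the test function.\<close>

definition test_out :: "'n::finite \<Rightarrow> real \<Rightarrow> real \<Rightarrow> real \<Rightarrow> real \<Rightarrow> (complex^'n) set \<Rightarrow> (complex^'n \<Rightarrow> real) \<Rightarrow> ennreal" where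
  "test_out k a c q \<beta> Z M = (\<integral>\<^sup>+z. indicator Z z * ennreal (M z powr (- c * q) * rho k z powr (a * q + \<beta>)) \<partial>lborel)"

definition test_mass :: "'n::finite \<Rightarrow> real \<Rightarrow> (complex^'n) set \<Rightarrow> (complex^'n \<Rightarrow> real) \<Rightarrow> ennreal" where
  "test_mass k b U g = (\<integral>\<^sup>+u. indicator U u * ennreal (rho k u powr b * g u) \<partial>lborel)"

definition test_in :: "'n::finite \<Rightarrow> real \<Rightarrow> real \<Rightarrow> (complex^'n) set \<Rightarrow> (complex^'n \<Rightarrow> real) \<Rightarrow> ennreal" where
  "test_in k p \<alpha> U g = (\<integral>\<^sup>+u. indicator U u * ennreal (g u powr p * rho k u powr \<alpha>) \<partial>lborel)"

text \<open>The set where \<open>Q\<close> holds (later, where an integral converges) is not assumed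
  measurable, so the order is exchanged for a measurable null set covering its complement.\<close>

lemma AE_lborel_pair_swapD:
  fixes Q :: "'a::euclidean_space \<times> 'b::euclidean_space \<Rightarrow> bool"
  assumes "AE x in lborel. Q x"
  shows "AE w in lborel. AE z in lborel. Q (z, w)"
proof -
  obtain N where N: "N \<in> sets (lborel \<Otimes>\<^sub>M lborel)" "emeasure (lborel \<Otimes>\<^sub>M lborel) N = 0" "{x. \<not> Q x} \<subseteq> N"
    using assms unfolding lborel_prod[symmetric] by (auto elim!: AE_E simp: space_pair_measure)
  have "AE x in lborel \<Otimes>\<^sub>M lborel. x \<notin> N" using N by (intro AE_not_in) auto
  then have "AE z in lborel. AE w in lborel. (z, w) \<notin> N" by (rule lborel_pair.AE_pair)
  moreover have "{x \<in> space (lborel \<Otimes>\<^sub>M lborel). (fst x, snd x) \<notin> N} \<in> sets (lborel \<Otimes>\<^sub>M lborel)"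
  proof -
    have "{x \<in> space (lborel \<Otimes>\<^sub>M lborel). (fst x, snd x) \<notin> N} = space (lborel \<Otimes>\<^sub>M lborel) - N" by auto
    then show ?thesis using N(1) by (simp only: sets.compl_sets)
  qed
  ultimately have "AE w in lborel. AE z in lborel. (z, w) \<notin> N"
    using lborel_pair.AE_commute[of "\<lambda>z w. (z, w) \<notin> N"] by simp
  then show ?thesis
  proof eventually_elim
    case (elim w)
    then show ?case by eventually_elim (use N(3) in auto)
  qed
qed

text \<open>The test function is a product over the two variables. Its mixed norm factors exactly,
  and by coherence the operator applied to it is bounded below by a product as well.\<close>

lemma test_inequality:
  fixes k :: "'n::finite"
  assumes p2: "1 < p2" and q: "1 \<le> q1" "1 \<le> q2"
    and bd: "bounded_op k K (a1,a2) (b1,b2) (1,p2) (\<alpha>1,\<alpha>2) (q1,q2) (\<beta>1,\<beta>2)"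
    and \<kappa>: "\<kappa> > 0"
    and coh: "\<And>z w u \<eta> M1 M2. close k \<delta> M1 z u \<Longrightarrow> close k \<delta> M2 w \<eta> \<Longrightarrow> \<kappa> * (M1 powr - c1 * M2 powr - c2) \<le> Re (K z w u \<eta>)"
  shows "\<exists>C::real. \<forall>Z1 U1 M1 g1 Z2 U2 M2 g2. test_pair k \<delta> Z1 U1 M1 g1 \<longrightarrow> test_pair k \<delta> Z2 U2 M2 g2 \<longrightarrow>
    test_mass k b1 U1 g1 < \<infinity> \<longrightarrow> test_mass k b2 U2 g2 < \<infinity> \<longrightarrow> test_in k 1 \<alpha>1 U1 g1 < \<infinity> \<longrightarrow> test_in k p2 \<alpha>2 U2 g2 < \<infinity> \<longrightarrow>
    (epow (test_out k a1 c1 q1 \<beta>1 Z1 M1) (1/q1) * test_mass k b1 U1 g1) * (epow (test_out k a2 c2 q2 \<beta>2 Z2 M2) (1/q2) * test_mass k b2 U2 g2)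
    \<le> ennreal C * (test_in k 1 \<alpha>1 U1 g1 * epow (test_in k p2 \<alpha>2 U2 g2) (1/p2))"
proof -
  obtain C where C: "\<And>f. inLp k (1,p2) (\<alpha>1,\<alpha>2) f \<Longrightarrow>
        (AE x in lborel. x \<in> TB k \<times> TB k \<longrightarrow>
            set_integrable lborel (TB k \<times> TB k) (integrand k K (b1,b2) f (fst x) (snd x)))
        \<and> mixnorm k (q1,q2) (\<beta>1,\<beta>2) (intop k K (a1,a2) (b1,b2) f) \<le> ennreal C * mixnorm k (1,p2) (\<alpha>1,\<alpha>2) f"
    using bd unfolding bounded_op_def by blast
  show ?thesis
  \<comment> \<open>The constant of boundedness may be negative, where \<open>ennreal\<close>
    truncates to 0; \<open>max\<close> makes it fit for multiplication. The factor
    \<open>\<kappa>\<close> is the loss in the coherence bound.\<close>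
  proof (intro exI[of _ "max C 0 / \<kappa>"] allI impI)
    fix Z1 U1 M1 g1 Z2 U2 M2 g2
    assume t1: "test_pair k \<delta> Z1 U1 M1 g1" and t2: "test_pair k \<delta> Z2 U2 M2 g2"
      and m1: "test_mass k b1 U1 g1 < \<infinity>" and m2: "test_mass k b2 U2 g2 < \<infinity>"
      and n1: "test_in k 1 \<alpha>1 U1 g1 < \<infinity>" and n2: "test_in k p2 \<alpha>2 U2 g2 < \<infinity>"
    have [measurable]: "Z1 \<in> sets borel" "U1 \<in> sets borel" "Z2 \<in> sets borel" "U2 \<in> sets borel"
      "M1 \<in> borel_measurable borel" "M2 \<in> borel_measurable borel" "g1 \<in> borel_measurable borel" "g2 \<in> borel_measurable borel"
      using t1 t2 by (auto simp: test_pair_def)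
    have g0: "0 \<le> g1 u" "0 \<le> g2 u" for u using t1 t2 by (auto simp: test_pair_def)
    have sub: "Z1 \<subseteq> TB k" "Z2 \<subseteq> TB k" "U1 \<subseteq> TB k" "U2 \<subseteq> TB k" using t1 t2 by (auto simp: test_pair_def)
    obtain i1 where i1: "test_mass k b1 U1 g1 = ennreal i1" "i1 \<ge> 0" using m1 by (cases "test_mass k b1 U1 g1") auto
    obtain i2 where i2: "test_mass k b2 U2 g2 = ennreal i2" "i2 \<ge> 0" using m2 by (cases "test_mass k b2 U2 g2") auto
    define f where "f u \<eta> = complex_of_real ((indicator U1 u * g1 u) * (indicator U2 \<eta> * g2 \<eta>))" for u \<eta>
    have nf: "cmod (f u \<eta>) = (indicator U1 u * g1 u) * (indicator U2 \<eta> * g2 \<eta>)" for u \<eta>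
      unfolding f_def norm_of_real using g0 by (simp add: abs_mult)
    have fm: "(\<lambda>(z,w). f z w) \<in> borel_measurable borel"
      unfolding f_def case_prod_beta by measurable
    have inner: "(\<integral>\<^sup>+u. indicator (TB k) u * ennreal (cmod (f u \<eta>) powr 1 * rho k u powr \<alpha>1) \<partial>lborel) = ennreal (indicator U2 \<eta> * g2 \<eta>) * test_in k 1 \<alpha>1 U1 g1" for \<eta>
    proof -
      have "(\<integral>\<^sup>+u. indicator (TB k) u * ennreal (cmod (f u \<eta>) powr 1 * rho k u powr \<alpha>1) \<partial>lborel)
        = (\<integral>\<^sup>+u. ennreal (indicator U2 \<eta> * g2 \<eta>) * (indicator U1 u * ennreal (g1 u powr 1 * rho k u powr \<alpha>1)) \<partial>lborel)"
      proof (rule nn_integral_cong)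
        fix u
        show "indicator (TB k) u * ennreal (cmod (f u \<eta>) powr 1 * rho k u powr \<alpha>1) = ennreal (indicator U2 \<eta> * g2 \<eta>) * (indicator U1 u * ennreal (g1 u powr 1 * rho k u powr \<alpha>1))"
          using sub g0 unfolding nf by (auto simp: indicator_def ennreal_mult[symmetric] ac_simps)
      qed
      also have "\<dots> = ennreal (indicator U2 \<eta> * g2 \<eta>) * test_in k 1 \<alpha>1 U1 g1"
        unfolding test_in_def by (rule nn_integral_cmult) simp
      finally show ?thesis .
    qed
    have mixf: "mixnorm k (1,p2) (\<alpha>1,\<alpha>2) f = test_in k 1 \<alpha>1 U1 g1 * epow (test_in k p2 \<alpha>2 U2 g2) (1/p2)"
    proof -
      have "(\<integral>\<^sup>+w. indicator (TB k) w * epow (\<integral>\<^sup>+u. indicator (TB k) u * ennreal (cmod (f u w) powr 1 * rho k u powr \<alpha>1) \<partial>lborel) (p2 / 1) * ennreal (rho k w powr \<alpha>2) \<partial>lborel)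
        = (\<integral>\<^sup>+w. epow (test_in k 1 \<alpha>1 U1 g1) p2 * (indicator U2 w * ennreal (g2 w powr p2 * rho k w powr \<alpha>2)) \<partial>lborel)"
      proof (rule nn_integral_cong)
        fix w
        show "indicator (TB k) w * epow (\<integral>\<^sup>+u. indicator (TB k) u * ennreal (cmod (f u w) powr 1 * rho k u powr \<alpha>1) \<partial>lborel) (p2 / 1) * ennreal (rho k w powr \<alpha>2)
          = epow (test_in k 1 \<alpha>1 U1 g1) p2 * (indicator U2 w * ennreal (g2 w powr p2 * rho k w powr \<alpha>2))"
          unfolding inner epow_mult using sub g0
          by (cases "w \<in> U2") (auto simp: epow_ennreal ennreal_mult ac_simps)
      qed
      also have "\<dots> = epow (test_in k 1 \<alpha>1 U1 g1) p2 * test_in k p2 \<alpha>2 U2 g2"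
        unfolding test_in_def[of k p2] by (rule nn_integral_cmult) simp
      finally show ?thesis
        using p2 unfolding mixnorm_def fst_conv snd_conv by (simp add: epow_mult epow_epow)
    qed
    have "inLp k (1,p2) (\<alpha>1,\<alpha>2) f"
      unfolding inLp_def mixf using fm n1 n2
      by (auto simp: ennreal_mult_eq_top_iff less_top[symmetric])
    note Cf = C[OF this]
    \<comment> \<open>Integrability is essential here: without it the operator would have the
      default value 0 and the lower bound would fail.\<close>
    have low: "rho k z powr a1 * rho k w powr a2 * (\<kappa> * (M1 z powr - c1 * M2 w powr - c2) * (i1 * i2)) \<le> cmod (intop k K (a1,a2) (b1,b2) f z w)"
      if z: "z \<in> Z1" and w: "w \<in> Z2" and int: "set_integrable lborel (TB k \<times> TB k) (integrand k K (b1,b2) f z w)" for z w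
    proof -
      define L where "L = \<kappa> * (M1 z powr - c1 * M2 w powr - c2)"
      have L0: "L \<ge> 0" using \<kappa> by (simp add: L_def)
      \<comment> \<open>A nonnegative minorant of the real part of the integrand, with separated
        variables, so that Tonelli evaluates its integral.\<close>
      define H where "H x = L * ((indicator U1 (fst x) * (rho k (fst x) powr b1 * g1 (fst x))) * (indicator U2 (snd x) * (rho k (snd x) powr b2 * g2 (snd x))))" for x :: "(complex^'n) \<times> (complex^'n)"
      have Hm[measurable]: "H \<in> borel_measurable borel" unfolding H_def by measurable
      have H0: "H x \<ge> 0" for x using L0 g0 by (simp add: H_def)
      have "(\<integral>\<^sup>+x. ennreal (H x) \<partial>lborel) = (\<integral>\<^sup>+u. \<integral>\<^sup>+\<eta>. ennreal (H (u,\<eta>)) \<partial>lborel \<partial>lborel)"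
      proof -
        have "(\<lambda>x. ennreal (H x)) \<in> borel_measurable (lborel \<Otimes>\<^sub>M lborel)" unfolding lborel_prod by simp
        from lborel.nn_integral_fst[OF this] show ?thesis unfolding lborel_prod by simp
      qed
      also have "\<dots> = (\<integral>\<^sup>+u. \<integral>\<^sup>+\<eta>. (ennreal L * (indicator U1 u * ennreal (rho k u powr b1 * g1 u))) * (indicator U2 \<eta> * ennreal (rho k \<eta> powr b2 * g2 \<eta>)) \<partial>lborel \<partial>lborel)"
        using g0 L0 by (intro nn_integral_cong) (auto simp: H_def indicator_def ennreal_mult[symmetric])
      also have "\<dots> = ennreal L * test_mass k b1 U1 g1 * test_mass k b2 U2 g2"
        unfolding test_mass_def by (simp add: nn_integral_cmult nn_integral_multc)
      also have "\<dots> = ennreal (L * (i1 * i2))" unfolding i1(1) i2(1) using L0 i1 i2 by (simp add: ennreal_mult mult.assoc)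
      finally have "has_bochner_integral lborel H (L * (i1 * i2))"
        using L0 i1 i2 H0 by (intro has_bochner_integral_nn_integral) auto
      then have Hi: "integrable lborel H" "integral\<^sup>L lborel H = L * (i1 * i2)" by (auto simp: has_bochner_integral_iff)
      let ?F = "\<lambda>x. indicator (TB k \<times> TB k) x *\<^sub>R integrand k K (b1,b2) f z w x"
      have Fi: "integrable lborel ?F" using int by (simp add: set_integrable_def)
      have "L * (i1 * i2) \<le> (\<integral>x. Re (?F x) \<partial>lborel)"
        unfolding Hi(2)[symmetric]
      proof (rule integral_mono[OF Hi(1) integrable_Re[OF Fi]])
        fix x :: "(complex^'n) \<times> (complex^'n)"
        obtain u \<eta> where x: "x = (u,\<eta>)" by (cases x)
        show "H x \<le> Re (?F x)"
        proof (cases "u \<in> U1 \<and> \<eta> \<in> U2")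
          case True
          have "close k \<delta> (M1 z) z u" "close k \<delta> (M2 w) w \<eta>" using True z w t1 t2 by (auto simp: test_pair_def)
          from coh[OF this] have "L \<le> Re (K z w u \<eta>)" unfolding L_def .
          then have "L * (rho k u powr b1 * rho k \<eta> powr b2 * (g1 u * g2 \<eta>)) \<le> Re (K z w u \<eta>) * (rho k u powr b1 * rho k \<eta> powr b2 * (g1 u * g2 \<eta>))"
            using g0 by (intro mult_right_mono) auto
          also have "\<dots> = Re (K z w u \<eta> * complex_of_real (rho k u powr b1 * rho k \<eta> powr b2 * (g1 u * g2 \<eta>)))"
            by simp
          also have "\<dots> = Re (?F x)"
          proof -
            have "(u, \<eta>) \<in> TB k \<times> TB k" using True sub by auto
            then show ?thesis using True unfolding x by (simp add: integrand_def f_def mult.assoc)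
          qed
          finally show ?thesis using True unfolding x by (simp add: H_def ac_simps)
        next
          case False
          then have "H x = 0" "integrand k K (b1,b2) f z w x = 0" unfolding x by (auto simp: H_def integrand_def f_def)
          then show ?thesis by simp
        qed
      qed
      also have "\<dots> = Re (set_lebesgue_integral lborel (TB k \<times> TB k) (integrand k K (b1,b2) f z w))"
        unfolding set_lebesgue_integral_def by (rule integral_Re[OF Fi])
      also have "\<dots> \<le> cmod (set_lebesgue_integral lborel (TB k \<times> TB k) (integrand k K (b1,b2) f z w))" by (rule complex_Re_le_cmod)
      finally have "L * (i1 * i2) \<le> cmod (set_lebesgue_integral lborel (TB k \<times> TB k) (integrand k K (b1,b2) f z w))" .
      then have "rho k z powr a1 * rho k w powr a2 * (L * (i1 * i2)) \<le> rho k z powr a1 * rho k w powr a2 * cmod (set_lebesgue_integral lborel (TB k \<times> TB k) (integrand k K (b1,b2) f z w))"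
        by (intro mult_left_mono) auto
      also have "\<dots> = cmod (intop k K (a1,a2) (b1,b2) f z w)"
        by (simp add: intop_def norm_mult)
      finally show ?thesis unfolding L_def .
    qed
    define X1 where "X1 = test_out k a1 c1 q1 \<beta>1 Z1 M1"
    define X2 where "X2 = test_out k a2 c2 q2 \<beta>2 Z2 M2"
    have i12: "i1 * i2 \<ge> 0" using i1 i2 by simp
    have q0: "q1 > 0" "q2 > 0" "p2 > 0" using q p2 by auto
    have "epow (\<integral>\<^sup>+w. ennreal ((\<kappa> * (i1 * i2)) powr q2) * epow X1 (q2 / q1) * (indicator Z2 w * ennreal (M2 w powr (- c2 * q2) * rho k w powr (a2 * q2 + \<beta>2))) \<partial>lborel) (1 / q2)
      \<le> mixnorm k (q1,q2) (\<beta>1,\<beta>2) (intop k K (a1,a2) (b1,b2) f)"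
      unfolding mixnorm_def fst_conv snd_conv
    proof (intro epow_mono nn_integral_mono_AE)
      have "AE w in lborel. AE z in lborel. (z, w) \<in> TB k \<times> TB k \<longrightarrow> set_integrable lborel (TB k \<times> TB k) (integrand k K (b1,b2) f z w)"
        using AE_lborel_pair_swapD[OF conjunct1[OF Cf]] by simp
      then show "AE w in lborel. ennreal ((\<kappa> * (i1 * i2)) powr q2) * epow X1 (q2 / q1) * (indicator Z2 w * ennreal (M2 w powr (- c2 * q2) * rho k w powr (a2 * q2 + \<beta>2)))
        \<le> indicator (TB k) w * epow (\<integral>\<^sup>+z. indicator (TB k) z * ennreal (cmod (intop k K (a1,a2) (b1,b2) f z w) powr q1 * rho k z powr \<beta>1) \<partial>lborel) (q2 / q1) * ennreal (rho k w powr \<beta>2)"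
      proof eventually_elim
        case (elim w)
        show ?case
        proof (cases "w \<in> Z2")
          case w: True
          \<comment> \<open>Collects everything in the lower bound that is constant in
            \<open>z\<close>, so that the inner norm becomes \<open>R\<close> times a one-variable
            quantity.\<close>
          define R where "R = rho k w powr a2 * (\<kappa> * M2 w powr - c2 * (i1 * i2))"
          have R0: "R \<ge> 0" using \<kappa> i12 by (simp add: R_def)
          have "ennreal (R powr q1) * X1 = (\<integral>\<^sup>+z. ennreal (R powr q1) * (indicator Z1 z * ennreal (M1 z powr (- c1 * q1) * rho k z powr (a1 * q1 + \<beta>1))) \<partial>lborel)"
            unfolding X1_def test_out_def by (rule nn_integral_cmult[symmetric]) simp
          also have "\<dots> \<le> (\<integral>\<^sup>+z. indicator (TB k) z * ennreal (cmod (intop k K (a1,a2) (b1,b2) f z w) powr q1 * rho k z powr \<beta>1) \<partial>lborel)"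
          proof (rule nn_integral_mono_AE, use elim in eventually_elim)
            case (elim z)
            show ?case
            proof (cases "z \<in> Z1")
              case z: True
              have "set_integrable lborel (TB k \<times> TB k) (integrand k K (b1,b2) f z w)" using elim z w sub by auto
              from low[OF z w this] have le: "R * (M1 z powr - c1 * rho k z powr a1) \<le> cmod (intop k K (a1,a2) (b1,b2) f z w)"
                by (simp add: R_def ac_simps)
              have "R powr q1 * (M1 z powr (- c1 * q1) * rho k z powr (a1 * q1 + \<beta>1)) = (R * (M1 z powr - c1 * rho k z powr a1)) powr q1 * rho k z powr \<beta>1"
                using R0 by (simp add: powr_mult powr_powr powr_add)
              also have "\<dots> \<le> cmod (intop k K (a1,a2) (b1,b2) f z w) powr q1 * rho k z powr \<beta>1"
                using R0 q0 by (intro mult_right_mono powr_mono2 le) auto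
              finally show ?thesis using z sub by (auto simp: ennreal_mult[symmetric] intro!: ennreal_leI)
            qed simp
          qed
          finally have "epow (ennreal (R powr q1) * X1) (q2 / q1) \<le> epow (\<integral>\<^sup>+z. indicator (TB k) z * ennreal (cmod (intop k K (a1,a2) (b1,b2) f z w) powr q1 * rho k z powr \<beta>1) \<partial>lborel) (q2 / q1)"
            using q0 by (intro epow_mono) auto
          moreover have "epow (ennreal (R powr q1) * X1) (q2 / q1) = ennreal (R powr q2) * epow X1 (q2 / q1)"
            using q0 R0 by (simp add: epow_mult epow_ennreal powr_powr)
          moreover have "R powr q2 * rho k w powr \<beta>2 = (\<kappa> * (i1 * i2)) powr q2 * (M2 w powr (- c2 * q2) * rho k w powr (a2 * q2 + \<beta>2))"
            using \<kappa> i12 by (simp add: R_def powr_mult powr_powr powr_add ac_simps)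
          ultimately have *: "ennreal (R powr q2) * epow X1 (q2 / q1) * ennreal (rho k w powr \<beta>2) \<le> epow (\<integral>\<^sup>+z. indicator (TB k) z * ennreal (cmod (intop k K (a1,a2) (b1,b2) f z w) powr q1 * rho k z powr \<beta>1) \<partial>lborel) (q2 / q1) * ennreal (rho k w powr \<beta>2)"
            and eq: "ennreal (R powr q2) * ennreal (rho k w powr \<beta>2) = ennreal ((\<kappa> * (i1 * i2)) powr q2) * ennreal (M2 w powr (- c2 * q2) * rho k w powr (a2 * q2 + \<beta>2))"
            by (auto intro!: mult_right_mono simp: ennreal_mult[symmetric])
          have "ennreal ((\<kappa> * (i1 * i2)) powr q2) * epow X1 (q2 / q1) * (indicator Z2 w * ennreal (M2 w powr (- c2 * q2) * rho k w powr (a2 * q2 + \<beta>2))) = ennreal (R powr q2) * epow X1 (q2 / q1) * ennreal (rho k w powr \<beta>2)"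
            using w eq by (simp add: ac_simps) (metis mult.assoc mult.commute)
          then show ?thesis using * w sub by auto
        qed simp
      qed
    qed (use q0 in auto)
    also have "\<dots> \<le> ennreal C * (test_in k 1 \<alpha>1 U1 g1 * epow (test_in k p2 \<alpha>2 U2 g2) (1/p2))"
      using Cf unfolding mixf by blast
    also have "\<dots> \<le> ennreal (max C 0) * (test_in k 1 \<alpha>1 U1 g1 * epow (test_in k p2 \<alpha>2 U2 g2) (1/p2))"
      by (intro mult_right_mono ennreal_leI) auto
    also have "(\<integral>\<^sup>+w. ennreal ((\<kappa> * (i1 * i2)) powr q2) * epow X1 (q2 / q1) * (indicator Z2 w * ennreal (M2 w powr (- c2 * q2) * rho k w powr (a2 * q2 + \<beta>2))) \<partial>lborel)
      = ennreal ((\<kappa> * (i1 * i2)) powr q2) * epow X1 (q2 / q1) * X2"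
      unfolding X2_def test_out_def by (rule nn_integral_cmult) simp
    also have "epow (ennreal ((\<kappa> * (i1 * i2)) powr q2) * epow X1 (q2 / q1) * X2) (1 / q2) = ennreal (\<kappa> * (i1 * i2)) * epow X1 (1 / q1) * epow X2 (1 / q2)"
      using q0 \<kappa> i12 by (simp add: epow_mult epow_epow epow_ennreal powr_powr)
    finally have fin: "ennreal (\<kappa> * (i1 * i2)) * epow X1 (1 / q1) * epow X2 (1 / q2) \<le> ennreal (max C 0) * (test_in k 1 \<alpha>1 U1 g1 * epow (test_in k p2 \<alpha>2 U2 g2) (1/p2))" .
    have "(epow X1 (1/q1) * ennreal i1) * (epow X2 (1/q2) * ennreal i2) = ennreal (1 / \<kappa>) * (ennreal (\<kappa> * (i1 * i2)) * epow X1 (1 / q1) * epow X2 (1 / q2))"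
    proof -
      have "ennreal (1 / \<kappa>) * ennreal (\<kappa> * (i1 * i2)) = ennreal i1 * ennreal i2"
        using \<kappa> i1 i2 by (simp add: ennreal_mult[symmetric])
      then show ?thesis by (simp add: ac_simps) (metis mult.assoc mult.commute)
    qed
    also have "\<dots> \<le> ennreal (1 / \<kappa>) * (ennreal (max C 0) * (test_in k 1 \<alpha>1 U1 g1 * epow (test_in k p2 \<alpha>2 U2 g2) (1/p2)))"
      by (intro mult_left_mono fin) auto
    also have "\<dots> = ennreal (max C 0 / \<kappa>) * (test_in k 1 \<alpha>1 U1 g1 * epow (test_in k p2 \<alpha>2 U2 g2) (1/p2))"
      using \<kappa> by (simp add: mult.assoc[symmetric] ennreal_mult[symmetric])
    finally show "(epow (test_out k a1 c1 q1 \<beta>1 Z1 M1) (1/q1) * test_mass k b1 U1 g1) * (epow (test_out k a2 c2 q2 \<beta>2 Z2 M2) (1/q2) * test_mass k b2 U2 g2)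
      \<le> ennreal (max C 0 / \<kappa>) * (test_in k 1 \<alpha>1 U1 g1 * epow (test_in k p2 \<alpha>2 U2 g2) (1/p2))"
      unfolding i1(1) i2(1) X1_def X2_def .
  qed
qed

section \<open>Necessity\<close>

text \<open>A nonzero power of a positive variable takes every positive value. This serves both the
  dilation argument and the logarithmic blow-up, where the exponent is
  \<open>1 - 1/p\<close>.\<close>

lemma powr_bounded_imp_exponent_zero:
  fixes E D :: real
  assumes "\<And>R. R > 0 \<Longrightarrow> R powr E \<le> D"
  shows "E = 0"
proof (rule ccontr)
  assume E: "E \<noteq> 0"
  have "((\<bar>D\<bar> + 1) powr (1 / E)) powr E \<le> D" by (rule assms) simp
  then show False using E by (simp add: powr_powr)
qed

section \<open>Divergent and homogeneous integrals of powers\<close>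

lemma nn_integral_inverse_interval:
  fixes x y :: real
  assumes "0 < x" "x \<le> y"
  shows "(\<integral>\<^sup>+\<tau>. indicator {x<..<y} \<tau> * ennreal (\<tau> powr -1) \<partial>lborel) = ennreal (ln (y / x))"
proof -
  have "((\<lambda>\<tau>. \<tau> powr -1) has_integral (ln y - ln x)) {x..y}"
    using assms by (intro fundamental_theorem_of_calculus)
      (auto intro!: derivative_eq_intros simp: has_real_derivative_iff_has_vector_derivative[symmetric] powr_minus divide_inverse)
  then have "((\<lambda>\<tau>. \<tau> powr -1) has_integral ln (y / x)) {x<..<y}"
    using assms by (simp add: has_integral_Icc_iff_Ioo ln_div)
  from nn_integral_has_integral_lebesgue'[OF _ this] show ?thesis by (simp add: mult.commute)
qed

lemma ennreal_eq_topI: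
  assumes "\<And>L::real. L > 0 \<Longrightarrow> ennreal L \<le> X"
  shows "X = top"
proof (cases X)
  case (real x)
  then have "ennreal (x + 1) \<le> ennreal x" using assms[of "x + 1"] by simp
  then show ?thesis using real by simp
qed

text \<open>Comparison with \<open>\<tau> powr -1\<close>, whose integral over the interval from
  \<open>exp (-L)\<close> to 1 is exactly \<open>L\<close>.\<close>

lemma nn_integral_powr_0_1_infinite:
  fixes s :: real
  assumes "s \<le> -1"
  shows "(\<integral>\<^sup>+\<tau>. indicator {0<..<1} \<tau> * ennreal (\<tau> powr s) \<partial>lborel) = top"
proof (rule ennreal_eq_topI)
  fix L :: real assume L: "L > 0"
  have "ennreal L = (\<integral>\<^sup>+\<tau>. indicator {exp (-L)<..<1} \<tau> * ennreal (\<tau> powr -1) \<partial>lborel)"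
    using L by (subst nn_integral_inverse_interval) (auto simp: ln_div)
  also have "\<dots> \<le> (\<integral>\<^sup>+\<tau>. indicator {0<..<1} \<tau> * ennreal (\<tau> powr s) \<partial>lborel)"
  proof (rule nn_integral_mono)
    fix \<tau> :: real
    have "\<tau> powr -1 \<le> \<tau> powr s" if "0 < \<tau>" "\<tau> < 1" using that assms by (intro powr_mono') auto
    then show "indicator {exp (-L)<..<1} \<tau> * ennreal (\<tau> powr -1) \<le> indicator {0<..<1} \<tau> * ennreal (\<tau> powr s)"
      using less_trans[OF exp_gt_zero[of "-L"], of \<tau>] by (auto simp: indicator_def intro!: ennreal_leI)
  qed
  finally show "ennreal L \<le> (\<integral>\<^sup>+\<tau>. indicator {0<..<1} \<tau> * ennreal (\<tau> powr s) \<partial>lborel)" .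
qed

lemma nn_integral_powr_1_inf_infinite:
  fixes s :: real
  assumes "s \<ge> -1"
  shows "(\<integral>\<^sup>+\<tau>. indicator {1<..} \<tau> * ennreal (\<tau> powr s) \<partial>lborel) = top"
proof (rule ennreal_eq_topI)
  fix L :: real assume L: "L > 0"
  have "ennreal L = (\<integral>\<^sup>+\<tau>. indicator {1<..<exp L} \<tau> * ennreal (\<tau> powr -1) \<partial>lborel)"
    using L by (subst nn_integral_inverse_interval) auto
  also have "\<dots> \<le> (\<integral>\<^sup>+\<tau>. indicator {1<..} \<tau> * ennreal (\<tau> powr s) \<partial>lborel)"
  proof (rule nn_integral_mono)
    fix \<tau> :: real
    have "\<tau> powr -1 \<le> \<tau> powr s" if "1 < \<tau>" using that assms by (intro powr_mono) auto
    then show "indicator {1<..<exp L} \<tau> * ennreal (\<tau> powr -1) \<le> indicator {1<..} \<tau> * ennreal (\<tau> powr s)"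
      by (auto simp: indicator_def intro!: ennreal_leI)
  qed
  finally show "ennreal L \<le> (\<integral>\<^sup>+\<tau>. indicator {1<..} \<tau> * ennreal (\<tau> powr s) \<partial>lborel)" .
qed

text \<open>The constant \<open>m\<close> is the integral for \<open>R = 1\<close>, positive and
  finite because the power is bounded above and below on that interval; the rest is the substitution
  \<open>\<tau> = R * x\<close>.\<close>

lemma nn_integral_powr_1_2:
  obtains m where "m > 0" "\<And>R. R > 0 \<Longrightarrow> (\<integral>\<^sup>+\<tau>. indicator {R<..<2*R} \<tau> * ennreal (\<tau> powr s) \<partial>lborel) = ennreal (m * R powr (s + 1))"
proof -
  let ?m = "\<integral>\<^sup>+\<tau>. indicator {1<..<2} \<tau> * ennreal (\<tau> powr s) \<partial>lborel"
  have b: "2 powr - \<bar>s\<bar> \<le> \<tau> powr s" "\<tau> powr s \<le> 2 powr \<bar>s\<bar>" if "1 < \<tau>" "\<tau> < 2" for \<tau> :: real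
  proof -
    have "\<tau> powr s \<le> \<tau> powr \<bar>s\<bar>" using that by (intro powr_mono) auto
    also have "\<dots> \<le> 2 powr \<bar>s\<bar>" using that by (intro powr_mono2) auto
    finally show "\<tau> powr s \<le> 2 powr \<bar>s\<bar>" .
    have "2 powr - \<bar>s\<bar> \<le> \<tau> powr - \<bar>s\<bar>" using that by (intro powr_mono2') auto
    also have "\<dots> \<le> \<tau> powr s" using that by (intro powr_mono) auto
    finally show "2 powr - \<bar>s\<bar> \<le> \<tau> powr s" .
  qed
  have "?m \<le> (\<integral>\<^sup>+\<tau>. ennreal (2 powr \<bar>s\<bar>) * indicator {1<..<2::real} \<tau> \<partial>lborel)"
    using b by (intro nn_integral_mono) (auto simp: indicator_def intro!: ennreal_leI)
  also have "\<dots> = ennreal (2 powr \<bar>s\<bar>)" by (simp add: nn_integral_cmult)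
  finally obtain m where m: "?m = ennreal m" "m \<ge> 0" by (cases ?m) (auto simp: top_unique)
  have "ennreal (2 powr - \<bar>s\<bar>) = (\<integral>\<^sup>+\<tau>. ennreal (2 powr - \<bar>s\<bar>) * indicator {1<..<2::real} \<tau> \<partial>lborel)"
    by (simp add: nn_integral_cmult)
  also have "\<dots> \<le> ?m"
    using b by (intro nn_integral_mono) (auto simp: indicator_def intro!: ennreal_leI)
  finally have "2 powr - \<bar>s\<bar> \<le> m" using m by simp
  then have "m > 0" using powr_gt_zero[of 2 "- \<bar>s\<bar>"] by linarith
  moreover have "(\<integral>\<^sup>+\<tau>. indicator {R<..<2*R} \<tau> * ennreal (\<tau> powr s) \<partial>lborel) = ennreal (m * R powr (s + 1))" if R: "R > 0" for R
  proof -
    have "(\<integral>\<^sup>+\<tau>. indicator {R<..<2*R} \<tau> * ennreal (\<tau> powr s) \<partial>lborel) = ennreal \<bar>R\<bar> * (\<integral>\<^sup>+x. indicator {R<..<2*R} (0 + R * x) * ennreal ((0 + R * x) powr s) \<partial>lborel)"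
      using R by (intro nn_integral_real_affine) auto
    also have "(\<integral>\<^sup>+x. indicator {R<..<2*R} (0 + R * x) * ennreal ((0 + R * x) powr s) \<partial>lborel) = (\<integral>\<^sup>+x. ennreal (R powr s) * (indicator {1<..<2} x * ennreal (x powr s)) \<partial>lborel)"
      using R by (intro nn_integral_cong) (auto simp: indicator_def powr_mult ennreal_mult[symmetric] mult.commute[of R])
    also have "\<dots> = ennreal (R powr s) * ennreal m" unfolding m(1)[symmetric] by (rule nn_integral_cmult) simp
    also have "ennreal \<bar>R\<bar> * (ennreal (R powr s) * ennreal m) = ennreal (m * R powr (s + 1))"
      using R m by (simp add: ennreal_mult[symmetric] powr_add ac_simps)
    finally show ?thesis .
  qed
  ultimately show ?thesis using that by blast
qed

text \<open>The width is governed by \<open>R\<close> and the height by \<open>s\<close> and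
  \<open>t\<close> independently, so layers that reach down to the boundary keep their full
  width.\<close>

definition cyl :: "'n::finite \<Rightarrow> real \<Rightarrow> real \<Rightarrow> real \<Rightarrow> real \<Rightarrow> (complex^'n) set" where
  "cyl k \<delta> R s t = cylinder k (\<lambda>_. \<delta> * R) {s<..<t}"

lemma measurable_cyl [measurable]: "cyl k \<delta> R s t \<in> sets borel"
  unfolding cyl_def by (rule measurable_cylinder) auto

lemma cyl_TB: "0 \<le> s \<Longrightarrow> cyl k \<delta> R s t \<subseteq> TB k"
  by (auto simp: cyl_def cylinder_def TB_iff)

lemma cyl_near:
  assumes "z \<in> cyl k \<delta> R s t" "R \<le> M" "\<delta> > 0"
  shows "near k \<delta> M z"
proof -
  have "\<delta> * R \<le> \<delta> * M" using assms by simp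
  then show ?thesis using assms(1) unfolding cyl_def cylinder_def near_def by (auto intro: less_le_trans)
qed

lemma cyl_rho: "z \<in> cyl k \<delta> R s t \<Longrightarrow> s < rho k z \<and> rho k z < t"
  by (auto simp: cyl_def cylinder_def)

lemma nn_integral_cyl:
  fixes k :: "'n::finite"
  assumes [measurable]: "\<phi> \<in> borel_measurable borel" and "\<delta> > 0" "R > 0"
  shows "(\<integral>\<^sup>+z. indicator (cyl k \<delta> R s t) z * ennreal (\<phi> (rho k z)) \<partial>lborel)
    = ennreal (2 * 4 ^ (CARD('n) - 1) * (\<delta> * R) ^ CARD('n)) * (\<integral>\<^sup>+\<tau>. indicator {s<..<t} \<tau> * ennreal (\<phi> \<tau>) \<partial>lborel)"
proof -
  have "(\<integral>\<^sup>+z. indicator (cyl k \<delta> R s t) z * ennreal (\<phi> (rho k z)) \<partial>lborel)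
    = (\<integral>\<^sup>+\<tau>. indicator {s<..<t} \<tau> * (ennreal (2 * 4 ^ (CARD('n) - 1) * (\<delta> * R) ^ CARD('n)) * ennreal (\<phi> \<tau>)) \<partial>lborel)"
    unfolding cyl_def using assms by (intro nn_integral_cylinder) auto
  also have "\<dots> = (\<integral>\<^sup>+\<tau>. ennreal (2 * 4 ^ (CARD('n) - 1) * (\<delta> * R) ^ CARD('n)) * (indicator {s<..<t} \<tau> * ennreal (\<phi> \<tau>)) \<partial>lborel)"
    by (simp add: mult.left_commute)
  also have "\<dots> = ennreal (2 * 4 ^ (CARD('n) - 1) * (\<delta> * R) ^ CARD('n)) * (\<integral>\<^sup>+\<tau>. indicator {s<..<t} \<tau> * ennreal (\<phi> \<tau>) \<partial>lborel)"
    by (rule nn_integral_cmult) simp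
  finally show ?thesis .
qed

lemma nn_integral_cyl_powr:
  fixes k :: "'n::finite"
  assumes "\<delta> > 0"
  obtains m where "m > 0" "\<And>R. R > 0 \<Longrightarrow> (\<integral>\<^sup>+z. indicator (cyl k \<delta> R R (2*R)) z * ennreal (rho k z powr s) \<partial>lborel) = ennreal (m * R powr (real CARD('n) + s + 1))"
proof -
  obtain m where m: "m > 0" "\<And>R. R > 0 \<Longrightarrow> (\<integral>\<^sup>+\<tau>. indicator {R<..<2*R} \<tau> * ennreal (\<tau> powr s) \<partial>lborel) = ennreal (m * R powr (s + 1))"
    using nn_integral_powr_1_2[of s] by blast
  have "(\<integral>\<^sup>+z. indicator (cyl k \<delta> R R (2*R)) z * ennreal (rho k z powr s) \<partial>lborel) = ennreal (2 * 4 ^ (CARD('n) - 1) * \<delta> ^ CARD('n) * m * R powr (real CARD('n) + s + 1))" if R: "R > 0" for R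
  proof -
    have "(\<integral>\<^sup>+z. indicator (cyl k \<delta> R R (2*R)) z * ennreal (rho k z powr s) \<partial>lborel) = ennreal (2 * 4 ^ (CARD('n) - 1) * (\<delta> * R) ^ CARD('n)) * ennreal (m * R powr (s + 1))"
      using assms R by (subst nn_integral_cyl) (auto simp: m(2)[OF R])
    also have "\<dots> = ennreal (2 * 4 ^ (CARD('n) - 1) * (\<delta> * R) ^ CARD('n) * (m * R powr (s + 1)))"
      using assms R m by (simp add: ennreal_mult)
    also have "2 * 4 ^ (CARD('n) - 1) * (\<delta> * R) ^ CARD('n) * (m * R powr (s + 1)) = 2 * 4 ^ (CARD('n) - 1) * \<delta> ^ CARD('n) * m * (R ^ CARD('n) * R powr (s + 1))"
      by (simp add: power_mult_distrib)
    also have "R ^ CARD('n) * R powr (s + 1) = R powr (real CARD('n) + s + 1)"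
      using R by (simp add: powr_realpow[symmetric] powr_add[symmetric] add.assoc)
    finally show ?thesis .
  qed
  moreover have "2 * 4 ^ (CARD('n) - 1) * \<delta> ^ CARD('n) * m > 0" using assms m by simp
  ultimately show ?thesis using that by blast
qed

lemma test_pair_cyl:
  assumes \<delta>: "\<delta> > 0" and R: "R > 0"
  shows "test_pair k \<delta> (cyl k \<delta> R R (2*R)) (cyl k \<delta> R R (2*R)) (\<lambda>_. R) (\<lambda>_. 1)"
  unfolding test_pair_def close_def
proof (intro conjI ballI)
  fix z u assume z: "z \<in> cyl k \<delta> R R (2*R)" and u: "u \<in> cyl k \<delta> R R (2*R)"
  show "R \<le> rho k z + rho k u" "rho k z + rho k u \<le> 4 * R" using cyl_rho[OF z] cyl_rho[OF u] R by auto
  show "near k \<delta> R z" "near k \<delta> R u" using cyl_near z u \<delta> by blast+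
qed (use R cyl_TB[of R k \<delta> R "2*R"] in auto)

lemma test_cyl:
  fixes k :: "'n::finite"
  assumes \<delta>: "\<delta> > 0"
  obtains mo mm mi where "mo > 0" "mm > 0" "mi > 0"
    "\<And>R. R > 0 \<Longrightarrow> test_out k a c q \<beta> (cyl k \<delta> R R (2*R)) (\<lambda>_. R) = ennreal (mo * R powr (real CARD('n) + (a * q + \<beta>) + 1 - c * q))"
    "\<And>R. R > 0 \<Longrightarrow> test_mass k b (cyl k \<delta> R R (2*R)) (\<lambda>_. 1) = ennreal (mm * R powr (real CARD('n) + b + 1))"
    "\<And>R. R > 0 \<Longrightarrow> test_in k p \<alpha> (cyl k \<delta> R R (2*R)) (\<lambda>_. 1) = ennreal (mi * R powr (real CARD('n) + \<alpha> + 1))"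
proof -
  obtain mo where mo: "mo > 0" "\<And>R. R > 0 \<Longrightarrow> (\<integral>\<^sup>+z. indicator (cyl k \<delta> R R (2*R)) z * ennreal (rho k z powr (a * q + \<beta>)) \<partial>lborel) = ennreal (mo * R powr (real CARD('n) + (a * q + \<beta>) + 1))"
    using nn_integral_cyl_powr[OF \<delta>] by blast
  obtain mm where mm: "mm > 0" "\<And>R. R > 0 \<Longrightarrow> (\<integral>\<^sup>+z. indicator (cyl k \<delta> R R (2*R)) z * ennreal (rho k z powr b) \<partial>lborel) = ennreal (mm * R powr (real CARD('n) + b + 1))"
    using nn_integral_cyl_powr[OF \<delta>] by blast
  obtain mi where mi: "mi > 0" "\<And>R. R > 0 \<Longrightarrow> (\<integral>\<^sup>+z. indicator (cyl k \<delta> R R (2*R)) z * ennreal (rho k z powr \<alpha>) \<partial>lborel) = ennreal (mi * R powr (real CARD('n) + \<alpha> + 1))"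
    using nn_integral_cyl_powr[OF \<delta>] by blast
  have "test_out k a c q \<beta> (cyl k \<delta> R R (2*R)) (\<lambda>_. R) = ennreal (mo * R powr (real CARD('n) + (a * q + \<beta>) + 1 - c * q))" if R: "R > 0" for R
  proof -
    have "test_out k a c q \<beta> (cyl k \<delta> R R (2*R)) (\<lambda>_. R) = (\<integral>\<^sup>+z. ennreal (R powr (- c * q)) * (indicator (cyl k \<delta> R R (2*R)) z * ennreal (rho k z powr (a * q + \<beta>))) \<partial>lborel)"
      unfolding test_out_def by (intro nn_integral_cong) (simp add: ennreal_mult mult.left_commute)
    also have "\<dots> = ennreal (R powr (- c * q)) * ennreal (mo * R powr (real CARD('n) + (a * q + \<beta>) + 1))"
      unfolding mo(2)[OF R, symmetric] by (rule nn_integral_cmult) simp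
    also have "\<dots> = ennreal (mo * (R powr (real CARD('n) + (a * q + \<beta>) + 1) * R powr (- c * q)))"
      using mo by (simp add: ennreal_mult[symmetric] ac_simps)
    also have "R powr (real CARD('n) + (a * q + \<beta>) + 1) * R powr (- c * q) = R powr (real CARD('n) + (a * q + \<beta>) + 1 - c * q)"
      by (simp add: powr_add[symmetric])
    finally show ?thesis .
  qed
  then show ?thesis using that[OF mo(1) mm(1) mi(1)] mm(2) mi(2) by (simp add: test_mass_def test_in_def)
qed

text \<open>One variable at a time: each assertion comes from its own choice of \<open>Z\<close>,
  \<open>U\<close>, \<open>M\<close> and \<open>g\<close> in the test inequality \<open>T\<close>.
  The formula for \<open>c\<close> comes first, since the comparison of \<open>\<alpha>\<close> with
  \<open>b\<close> relies on it.\<close>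

lemma scalar_test_conditions:
  fixes k :: "'n::finite" and C :: real
  defines "n \<equiv> real CARD('n)"
  assumes \<delta>: "\<delta> > 0" and p: "1 \<le> p" and q: "1 \<le> q"
    and T: "\<And>Z U M g. test_pair k \<delta> Z U M g \<Longrightarrow> test_mass k b U g < \<infinity> \<Longrightarrow> test_in k p \<alpha> U g < \<infinity> \<Longrightarrow>
      epow (test_out k a c q \<beta> Z M) (1/q) * test_mass k b U g \<le> ennreal C * epow (test_in k p \<alpha> U g) (1/p)"
  shows "c = n + 1 + a + b + ((n + 1 + \<beta>) / q - (n + 1 + \<alpha>) / p)"
    and "- q * a < \<beta> + 1"
    and "p = 1 \<Longrightarrow> \<alpha> < b"
    and "p > 1 \<Longrightarrow> \<alpha> + 1 < p * (b + 1)"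
proof -
  have q0: "q > 0" and p0: "p > 0" using p q by auto
  obtain mo mm mi where m: "mo > 0" "mm > 0" "mi > 0"
    and mo: "\<And>R. R > 0 \<Longrightarrow> test_out k a c q \<beta> (cyl k \<delta> R R (2*R)) (\<lambda>_. R) = ennreal (mo * R powr (n + (a * q + \<beta>) + 1 - c * q))"
    and mm: "\<And>R. R > 0 \<Longrightarrow> test_mass k b (cyl k \<delta> R R (2*R)) (\<lambda>_. 1) = ennreal (mm * R powr (n + b + 1))"
    and mi: "\<And>R. R > 0 \<Longrightarrow> test_in k p \<alpha> (cyl k \<delta> R R (2*R)) (\<lambda>_. 1) = ennreal (mi * R powr (n + \<alpha> + 1))"
    unfolding n_def using test_cyl[OF \<delta>, of k a c q \<beta> b p \<alpha>] by blast
  define C' where "C' = max C 0"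
  have C': "C' \<ge> 0" "ennreal C \<le> ennreal C'" by (auto simp: C'_def intro: ennreal_leI)
  \<comment> \<open>The net power of \<open>R\<close> in the inequality when both cylinders have
    size \<open>R\<close>; its vanishing is the formula for \<open>c\<close>.\<close>
  define E where "E = (n + (a * q + \<beta>) + 1 - c * q) / q + (n + b + 1) - (n + \<alpha> + 1) / p"
  have "E = 0"
  proof (rule powr_bounded_imp_exponent_zero)
    fix R :: real assume R: "R > 0"
    have "epow (ennreal (mo * R powr (n + (a * q + \<beta>) + 1 - c * q))) (1/q) * ennreal (mm * R powr (n + b + 1)) \<le> ennreal C * epow (ennreal (mi * R powr (n + \<alpha> + 1))) (1/p)"
      using T[OF test_pair_cyl[OF \<delta> R]] unfolding mo[OF R] mm[OF R] mi[OF R] by simp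
    also have "\<dots> \<le> ennreal C' * epow (ennreal (mi * R powr (n + \<alpha> + 1))) (1/p)"
      by (intro mult_right_mono C') simp
    finally have "(mo * R powr (n + (a * q + \<beta>) + 1 - c * q)) powr (1/q) * (mm * R powr (n + b + 1)) \<le> C' * (mi * R powr (n + \<alpha> + 1)) powr (1/p)"
      using m C' by (simp add: epow_ennreal ennreal_mult[symmetric])
    then have "mo powr (1/q) * mm * (R powr ((n + (a * q + \<beta>) + 1 - c * q) / q) * R powr (n + b + 1)) \<le> C' * mi powr (1/p) * R powr ((n + \<alpha> + 1) / p)"
      using m by (simp add: powr_mult powr_powr ac_simps)
    moreover have "R powr ((n + (a * q + \<beta>) + 1 - c * q) / q) * R powr (n + b + 1) = R powr E * R powr ((n + \<alpha> + 1) / p)"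
      by (simp add: powr_add[symmetric] E_def)
    ultimately have "(mo powr (1/q) * mm * R powr E) * R powr ((n + \<alpha> + 1) / p) \<le> (C' * mi powr (1/p)) * R powr ((n + \<alpha> + 1) / p)"
      by (simp add: ac_simps)
    then have "mo powr (1/q) * mm * R powr E \<le> C' * mi powr (1/p)"
      using R by (subst (asm) mult_le_cancel_right_pos) auto
    then show "R powr E \<le> C' * mi powr (1/p) / (mo powr (1/q) * mm)"
      using m by (simp add: pos_le_divide_eq mult.commute)
  qed
  then show c: "c = n + 1 + a + b + ((n + 1 + \<beta>) / q - (n + 1 + \<alpha>) / p)"
    using q0 unfolding E_def by (simp add: add_divide_distrib diff_divide_distrib)
  define K where "K = 2 * 4 ^ (CARD('n) - 1) * \<delta> ^ CARD('n)"
  have K: "K > 0" using \<delta> by (simp add: K_def)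
  have mm1: "test_mass k b (cyl k \<delta> 1 1 2) (\<lambda>_. 1) = ennreal mm" and mi1: "test_in k p \<alpha> (cyl k \<delta> 1 1 2) (\<lambda>_. 1) = ennreal mi"
    and mo1: "test_out k a c q \<beta> (cyl k \<delta> 1 1 2) (\<lambda>_. 1) = ennreal mo"
    using mo[of 1] mm[of 1] mi[of 1] by auto
  \<comment> \<open>With \<open>U\<close> the unit cylinder and \<open>g = 1\<close>, mass and input
    norm are positive and finite, so the output must be finite for every admissible
    \<open>Z\<close>. The next two conditions are proved by exhibiting an infinite output.\<close>
  have finite_out: "test_out k a c q \<beta> Z M \<noteq> top" if t: "test_pair k \<delta> Z (cyl k \<delta> 1 1 2) M (\<lambda>_. 1)" for Z M
  proof
    assume top: "test_out k a c q \<beta> Z M = top"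
    have "epow (test_out k a c q \<beta> Z M) (1/q) * ennreal mm \<le> ennreal C * epow (ennreal mi) (1/p)"
      using T[OF t] unfolding mm1 mi1 by simp
    then show False unfolding top using m by (auto simp: ennreal_top_mult top_unique ennreal_mult_eq_top_iff)
  qed
  show a: "- q * a < \<beta> + 1"
  proof (rule ccontr)
    assume "\<not> - q * a < \<beta> + 1"
    then have s: "a * q + \<beta> \<le> -1" by (simp add: mult.commute)
    \<comment> \<open>\<open>U\<close> keeps the kernel at scale 1 while \<open>Z\<close> reaches
      the boundary, so the output is a multiple of the integral of
      \<open>\<tau> powr (a * q + \<beta>)\<close> over heights from 0 to 1.\<close>
    have "test_pair k \<delta> (cyl k \<delta> 1 0 1) (cyl k \<delta> 1 1 2) (\<lambda>_. 1) (\<lambda>_. 1)"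
      unfolding test_pair_def close_def
    proof (intro conjI ballI)
      fix z u assume z: "z \<in> cyl k \<delta> 1 0 1" and u: "u \<in> cyl k \<delta> 1 1 2"
      show "1 \<le> rho k z + rho k u" "rho k z + rho k u \<le> 4 * 1" using cyl_rho[OF z] cyl_rho[OF u] by auto
      show "near k \<delta> 1 z" "near k \<delta> 1 u" using cyl_near z u \<delta> by blast+
    qed (use cyl_TB[of 0 k \<delta> 1 1] cyl_TB[of 1 k \<delta> 1 2] in auto)
    from finite_out[OF this] show False
      using K \<delta> nn_integral_powr_0_1_infinite[OF s] nn_integral_cyl[of "\<lambda>\<tau>. \<tau> powr (a * q + \<beta>)" \<delta> 1 k 0 1]
      by (simp add: test_out_def ennreal_mult_top)
  qed
  show "\<alpha> < b" if p1: "p = 1"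
  proof (rule ccontr)
    assume "\<not> \<alpha> < b"
    then have ba: "b \<le> \<alpha>" by simp
    have "c * q = a * q + q * (b - \<alpha>) + n + 1 + \<beta>" using q0 unfolding c p1 by (simp add: field_simps)
    moreover have "q * (b - \<alpha>) \<le> 0" using ba q0 by (simp add: mult_nonneg_nonpos)
    ultimately have s: "n - c * q + (a * q + \<beta>) \<ge> -1" by simp
    \<comment> \<open>In the cone the scale is the height of \<open>z\<close> itself. The slice at
      height \<open>\<tau>\<close> contributes \<open>\<tau>\<close> to the power n and the kernel
      \<open>\<tau> powr (- c * q)\<close>, which gives the exponent in \<open>s\<close> and a
      divergence at infinity.\<close>
    let ?Z = "cylinder k (\<lambda>\<tau>. \<delta> * \<tau>) {1<..}"
    have "test_pair k \<delta> ?Z (cyl k \<delta> 1 1 2) (rho k) (\<lambda>_. 1)"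
      unfolding test_pair_def close_def
    proof (intro conjI ballI)
      show "?Z \<in> sets borel" by (rule measurable_cylinder) auto
      show "?Z \<subseteq> TB k" by (auto simp: cylinder_def TB_iff)
      fix z u assume z: "z \<in> ?Z" and u: "u \<in> cyl k \<delta> 1 1 2"
      have z1: "rho k z > 1" using z by (simp add: cylinder_def)
      then show "0 < rho k z" by simp
      show "rho k z \<le> rho k z + rho k u" "rho k z + rho k u \<le> 4 * rho k z" using z1 cyl_rho[OF u] by auto
      show "near k \<delta> (rho k z) z" using z by (auto simp: cylinder_def near_def)
      show "near k \<delta> (rho k z) u" using cyl_near[OF u _ \<delta>, of "rho k z"] z1 by simp
    qed (use cyl_TB[of 1 k \<delta> 1 2] in auto)
    from finite_out[OF this] have "test_out k a c q \<beta> ?Z (rho k) \<noteq> top" .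
    moreover have "test_out k a c q \<beta> ?Z (rho k) = top"
    proof -
      have "test_out k a c q \<beta> ?Z (rho k) = (\<integral>\<^sup>+\<tau>. indicator {1<..} \<tau> * (ennreal (2 * 4 ^ (CARD('n) - 1) * (\<delta> * \<tau>) ^ CARD('n)) * ennreal (\<tau> powr (- c * q) * \<tau> powr (a * q + \<beta>))) \<partial>lborel)"
        unfolding test_out_def using \<delta> by (intro nn_integral_cylinder[of _ _ "\<lambda>\<tau>. ennreal (\<tau> powr (- c * q) * \<tau> powr (a * q + \<beta>))"]) auto
      also have "\<dots> = (\<integral>\<^sup>+\<tau>. ennreal K * (indicator {1<..} \<tau> * ennreal (\<tau> powr (n - c * q + (a * q + \<beta>)))) \<partial>lborel)"
      proof (rule nn_integral_cong)
        fix \<tau> :: real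
        show "indicator {1<..} \<tau> * (ennreal (2 * 4 ^ (CARD('n) - 1) * (\<delta> * \<tau>) ^ CARD('n)) * ennreal (\<tau> powr (- c * q) * \<tau> powr (a * q + \<beta>))) = ennreal K * (indicator {1<..} \<tau> * ennreal (\<tau> powr (n - c * q + (a * q + \<beta>))))"
        proof (cases "\<tau> > 1")
          case True
          have "\<tau> ^ CARD('n) * (\<tau> powr (- c * q) * \<tau> powr (a * q + \<beta>)) = \<tau> powr (n - c * q + (a * q + \<beta>))"
            using True by (simp add: powr_realpow[symmetric] powr_add[symmetric] n_def algebra_simps)
          then have "2 * 4 ^ (CARD('n) - 1) * (\<delta> * \<tau>) ^ CARD('n) * (\<tau> powr (- c * q) * \<tau> powr (a * q + \<beta>)) = K * \<tau> powr (n - c * q + (a * q + \<beta>))"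
            by (simp add: K_def power_mult_distrib mult.assoc)
          then show ?thesis using True \<delta> K by (simp add: ennreal_mult[symmetric])
        qed simp
      qed
      also have "\<dots> = ennreal K * (\<integral>\<^sup>+\<tau>. indicator {1<..} \<tau> * ennreal (\<tau> powr (n - c * q + (a * q + \<beta>))) \<partial>lborel)"
        by (rule nn_integral_cmult) simp
      finally show ?thesis using K nn_integral_powr_1_inf_infinite[OF s] by (simp add: ennreal_mult_top)
    qed
    ultimately show False by simp
  qed
  show "\<alpha> + 1 < p * (b + 1)" if p1: "p > 1"
  proof (rule ccontr)
    assume "\<not> \<alpha> + 1 < p * (b + 1)"
    then have s: "- (b + 1) * p + \<alpha> \<ge> -1" by (simp add: algebra_simps)
    define A0 where "A0 = mo powr (1/q)"
    have A0: "A0 > 0" using m by (simp add: A0_def)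
    \<comment> \<open>The function \<open>rho powr - (b + 1)\<close> makes the mass integral
      logarithmic. If the condition fails, the p-th power of its norm is at most the same logarithm
      y, so y is bounded by a multiple of \<open>y powr (1/p)\<close> for every y, which is
      impossible for \<open>p > 1\<close>.\<close>
    have "1 - 1/p = 0"
    proof (rule powr_bounded_imp_exponent_zero)
      fix y :: real assume y: "y > 0"
      define L where "L = y / K"
      have L: "L > 0" "K * L = y" using y K by (auto simp: L_def)
      \<comment> \<open>Chosen so that \<open>K * ln (1 / \<epsilon>) = y\<close>: the mass of the
        test function is then exactly \<open>y\<close>.\<close>
      define \<epsilon> where "\<epsilon> = exp (- L)"
      have \<epsilon>: "0 < \<epsilon>" "\<epsilon> < 1" "ln (1 / \<epsilon>) = L" using L by (auto simp: \<epsilon>_def ln_div)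
      let ?U = "cyl k \<delta> 1 \<epsilon> 1" and ?g = "\<lambda>u. rho k u powr - (b + 1)"
      have tp: "test_pair k \<delta> (cyl k \<delta> 1 1 2) ?U (\<lambda>_. 1) ?g"
        unfolding test_pair_def close_def
      proof (intro conjI ballI)
        fix z u assume z: "z \<in> cyl k \<delta> 1 1 2" and u: "u \<in> cyl k \<delta> 1 \<epsilon> 1"
        show "1 \<le> rho k z + rho k u" "rho k z + rho k u \<le> 4 * 1" using cyl_rho[OF z] cyl_rho[OF u] \<epsilon> by auto
        show "near k \<delta> 1 z" "near k \<delta> 1 u" using cyl_near z u \<delta> by blast+
      qed (use cyl_TB[of \<epsilon> k \<delta> 1 1] cyl_TB[of 1 k \<delta> 1 2] \<epsilon> in auto)
      have base: "(\<integral>\<^sup>+u. indicator ?U u * ennreal (rho k u powr -1) \<partial>lborel) = ennreal y"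
      proof -
        have "(\<integral>\<^sup>+u. indicator ?U u * ennreal (rho k u powr -1) \<partial>lborel) = ennreal K * ennreal (ln (1 / \<epsilon>))"
          unfolding K_def using nn_integral_cyl[of "\<lambda>\<tau>. \<tau> powr -1" \<delta> 1 k \<epsilon> 1] nn_integral_inverse_interval[of \<epsilon> 1] \<delta> \<epsilon>
          by (simp only: mult_1_right) auto
        also have "\<dots> = ennreal y" unfolding \<epsilon>(3) using K L by (simp add: ennreal_mult[symmetric])
        finally show ?thesis .
      qed
      have mass: "test_mass k b ?U ?g = ennreal y"
        unfolding base[symmetric] test_mass_def by (intro nn_integral_cong) (simp add: powr_add[symmetric])
      have inle: "test_in k p \<alpha> ?U ?g \<le> ennreal y"
        unfolding base[symmetric] test_in_def
      proof (rule nn_integral_mono)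
        fix u
        show "indicator ?U u * ennreal (?g u powr p * rho k u powr \<alpha>) \<le> indicator ?U u * ennreal (rho k u powr -1)"
        proof (cases "u \<in> ?U")
          case True
          have "?g u powr p * rho k u powr \<alpha> = rho k u powr (- (b + 1) * p + \<alpha>)" by (simp only: powr_powr powr_add)
          also have "\<dots> \<le> rho k u powr -1" using s cyl_rho[OF True] \<epsilon> by (intro powr_mono') auto
          finally show ?thesis using True by (simp add: ennreal_leI)
        qed simp
      qed
      have "epow (ennreal mo) (1/q) * ennreal y \<le> ennreal C * epow (test_in k p \<alpha> ?U ?g) (1/p)"
        using T[OF tp] inle unfolding mass mo1 by (simp add: order_le_less_trans)
      also have "\<dots> \<le> ennreal C' * epow (ennreal y) (1/p)"
        using p0 by (intro mult_mono C' epow_mono inle) auto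
      finally have le: "A0 * y \<le> C' * y powr (1/p)"
        using m y C' by (simp add: A0_def epow_ennreal ennreal_mult[symmetric])
      have "A0 * y powr (1 - 1/p) * y powr (1/p) \<le> C' * y powr (1/p)"
        using le y by (simp add: mult.assoc powr_add[symmetric])
      then have "A0 * y powr (1 - 1/p) \<le> C'" using y by (subst (asm) mult_le_cancel_right_pos) auto
      then show "y powr (1 - 1/p) \<le> C' / A0" using A0 by (simp add: pos_le_divide_eq mult.commute)
    qed
    then show False using p1 by simp
  qed
qed


text \<open>With the unit cylinder in one variable, its three test quantities are positive finite
  constants. Dividing by them turns the product inequality into the scalar one for the other
  variable.\<close>

lemma bounded_op_imp_kernel_conditions:
  fixes k :: "'n::finite"
  defines "n \<equiv> real CARD('n)"
  assumes p2: "1 < p2" and q: "1 \<le> q1" "1 \<le> q2"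
    and bd: "bounded_op k K (a1,a2) (b1,b2) (1,p2) (\<alpha>1,\<alpha>2) (q1,q2) (\<beta>1,\<beta>2)"
    and coh: "coherent_kernel k c1 c2 K"
  shows "\<alpha>1 < b1 \<and> \<alpha>2 + 1 < p2 * (b2 + 1) \<and> - q1 * a1 < \<beta>1 + 1 \<and> - q2 * a2 < \<beta>2 + 1
    \<and> c1 = n + 1 + a1 + b1 + ((n + 1 + \<beta>1) / q1 - (n + 1 + \<alpha>1))
    \<and> c2 = n + 1 + a2 + b2 + ((n + 1 + \<beta>2) / q2 - (n + 1 + \<alpha>2) / p2)"
proof -
  obtain \<delta> \<kappa> where \<delta>: "\<delta> > 0" and \<kappa>: "\<kappa> > 0"
    and low: "\<And>z w u \<eta> M1 M2. close k \<delta> M1 z u \<Longrightarrow> close k \<delta> M2 w \<eta> \<Longrightarrow> \<kappa> * (M1 powr - c1 * M2 powr - c2) \<le> Re (K z w u \<eta>)"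
    using coh unfolding coherent_kernel_def by blast
  obtain C where C: "\<And>Z1 U1 M1 g1 Z2 U2 M2 g2. test_pair k \<delta> Z1 U1 M1 g1 \<Longrightarrow> test_pair k \<delta> Z2 U2 M2 g2 \<Longrightarrow>
    test_mass k b1 U1 g1 < \<infinity> \<Longrightarrow> test_mass k b2 U2 g2 < \<infinity> \<Longrightarrow> test_in k 1 \<alpha>1 U1 g1 < \<infinity> \<Longrightarrow> test_in k p2 \<alpha>2 U2 g2 < \<infinity> \<Longrightarrow>
    (epow (test_out k a1 c1 q1 \<beta>1 Z1 M1) (1/q1) * test_mass k b1 U1 g1) * (epow (test_out k a2 c2 q2 \<beta>2 Z2 M2) (1/q2) * test_mass k b2 U2 g2)
    \<le> ennreal C * (test_in k 1 \<alpha>1 U1 g1 * epow (test_in k p2 \<alpha>2 U2 g2) (1/p2))"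
    using test_inequality[OF p2 q bd \<kappa> low] by blast
  let ?E = "cyl k \<delta> 1 1 2"
  have E: "test_pair k \<delta> ?E ?E (\<lambda>_. 1) (\<lambda>_. 1)" using test_pair_cyl[OF \<delta>, of 1 k] by simp
  have ref: "\<exists>o' m' i'. o' > 0 \<and> m' > 0 \<and> i' > 0 \<and> test_out k a c q \<beta> ?E (\<lambda>_. 1) = ennreal o' \<and> test_mass k b ?E (\<lambda>_. 1) = ennreal m' \<and> test_in k p \<alpha> ?E (\<lambda>_. 1) = ennreal i'"
    for a b c q \<beta> p \<alpha>
  proof -
    obtain mo mm mi where m: "mo > 0" "mm > 0" "mi > 0"
      and mo: "\<And>R. R > 0 \<Longrightarrow> test_out k a c q \<beta> (cyl k \<delta> R R (2*R)) (\<lambda>_. R) = ennreal (mo * R powr (real CARD('n) + (a * q + \<beta>) + 1 - c * q))"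
      and mm: "\<And>R. R > 0 \<Longrightarrow> test_mass k b (cyl k \<delta> R R (2*R)) (\<lambda>_. 1) = ennreal (mm * R powr (real CARD('n) + b + 1))"
      and mi: "\<And>R. R > 0 \<Longrightarrow> test_in k p \<alpha> (cyl k \<delta> R R (2*R)) (\<lambda>_. 1) = ennreal (mi * R powr (real CARD('n) + \<alpha> + 1))"
      using test_cyl[OF \<delta>, of k a c q \<beta> b p \<alpha>] by blast
    show ?thesis using m mo[of 1] mm[of 1] mi[of 1] by auto
  qed
  have cancel: "X \<le> ennreal (max C 0 * j / r) * Y" if "X * ennreal r \<le> ennreal C * (Y * ennreal j)" "r > 0" "j > 0" for X Y r j
  proof -
    have "X = ennreal (1 / r) * (X * ennreal r)"
    proof -
      have "ennreal (1 / r) * ennreal r = 1" using that by (simp add: ennreal_mult[symmetric])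
      then show ?thesis by (metis mult.assoc mult.commute mult_1)
    qed
    also have "\<dots> \<le> ennreal (1 / r) * (ennreal (max C 0) * (Y * ennreal j))"
      by (intro mult_left_mono order_trans[OF that(1)] mult_right_mono ennreal_leI) auto
    also have "\<dots> = (ennreal (1 / r) * ennreal (max C 0) * ennreal j) * Y" by (simp add: ac_simps)
    also have "ennreal (1 / r) * ennreal (max C 0) * ennreal j = ennreal (max C 0 * j / r)"
      using that by (simp add: ennreal_mult[symmetric])
    finally show ?thesis .
  qed
  obtain o1 m1 i1 where r1: "o1 > 0" "m1 > 0" "i1 > 0"
    and r1': "test_out k a1 c1 q1 \<beta>1 ?E (\<lambda>_. 1) = ennreal o1" "test_mass k b1 ?E (\<lambda>_. 1) = ennreal m1" "test_in k 1 \<alpha>1 ?E (\<lambda>_. 1) = ennreal i1"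
    using ref[of a1 c1 q1 \<beta>1 b1 1 \<alpha>1] by blast
  obtain o2 m2 i2 where r2: "o2 > 0" "m2 > 0" "i2 > 0"
    and r2': "test_out k a2 c2 q2 \<beta>2 ?E (\<lambda>_. 1) = ennreal o2" "test_mass k b2 ?E (\<lambda>_. 1) = ennreal m2" "test_in k p2 \<alpha>2 ?E (\<lambda>_. 1) = ennreal i2"
    using ref[of a2 c2 q2 \<beta>2 b2 p2 \<alpha>2] by blast
  have T1: "epow (test_out k a1 c1 q1 \<beta>1 Z M) (1/q1) * test_mass k b1 U g \<le> ennreal (max C 0 * i2 powr (1/p2) / (o2 powr (1/q2) * m2)) * epow (test_in k 1 \<alpha>1 U g) (1/1)"
    if "test_pair k \<delta> Z U M g" "test_mass k b1 U g < \<infinity>" "test_in k 1 \<alpha>1 U g < \<infinity>" for Z U M g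
  proof (rule cancel)
    show "epow (test_out k a1 c1 q1 \<beta>1 Z M) (1/q1) * test_mass k b1 U g * ennreal (o2 powr (1/q2) * m2) \<le> ennreal C * (epow (test_in k 1 \<alpha>1 U g) (1/1) * ennreal (i2 powr (1/p2)))"
      using C[OF that(1) E that(2) _ that(3)] r2 by (simp add: r2' epow_ennreal ennreal_mult)
  qed (use r2 in auto)
  have T2: "epow (test_out k a2 c2 q2 \<beta>2 Z M) (1/q2) * test_mass k b2 U g \<le> ennreal (max C 0 * i1 / (o1 powr (1/q1) * m1)) * epow (test_in k p2 \<alpha>2 U g) (1/p2)"
    if "test_pair k \<delta> Z U M g" "test_mass k b2 U g < \<infinity>" "test_in k p2 \<alpha>2 U g < \<infinity>" for Z U M g
  proof (rule cancel)
    show "epow (test_out k a2 c2 q2 \<beta>2 Z M) (1/q2) * test_mass k b2 U g * ennreal (o1 powr (1/q1) * m1) \<le> ennreal C * (epow (test_in k p2 \<alpha>2 U g) (1/p2) * ennreal i1)"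
      using C[OF E that(1) _ that(2) _ that(3)] r1 by (simp add: r1' epow_ennreal ennreal_mult mult.commute)
  qed (use r1 in auto)
  \<comment> \<open>The first variable has input exponent 1 and yields the clause for
    \<open>p = 1\<close>; the second has input exponent \<open>p2\<close> and yields the clause for
    \<open>p > 1\<close>.\<close>
  note S1 = scalar_test_conditions[OF \<delta> order_refl q(1) T1, folded n_def]
    and S2 = scalar_test_conditions[OF \<delta> less_imp_le[OF p2] q(2) T2, folded n_def]
  show ?thesis using S1(1-3) S2(1,2,4) p2 by simp
qed

theorem theorem6p4:
  fixes k :: "'n::finite"
    and p2 q1 q2 a1 a2 b1 b2 c1 c2 \<alpha>1 \<alpha>2 \<beta>1 \<beta>2 :: real
  assumes "1 < p2" "p2 \<le> min q1 q2"
    and "\<alpha>1 > -1" "\<alpha>2 > -1" "\<beta>1 > -1" "\<beta>2 > -1"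
  defines "n \<equiv> real CARD('n)"
  shows "(bounded_op k (KS k (c1,c2)) (a1,a2) (b1,b2) (1,p2) (\<alpha>1,\<alpha>2) (q1,q2) (\<beta>1,\<beta>2)
            \<longleftrightarrow> bounded_op k (KT k (c1,c2)) (a1,a2) (b1,b2) (1,p2) (\<alpha>1,\<alpha>2) (q1,q2) (\<beta>1,\<beta>2))
       \<and> (bounded_op k (KT k (c1,c2)) (a1,a2) (b1,b2) (1,p2) (\<alpha>1,\<alpha>2) (q1,q2) (\<beta>1,\<beta>2)
            \<longleftrightarrow> (\<alpha>1 < b1 \<and> \<alpha>2 + 1 < p2 * (b2 + 1)
                 \<and> - q1 * a1 < \<beta>1 + 1 \<and> - q2 * a2 < \<beta>2 + 1
                 \<and> c1 = n + 1 + a1 + b1 + ((n + 1 + \<beta>1) / q1 - (n + 1 + \<alpha>1))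
                 \<and> c2 = n + 1 + a2 + b2 + ((n + 1 + \<beta>2) / q2 - (n + 1 + \<alpha>2) / p2)))"
proof -
  have q: "1 \<le> q1" "1 \<le> q2" "p2 \<le> q2" using assms(1,2) by auto
  \<comment> \<open>The condition on the right does not mention the kernel, so the instances for
    \<open>KS\<close> and \<open>KT\<close> also give the equivalence of the two boundedness
    statements.\<close>
  have "bounded_op k K (a1,a2) (b1,b2) (1,p2) (\<alpha>1,\<alpha>2) (q1,q2) (\<beta>1,\<beta>2)
      \<longleftrightarrow> (\<alpha>1 < b1 \<and> \<alpha>2 + 1 < p2 * (b2 + 1)
           \<and> - q1 * a1 < \<beta>1 + 1 \<and> - q2 * a2 < \<beta>2 + 1
           \<and> c1 = n + 1 + a1 + b1 + ((n + 1 + \<beta>1) / q1 - (n + 1 + \<alpha>1))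
           \<and> c2 = n + 1 + a2 + b2 + ((n + 1 + \<beta>2) / q2 - (n + 1 + \<alpha>2) / p2))"
    if "coherent_kernel k c1 c2 K" "power_kernel k c1 c2 K" for K
    using bounded_op_imp_kernel_conditions[OF assms(1) q(1,2) _ that(1), folded n_def]
      kernel_conditions_imp_bounded_op[OF assms(1) q(1,3) that(2), folded n_def] by blast
  from this[OF coherent_KS power_kernel_KS] this[OF coherent_KT power_kernel_KT]
  show ?thesis by simp
qed

end
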